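(* Let $n\ge 1$, let $Q$ and $B$ be real $n\times n$ matrices with $Q$ symmetric positive semidefinite, and assume the Kalman rank condition $$\mathrm{Rank}\,[Q^{1/2},BQ^{1/2},\dots,B^{n-1}Q^{1/2}]=n .$$ Let $T>0$ and let $\omega\subset\mathbb{R}^n$ be an open set such that $$\exists \delta,r>0,\ \forall y\in\mathbb{R}^n,\ \exists y'\in\omega,\quad B(y',r)\subset\omega \ \text{ and }\ |y-y'|<\delta .$$ Then the Ornstein-Uhlenbeck equation posed in $L^2(\mathbb{R}^n)$ $$\partial_t f(t,x)-\tfrac12\mathrm{Tr}[Q\nabla_x^2 f(t,x)]-\langle Bx,\nabla_x f(t,x)\rangle=u(t,x)\mathbf 1_{\omega}(x),\quad x\in\mathbb{R}^n,\qquad f|_{t=0}=f_0\in L^2(\mathbb{R}^n),$$ is null-controllable from the set $\omega$ in time $T$.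
   Context: $Q^{1/2}$ is the symmetric positive semidefinite square root of $Q$, and $[Q^{1/2},BQ^{1/2},\dots,B^{n-1}Q^{1/2}]$ is the $n\times n^2$ matrix obtained by writing consecutively the columns of the matrices $B^jQ^{1/2}$. $B(y',r)$ is the Euclidean ball of center $y'$ and radius $r$. $\mathrm{Tr}(Q\nabla_x^2)=\sum_{i,j}q_{i,j}\partial^2_{x_i,x_j}$ and $\langle Bx,\nabla_x\rangle=\sum_{i,j}b_{i,j}x_j\partial_{x_i}$. The operator $P=\frac12\mathrm{Tr}(Q\nabla_x^2)+\langle Bx,\nabla_x\rangle$ is considered on $L^2(\mathbb{R}^n)$ (Lebesgue measure) with domain $\{g\in L^2: Pg\in L^2\}$; it generates the strongly continuous semigroup $$(e^{tP}f)(x)=\frac{1}{(2\pi)^{n/2}\sqrt{\det Q_t}}\int_{\mathbb{R}^n}e^{-\frac12\langle Q_t^{-1}y,y\rangle}f(e^{tB}x-y)\,dy,\quad t>0,\qquad Q_t=\int_0^te^{sB}Qe^{sB^T}ds .$$ The mild solution is $f(t)=e^{tP}f_0+\int_0^te^{(t-s)P}(\mathbf 1_\omega u(s,\cdot))\,ds$. Null-controllable from $\omega$ in time $T$ means: for every $f_0\in L^2(\mathbb{R}^n)$ there exists $u\in L^2((0,T)\times\mathbb{R}^n)$, supported in $(0,T)\times\omega$, such that the mild solution satisfies $f(T,\cdot)=0$. *)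

theory Defs
  imports "HOL-Analysis.Analysis"
begin

text \<open>
  The dimension is \<open>n = CARD('n)\<close>. Note that the library's multiplication (and hence \<open>^\<close> and \<open>exp\<close>)
  on the type of vectors is componentwise, so powers and exponentials of matrices with respect to
  the matrix product are introduced here.
\<close>

definition matpow :: "real^'n^'n \<Rightarrow> nat \<Rightarrow> real^'n^'n" where
  "matpow A k = (((**) A) ^^ k) (mat 1)"

definition mexp :: "real^'n^'n \<Rightarrow> real^'n^'n" where
  "mexp A = (\<Sum>k. (1 / fact k) *\<^sub>R matpow A k)"

definition sym_psd :: "real^'n^'n \<Rightarrow> bool" where
  "sym_psd A \<longleftrightarrow> transpose A = A \<and> (\<forall>x. 0 \<le> (A *v x) \<bullet> x)"

text \<open>Meaningful for symmetric positive semidefinite \<open>Q\<close>; there the root exists and is unique.\<close>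

definition msqrt :: "real^'n^'n \<Rightarrow> real^'n^'n" where
  "msqrt Q = (THE R. sym_psd R \<and> R ** R = Q)"

text \<open>
  The \<open>n \<times> n\<^sup>2\<close> matrix with blocks \<open>B\<^sup>j Q\<^sup>1\<^sup>/\<^sup>2\<close>, \<open>j = 0, \<dots>, n - 1\<close>. Its columns are indexed by pairs:
  \<open>to_nat_on UNIV\<close> is a bijection from \<open>'n\<close> onto \<open>{..<n}\<close>, so the column indexed by \<open>(p, q)\<close> is the
  column \<open>q\<close> of \<open>B\<^sup>j Q\<^sup>1\<^sup>/\<^sup>2\<close> where \<open>j = to_nat_on UNIV p\<close>.
\<close>

definition kalman_matrix :: "real^'n^'n \<Rightarrow> real^'n^'n \<Rightarrow> real^('n \<times> 'n)^'n" where
  "kalman_matrix Q B =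
     (\<chi> i c. (matpow B (to_nat_on (UNIV :: 'n set) (fst c)) ** msqrt Q) $ i $ snd c)"

text \<open>
  Elements of complex \<open>L\<^sup>2\<close> spaces are given by Borel measurable representatives (every class has one).
\<close>

definition L2_on :: "'a::euclidean_space set \<Rightarrow> ('a \<Rightarrow> complex) \<Rightarrow> bool" where
  "L2_on S f \<longleftrightarrow> set_borel_measurable lborel S f \<and> set_integrable lborel S (\<lambda>x. (cmod (f x))\<^sup>2)"

definition ou_covariance :: "real^'n^'n \<Rightarrow> real^'n^'n \<Rightarrow> real \<Rightarrow> real^'n^'n" where
  "ou_covariance Q B t = integral {0..t} (\<lambda>s. mexp (s *\<^sub>R B) ** Q ** mexp (s *\<^sub>R transpose B))"

text \<open>The semigroup generated by \<open>P = 1/2 Tr(Q \<nabla>\<^sup>2) + \<langle>B x, \<nabla>\<rangle>\<close>, for \<open>t > 0\<close> only.\<close>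

definition ou_semigroup ::
  "real^'n^'n \<Rightarrow> real^'n^'n \<Rightarrow> real \<Rightarrow> (real^'n \<Rightarrow> complex) \<Rightarrow> real^'n \<Rightarrow> complex" where
  "ou_semigroup Q B t f x =
     complex_of_real
       (1 / ((2 * pi) powr (real CARD('n) / 2) * sqrt (det (ou_covariance Q B t)))) *
     (LINT y|lborel.
        complex_of_real (exp (- (1/2) * ((matrix_inv (ou_covariance Q B t) *v y) \<bullet> y))) *
        f (mexp (t *\<^sub>R B) *v x - y))"

text \<open>The integrand \<open>s \<mapsto> (e\<^bsup>(t-s)P\<^esup> (1\<^sub>\<omega> u(s, \<sqdot>)))(x)\<close> in Duhamel's formula.\<close>

definition duhamel_integrand ::
  "real^'n^'n \<Rightarrow> real^'n^'n \<Rightarrow> (real^'n) set \<Rightarrow> (real \<times> (real^'n) \<Rightarrow> complex) \<Rightarrow>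
   real \<Rightarrow> real^'n \<Rightarrow> real \<Rightarrow> complex" where
  "duhamel_integrand Q B \<omega> u t x s = ou_semigroup Q B (t - s) (\<lambda>y. indicator \<omega> y * u (s, y)) x"

text \<open>
  On representatives, the \<open>L\<^sup>2\<close>-valued integral in Duhamel's formula is computed at almost every \<open>x\<close>
  as an integral of complex-valued functions (Fubini).
\<close>

definition mild_solution ::
  "real^'n^'n \<Rightarrow> real^'n^'n \<Rightarrow> (real^'n) set \<Rightarrow> (real^'n \<Rightarrow> complex) \<Rightarrow>
   (real \<times> (real^'n) \<Rightarrow> complex) \<Rightarrow> real \<Rightarrow> real^'n \<Rightarrow> complex" where
  "mild_solution Q B \<omega> f0 u t x =
     ou_semigroup Q B t f0 x + (LINT s:{0<..<t}|lborel. duhamel_integrand Q B \<omega> u t x s)"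

text \<open>
  The control is extended by zero outside \<open>(0, T) \<times> \<omega>\<close>. Since the Bochner integral of a non-integrable
  function is \<open>0\<close> by convention, the convergence of the integral in Duhamel's formula at almost every
  \<open>x\<close> is required explicitly.
\<close>

definition ou_null_controllable ::
  "real^'n^'n \<Rightarrow> real^'n^'n \<Rightarrow> (real^'n) set \<Rightarrow> real \<Rightarrow> bool" where
  "ou_null_controllable Q B \<omega> T \<longleftrightarrow>
     (\<forall>f0. L2_on UNIV f0 \<longrightarrow>
       (\<exists>u. L2_on ({0<..<T} \<times> UNIV) u \<and>
            (\<forall>p. p \<notin> {0<..<T} \<times> \<omega> \<longrightarrow> u p = 0) \<and>
            (AE x in lborel. set_integrable lborel {0<..<T} (duhamel_integrand Q B \<omega> u T x)) \<and>
            (AE x in lborel. mild_solution Q B \<omega> f0 u T x = 0)))"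

end

theory Submission
  imports Defs "HOL-Probability.Distributions"
begin

text \<open>
  The control is explicit; neither duality nor a spectral inequality is needed. Choose disjoint cubes
  of fixed size, each containing a ball \<open>B(y, r) \<subseteq> \<omega>\<close>. For \<open>M + 1\<close> equidistant nodes \<open>t\<^sub>j\<close> in a small
  interval \<open>[\<rho>/2, \<rho>]\<close>, the operator \<open>S\<close> moves the mass of \<open>F\<close> at \<open>x\<close> to the points \<open>y + t\<^sub>j (x - y)\<close>, which
  lie in \<open>\<omega>\<close>, with the weights that extrapolate polynomials of degree at most \<open>M\<close> from the nodes to \<open>1\<close>.
  Its norm is at most \<open>C\<^sup>M\<close>. As Gaussians are entire functions, \<open>e\<^bsup>tP\<^esup> (S - 1)\<close> is of size \<open>\<epsilon>\<^sup>M\<close> with \<open>\<epsilon>\<close> as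
  small as we like, provided that \<open>M\<close> is a large multiple of \<open>1 / \<lambda>\<close>, where \<open>\<lambda>\<close> is the least eigenvalue of
  \<open>Q\<^sub>t\<close>; the Kalman condition gives \<open>\<lambda> \<ge> c t\<^sup>\<kappa>\<close>.

  On a time interval \<open>(a, a + 2\<theta>)\<close> with state \<open>f\<close> at time \<open>a\<close>, apply during the first half the control
  \<open>-(1/\<theta>) S e\<^bsup>(s-a)P\<^esup> f\<close>. With \<open>1\<close> instead of \<open>S\<close> it would steer \<open>f\<close> exactly to \<open>0\<close>, so the final state is of
  size \<open>\<epsilon>\<^sup>M |f|\<close>. Repeating this on intervals of lengths \<open>T/2, T/4, \<dots>\<close> with \<open>M\<close> growing geometrically, the
  gain \<open>\<epsilon>\<^sup>M\<close> of each step beats the cost of the next one, and the state tends to \<open>0\<close> at time \<open>T\<close>.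
\<close>

section \<open>Square roots of positive semidefinite matrices\<close>

text \<open>The obstacle is that the extrapolation weights grow like q^M, and this growth enters
  both the cost of the control and the error. It is beaten because a Gaussian is entire of order
  two: extrapolation from nodes in [0, 1] to the point 1 has an error of order q^M / R^M * exp
  (const * R^2 / \<lambda>) for every R \<ge> 1, so R may be fixed after q, above any given power of
  it. The exponential is the price of a large R. As \<lambda> is only known to be at least c
  t^\<kappa> and the steps halve in length, the exponent grows by the factor P = 2^\<kappa> per
  step. Letting M grow by the same factor compensates for this, and the next control then costs at
  most a power of q^(P M), which is why R has to exceed a power of q that depends on P.

  Two features keep the bounds uniform. The control rests during the second half of each step, so
  that at least a time \<theta> of smoothing follows it. The cells have a fixed size, so that every
  point is moved by a bounded distance.\<close>

lemma inner_matrix_vector: "(A *v x) \<bullet> y = x \<bullet> (transpose A *v y)" for A :: "real^'n^'m"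
  by (metis dot_lmul_matrix vector_transpose_matrix)

text \<open>A maximiser v of the quadratic form on the unit sphere of S is an eigenvector: the
  residual w = A v - l v lies in S, and moving v along w would raise the Rayleigh quotient above l
  unless w = 0.\<close>

lemma symmetric_eigenvector:
  fixes A :: "real^'n^'n"
  assumes sym: "transpose A = A" and S: "subspace S" "S \<noteq> {0}"
    and inv: "\<And>x. x \<in> S \<Longrightarrow> A *v x \<in> S"
  obtains v l where "v \<in> S" "norm v = 1" "A *v v = l *\<^sub>R v"
proof -
  have cpt: "compact (S \<inter> sphere 0 1)"
    using closed_subspace[OF S(1)] by (simp add: closed_Int_compact)
  obtain z where z: "z \<in> S" "z \<noteq> 0" using S subspace_0 by blast
  have ne: "S \<inter> sphere 0 1 \<noteq> {}"
  proof -
    have "(1 / norm z) *\<^sub>R z \<in> S \<inter> sphere 0 1"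
      using z S(1) by (auto simp: subspace_scale)
    then show ?thesis by blast
  qed
  have cont: "continuous_on (S \<inter> sphere 0 1) (\<lambda>x. (A *v x) \<bullet> x)"
    by (intro continuous_intros linear_continuous_on matrix_vector_mul_bounded_linear)
  obtain v where v: "v \<in> S \<inter> sphere 0 1"
    and vmax: "\<And>x. x \<in> S \<inter> sphere 0 1 \<Longrightarrow> (A *v x) \<bullet> x \<le> (A *v v) \<bullet> v"
    using continuous_attains_sup[OF cpt ne cont] by blast
  define l where "l = (A *v v) \<bullet> v"
  have bound: "(A *v x) \<bullet> x \<le> l * (x \<bullet> x)" if "x \<in> S" for x
  proof (cases "x = 0")
    case False
    define y where "y = (1 / norm x) *\<^sub>R x"
    have "y \<in> S \<inter> sphere 0 1" using that False S(1) by (auto simp: y_def subspace_scale)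
    then have "(A *v y) \<bullet> y \<le> l" using vmax l_def by auto
    moreover have "(A *v y) \<bullet> y = ((A *v x) \<bullet> x) / (norm x)^2"
      by (simp add: y_def matrix_vector_mult_scaleR power2_eq_square)
    ultimately show ?thesis using False
      by (simp add: divide_le_eq power2_norm_eq_inner mult.commute)
  qed auto
  define w where "w = A *v v - l *\<^sub>R v"
  have vS: "v \<in> S" and nv: "norm v = 1" using v by auto
  have wS: "w \<in> S" unfolding w_def using inv vS S(1) by (simp add: subspace_diff subspace_scale)
  have vv: "v \<bullet> v = 1" using nv by (simp add: norm_eq_sqrt_inner)
  have Avw: "(A *v v) \<bullet> w = w \<bullet> w + l * (v \<bullet> w)"
    by (simp add: w_def inner_diff_left inner_diff_right algebra_simps inner_commute)
  have Awv: "(A *v w) \<bullet> v = (A *v v) \<bullet> w"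
    using inner_matrix_vector[of A w v] sym by (simp add: inner_commute)
  define c where "c = l * (w \<bullet> w) - (A *v w) \<bullet> w"
  \<comment> \<open>This is \<open>bound\<close> at v + e w. A parabola in e that vanishes at 0 and
    is never negative has no linear term; if c > 0, the minimiser e = (w \<bullet> w) / c shows
    it.\<close>
  have key: "0 \<le> - 2 * e * (w \<bullet> w) + e^2 * c" for e
  proof -
    have "v + e *\<^sub>R w \<in> S" using vS wS S(1) by (simp add: subspace_add subspace_scale)
    from bound[OF this] show ?thesis
      by (simp add: matrix_vector_right_distrib matrix_vector_mult_scaleR inner_add_left inner_add_right
          Awv Avw vv c_def power2_eq_square algebra_simps inner_commute[of w v] flip: l_def)
  qed
  have "w \<bullet> w = 0"
  proof (cases "c \<le> 0")
    case True
    then show ?thesis using key[of 1] inner_ge_zero[of w] by (simp del: inner_eq_zero_iff inner_ge_zero)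
  next
    case False
    have "- 2 * ((w \<bullet> w) / c) * (w \<bullet> w) + ((w \<bullet> w) / c)^2 * c = - ((w \<bullet> w)^2 / c)"
      using False by (simp add: power2_eq_square field_simps)
    then have "(w \<bullet> w)^2 / c \<le> 0" using key[of "(w \<bullet> w) / c"] by linarith
    then show ?thesis using False by (simp add: divide_le_0_iff)
  qed
  then have "A *v v = l *\<^sub>R v" by (simp add: w_def)
  then show ?thesis using that vS nv by blast
qed

text \<open>Take an orthonormal set of eigenvectors of the largest cardinality. By symmetry its
  orthogonal complement is invariant under A, so a nontrivial complement would contain one more
  eigenvector.\<close>

lemma symmetric_eigenbasis:
  fixes A :: "real^'n^'n"
  assumes sym: "transpose A = A"
  obtains E where "finite E" "pairwise orthogonal E" "\<And>e. e \<in> E \<Longrightarrow> norm e = 1"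
    "\<And>e. e \<in> E \<Longrightarrow> A *v e = ((A *v e) \<bullet> e) *\<^sub>R e" "span E = UNIV"
proof -
  define good where "good E \<longleftrightarrow> finite E \<and> pairwise orthogonal E \<and> (\<forall>e\<in>E. norm e = 1 \<and> A *v e = ((A *v e) \<bullet> e) *\<^sub>R e)" for E
  have good_ind: "independent E" if "good E" for E
    using that by (intro pairwise_orthogonal_independent) (auto simp: good_def)
  have bd: "card E \<le> CARD('n)" if "good E" for E
    using independent_bound_general[OF good_ind[OF that]] by (metis dim_UNIV dim_subset_UNIV_cart order_trans good_ind that dim_eq_card_independent)
  have "\<exists>E. good E \<and> (\<forall>F. good F \<longrightarrow> card F \<le> card E)"
    by (rule ex_has_greatest_nat[of good "{}" card "Suc CARD('n)"]) (use bd in \<open>auto simp: good_def less_Suc_eq_le\<close>)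
  then obtain E where E: "good E" and mx: "\<And>F. good F \<Longrightarrow> card F \<le> card E" by blast
  have "span E = UNIV"
  proof (rule ccontr)
    assume ne: "span E \<noteq> UNIV"
    then obtain z where z: "z \<noteq> 0" "\<And>y. y \<in> span E \<Longrightarrow> orthogonal z y"
      using orthogonal_to_subspace_exists_gen[of E UNIV] by (metis psubsetI span_UNIV subset_UNIV)
    define S where "S = {x. \<forall>e\<in>E. orthogonal x e}"
    have sub: "subspace S" by (auto simp: S_def subspace_def orthogonal_def inner_add_left)
    have "z \<in> S" using z by (auto simp: S_def span_base)
    then have ne0: "S \<noteq> {0}" using z by blast
    have inv: "A *v x \<in> S" if "x \<in> S" for x
    proof -
      have "(A *v x) \<bullet> e = 0" if "e \<in> E" for e
      proof -
        have "(A *v x) \<bullet> e = x \<bullet> (A *v e)" using inner_matrix_vector[of A x e] sym by simp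
        also have "\<dots> = ((A *v e) \<bullet> e) * (x \<bullet> e)" using E that by (metis good_def inner_scaleR_right)
        also have "\<dots> = 0" using \<open>x \<in> S\<close> that by (simp add: S_def orthogonal_def)
        finally show ?thesis .
      qed
      then show ?thesis by (simp add: S_def orthogonal_def)
    qed
    obtain v l where v: "v \<in> S" "norm v = 1" "A *v v = l *\<^sub>R v"
      using symmetric_eigenvector[OF sym sub ne0 inv] by blast
    have "v \<notin> E" using v by (auto simp: S_def orthogonal_def norm_eq_sqrt_inner)
    have "good (insert v E)"
      using E v unfolding good_def
      by (auto simp: S_def pairwise_insert orthogonal_commute norm_eq_1)
    then have "card (insert v E) \<le> card E" by (rule mx)
    then show False using \<open>v \<notin> E\<close> E by (simp add: good_def)
  qed
  then show ?thesis using that E unfolding good_def by blast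
qed

lemma psd_root_exists:
  fixes A :: "real^'n^'n"
  assumes "sym_psd A"
  obtains R where "sym_psd R" "R ** R = A"
proof -
  have sym: "transpose A = A" and psd: "\<And>x. 0 \<le> (A *v x) \<bullet> x" using assms by (auto simp: sym_psd_def)
  obtain E where E: "finite E" "pairwise orthogonal E" "\<And>e. e \<in> E \<Longrightarrow> norm e = 1"
    "\<And>e. e \<in> E \<Longrightarrow> A *v e = ((A *v e) \<bullet> e) *\<^sub>R e" "span E = UNIV"
    using symmetric_eigenbasis[OF sym] by metis
  define f where "f x = (\<Sum>e\<in>E. (sqrt ((A *v e) \<bullet> e) * (x \<bullet> e)) *\<^sub>R e)" for x
  have lin: "linear f"
    by (rule linearI) (simp_all add: f_def inner_add_left algebra_simps sum.distrib scaleR_sum_right)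
  define R where "R = matrix f"
  have Rf: "R *v x = f x" for x using lin by (simp add: R_def matrix_works)
  have fin: "f x \<bullet> y = (\<Sum>e\<in>E. sqrt ((A *v e) \<bullet> e) * (x \<bullet> e) * (y \<bullet> e))" for x y
    by (simp add: f_def inner_sum_left inner_commute[of y])
  have "x \<bullet> (transpose R *v y) = x \<bullet> (R *v y)" for x y
    using inner_matrix_vector[of R x y] fin[of x y] fin[of y x]
    by (simp add: Rf inner_commute mult.commute mult.left_commute)
  then have "transpose R = R"
    by (metis matrix_eq vector_eq_rdot inner_commute)
  moreover have "0 \<le> (R *v x) \<bullet> x" for x
    unfolding Rf fin by (intro sum_nonneg) (simp add: psd mult.assoc)
  ultimately have Rp: "sym_psd R" by (simp add: sym_psd_def)
  have fe: "f e = sqrt ((A *v e) \<bullet> e) *\<^sub>R e" if "e \<in> E" for e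
  proof -
    have "f e = (\<Sum>e'\<in>E. if e' = e then sqrt ((A *v e) \<bullet> e) *\<^sub>R e else 0)"
      unfolding f_def using E that
      by (intro sum.cong) (auto simp: pairwise_def orthogonal_def norm_eq_1)
    then show ?thesis using E that by simp
  qed
  have "(R ** R) *v x = A *v x" for x
  proof -
    have "linear (\<lambda>x. (R ** R) *v x)" "linear (\<lambda>x. A *v x)" by auto
    moreover have "(R ** R) *v e = A *v e" if "e \<in> E" for e
    proof -
      have "(R ** R) *v e = f (f e)" by (simp add: Rf flip: matrix_vector_mul_assoc)
      also have "\<dots> = (sqrt ((A *v e) \<bullet> e) * sqrt ((A *v e) \<bullet> e)) *\<^sub>R e"
        using fe[OF that] lin by (simp add: linear_cmul)
      also have "\<dots> = A *v e" using E(4)[OF that] psd[of e] by simp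
      finally show ?thesis .
    qed
    ultimately show ?thesis using linear_eq_on_span[of "\<lambda>x. (R ** R) *v x" "\<lambda>x. A *v x" E x] E(5) by simp
  qed
  then have "R ** R = A" by (simp add: matrix_eq)
  then show ?thesis using that Rp by blast
qed

text \<open>For an eigenvector e of R' with eigenvalue m, the vector w = R e - m e satisfies R w = -
  m w. If m > 0, positivity of R forces w = 0; if m = 0, then R (R e) = 0 gives |R e|^2 = 0.\<close>

lemma psd_root_unique:
  fixes R R' :: "real^'n^'n"
  assumes R: "sym_psd R" and R': "sym_psd R'" and eq: "R ** R = R' ** R'"
  shows "R = R'"
proof -
  have sym: "transpose R' = R'" using R' by (auto simp: sym_psd_def)
  obtain E where E: "finite E" "pairwise orthogonal E" "\<And>e. e \<in> E \<Longrightarrow> norm e = 1"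
    "\<And>e. e \<in> E \<Longrightarrow> R' *v e = ((R' *v e) \<bullet> e) *\<^sub>R e" "span E = UNIV"
    using symmetric_eigenbasis[OF sym] by metis
  have "R *v e = R' *v e" if "e \<in> E" for e
  proof -
    define m where "m = (R' *v e) \<bullet> e"
    have m0: "0 \<le> m" using R' by (simp add: m_def sym_psd_def)
    have e': "R' *v e = m *\<^sub>R e" using E(4)[OF that] m_def by simp
    have RR: "R *v (R *v e) = (m * m) *\<^sub>R e"
      using eq e' by (simp add: matrix_vector_mul_assoc) (simp add: matrix_vector_mult_scaleR flip: matrix_vector_mul_assoc)
    define w where "w = R *v e - m *\<^sub>R e"
    have Rw: "R *v w = - m *\<^sub>R w"
      by (simp add: w_def matrix_vector_mult_diff_distrib matrix_vector_mult_scaleR RR algebra_simps)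
    have "w = 0"
    proof (cases "m = 0")
      case True
      then have "(R *v e) \<bullet> (R *v e) = 0"
        using inner_matrix_vector[of R e "R *v e"] R RR unfolding sym_psd_def by simp
      then show ?thesis using True by (simp add: w_def)
    next
      case False
      have "0 \<le> (R *v w) \<bullet> w" using R by (simp add: sym_psd_def)
      then have "m * (w \<bullet> w) \<le> 0" using Rw by simp
      then have "w \<bullet> w \<le> 0" using m0 False by (simp add: mult_le_0_iff)
      then show ?thesis by (metis inner_eq_zero_iff inner_ge_zero order_antisym)
    qed
    then show ?thesis by (simp add: w_def e')
  qed
  then have "R *v x = R' *v x" for x
    using linear_eq_on_span[of "\<lambda>x. R *v x" "\<lambda>x. R' *v x" E x] E(5) by simp
  then show ?thesis by (simp add: matrix_eq)
qed

lemma msqrt: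
  fixes Q :: "real^'n^'n"
  assumes "sym_psd Q"
  shows sym_psd_msqrt: "sym_psd (msqrt Q)" and msqrt_square: "msqrt Q ** msqrt Q = Q"
proof -
  have "\<exists>!R. sym_psd R \<and> R ** R = Q"
    using psd_root_exists[OF assms] psd_root_unique by metis
  from theI'[OF this] show "sym_psd (msqrt Q)" "msqrt Q ** msqrt Q = Q" by (auto simp: msqrt_def)
qed

section \<open>The matrix exponential\<close>

lemma bounded_bilinear_matrix_mult:
  "bounded_bilinear ((**) :: real^'n^'m \<Rightarrow> real^'k^'n \<Rightarrow> real^'k^'m)"
  unfolding bilinear_conv_bounded_bilinear[symmetric] bilinear_def
  by (auto intro!: linearI simp: matrix_matrix_mult_def vec_eq_iff sum.distrib sum_distrib_left algebra_simps)

lemma bounded_bilinear_matrix_vector_mult: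
  "bounded_bilinear ((*v) :: real^'n^'m \<Rightarrow> real^'n \<Rightarrow> real^'m)"
  unfolding bilinear_conv_bounded_bilinear[symmetric] bilinear_def
  by (auto intro!: linearI simp: matrix_vector_mult_def vec_eq_iff sum.distrib sum_distrib_left algebra_simps)

lemma bounded_linear_transpose: "bounded_linear (transpose :: real^'n^'m \<Rightarrow> real^'m^'n)"
  unfolding linear_conv_bounded_linear[symmetric]
  by (auto intro!: linearI simp: transpose_def vec_eq_iff)

lemma matrix_mult_uminus_left: "(- A) ** B = - (A ** (B :: real^'k^'n))" for A :: "real^'n^'m"
  using bounded_bilinear.minus_left[OF bounded_bilinear_matrix_mult] .

lemma matpow_0 [simp]: "matpow A 0 = mat 1"
  by (simp add: matpow_def)

lemma matpow_Suc: "matpow A (Suc k) = A ** matpow A k"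
  by (simp add: matpow_def)

lemma matpow_Suc2: "matpow A (Suc k) = matpow A k ** A"
proof (induction k)
  case (Suc k)
  then show ?case by (metis matpow_Suc matrix_mul_assoc)
qed (simp add: matpow_Suc)

lemma matpow_scaleR: "matpow (s *\<^sub>R A) k = s ^ k *\<^sub>R matpow A k"
proof (induction k)
  case (Suc k)
  then show ?case
    by (simp add: matpow_Suc bounded_bilinear.scaleR_left[OF bounded_bilinear_matrix_mult]
        bounded_bilinear.scaleR_right[OF bounded_bilinear_matrix_mult])
qed simp

lemma matpow_transpose: "matpow (transpose A) k = transpose (matpow A k)" for A :: "real^'n^'n"
proof (induction k)
  case (Suc k)
  then show ?case using matpow_Suc[of "transpose A" k] matpow_Suc2[of A k]
    by (simp add: matrix_transpose_mul)
qed (simp add: transpose_mat)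

lemma summable_mexp: "summable (\<lambda>k. norm ((s ^ k / fact k) *\<^sub>R matpow A k))" for A :: "real^'n^'n"
proof -
  \<comment> \<open>The constant K is there because the norm on matrices is the Euclidean one, taken
    from boundedness of the bilinear product.\<close>
  obtain K where K: "K > 0" "\<And>(A :: real^'n^'n) (B :: real^'n^'n). norm (A ** B) \<le> norm A * norm B * K"
    using bounded_bilinear.pos_bounded[OF bounded_bilinear_matrix_mult] by blast
  have b: "norm (matpow A k) \<le> (norm A * K) ^ k * norm (mat 1 :: real^'n^'n)" for k
  proof (induction k)
    case (Suc k)
    have "norm (matpow A (Suc k)) \<le> norm A * norm (matpow A k) * K"
      using K(2)[of A "matpow A k"] by (simp only: matpow_Suc)
    also have "\<dots> \<le> norm A * ((norm A * K) ^ k * norm (mat 1 :: real^'n^'n)) * K"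
      using K Suc by (intro mult_right_mono mult_left_mono) auto
    finally show ?case by (simp add: algebra_simps)
  qed simp
  have "summable (\<lambda>k. ((\<bar>s\<bar> * (norm A * K)) ^ k /\<^sub>R fact k) * norm (mat 1 :: real^'n^'n))"
    by (intro summable_mult2 summable_exp_generic)
  then show ?thesis
  proof (rule summable_comparison_test[rotated], intro exI allI impI)
    fix k
    have "norm (norm ((s ^ k / fact k) *\<^sub>R matpow A k)) = \<bar>s\<bar> ^ k / fact k * norm (matpow A k)"
      by (simp add: power_abs)
    also have "\<dots> \<le> \<bar>s\<bar> ^ k / fact k * ((norm A * K) ^ k * norm (mat 1 :: real^'n^'n))"
      by (intro mult_left_mono b) auto
    finally show "norm (norm ((s ^ k / fact k) *\<^sub>R matpow A k))
        \<le> ((\<bar>s\<bar> * (norm A * K)) ^ k /\<^sub>R fact k) * norm (mat 1 :: real^'n^'n)"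
      by (simp add: power_mult_distrib field_simps)
  qed
qed

lemma mexp_sums: "(\<lambda>k. (s ^ k / fact k) *\<^sub>R matpow A k) sums mexp (s *\<^sub>R A)" for A :: "real^'n^'n"
proof -
  have "summable (\<lambda>k. (s ^ k / fact k) *\<^sub>R matpow A k)"
    by (rule summable_norm_cancel[OF summable_mexp])
  then show ?thesis by (simp add: mexp_def matpow_scaleR summable_sums)
qed

lemma mexp_0: "mexp (0 *\<^sub>R A) = mat 1" for A :: "real^'n^'n"
proof -
  have "(\<lambda>k. (0 ^ k / fact k) *\<^sub>R matpow A k) sums ((0 ^ 0 / fact 0) *\<^sub>R matpow A 0)"
    by (rule sums_single[of 0 "\<lambda>k. (0 ^ k / fact k) *\<^sub>R matpow A k", THEN sums_cong[THEN iffD1, rotated]]) auto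
  then show ?thesis using mexp_sums[of 0 A] sums_unique2 by fastforce
qed

lemma mexp_commute: "A ** mexp (s *\<^sub>R A) = mexp (s *\<^sub>R A) ** A" for A :: "real^'n^'n"
proof -
  have "(\<lambda>k. A ** ((s ^ k / fact k) *\<^sub>R matpow A k)) sums (A ** mexp (s *\<^sub>R A))"
    using bounded_linear.sums[OF bounded_bilinear.bounded_linear_right[OF bounded_bilinear_matrix_mult] mexp_sums] .
  moreover have "(\<lambda>k. ((s ^ k / fact k) *\<^sub>R matpow A k) ** A) sums (mexp (s *\<^sub>R A) ** A)"
    using bounded_linear.sums[OF bounded_bilinear.bounded_linear_left[OF bounded_bilinear_matrix_mult] mexp_sums] .
  moreover have "A ** ((s ^ k / fact k) *\<^sub>R matpow A k) = ((s ^ k / fact k) *\<^sub>R matpow A k) ** A" for k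
    using matpow_Suc[of A k] matpow_Suc2[of A k]
    by (simp add: bounded_bilinear.scaleR_left[OF bounded_bilinear_matrix_mult]
        bounded_bilinear.scaleR_right[OF bounded_bilinear_matrix_mult])
  ultimately show ?thesis using sums_unique2 by simp
qed

lemma transpose_mexp: "mexp (s *\<^sub>R transpose A) = transpose (mexp (s *\<^sub>R A))" for A :: "real^'n^'n"
proof -
  have "(\<lambda>k. transpose ((s ^ k / fact k) *\<^sub>R matpow A k)) sums transpose (mexp (s *\<^sub>R A))"
    by (rule bounded_linear.sums[OF bounded_linear_transpose mexp_sums])
  then show ?thesis
    using mexp_sums[of s "transpose A"] sums_unique2
    by (auto simp: matpow_transpose linear_cmul[OF bounded_linear.linear[OF bounded_linear_transpose]])
qed

text \<open>Each entry is an everywhere convergent scalar power series in s, so it may be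
  differentiated termwise; \<open>diffs c k\<close> is the entry of A^(k+1) / k!.\<close>

lemma mexp_entry_derivative:
  "((\<lambda>s. mexp (s *\<^sub>R A) $ i $ j) has_real_derivative (A ** mexp (s *\<^sub>R A)) $ i $ j) (at s)"
  for A :: "real^'n^'n"
proof -
  have bl: "bounded_linear (\<lambda>M :: real^'n^'n. M $ i $ j)"
    using bounded_linear_compose[OF bounded_linear_vec_nth bounded_linear_vec_nth] .
  define c where "c k = matpow A k $ i $ j / fact k" for k
  have e: "(\<lambda>k. c k * s ^ k) sums (mexp (s *\<^sub>R A) $ i $ j)" for s
    using bounded_linear.sums[OF bl mexp_sums[of s A]] by (simp add: c_def algebra_simps)
  have d: "(\<lambda>k. diffs c k * s ^ k) sums ((A ** mexp (s *\<^sub>R A)) $ i $ j)"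
  proof -
    have "(\<lambda>k. (A ** ((s ^ k / fact k) *\<^sub>R matpow A k)) $ i $ j) sums ((A ** mexp (s *\<^sub>R A)) $ i $ j)"
      using bounded_linear.sums[OF bl bounded_linear.sums[OF bounded_bilinear.bounded_linear_right[OF bounded_bilinear_matrix_mult] mexp_sums]] .
    moreover have "(A ** ((s ^ k / fact k) *\<^sub>R matpow A k)) $ i $ j = diffs c k * s ^ k" for k
      by (simp add: diffs_def c_def matpow_Suc bounded_bilinear.scaleR_right[OF bounded_bilinear_matrix_mult] field_simps del: of_nat_Suc)
    ultimately show ?thesis by simp
  qed
  have "((\<lambda>s. \<Sum>k. c k * s ^ k) has_real_derivative (\<Sum>k. diffs c k * s ^ k)) (at s)"
    using e by (intro termdiffs_strong_converges_everywhere) (auto simp: sums_iff)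
  then show ?thesis using e d by (simp add: sums_iff)
qed

lemma has_vector_derivative_mexp:
  "((\<lambda>s. mexp (s *\<^sub>R A)) has_vector_derivative (A ** mexp (s *\<^sub>R A))) (at s)"
  for A :: "real^'n^'n"
proof -
  have "((\<lambda>s. mexp (s *\<^sub>R A) \<bullet> b) has_derivative (\<lambda>h. (h *\<^sub>R (A ** mexp (s *\<^sub>R A))) \<bullet> b)) (at s)"
    if "b \<in> Basis" for b
  proof -
    obtain i j where b: "b = axis i (axis j 1)" using \<open>b \<in> Basis\<close> by (auto simp: Basis_vec_def)
    have bb: "M \<bullet> b = M $ i $ j" for M :: "real^'n^'n" by (simp add: b inner_axis)
    show ?thesis using mexp_entry_derivative[of A i j s]
      by (simp add: bb has_field_derivative_def mult.commute[of _ "(A ** mexp (s *\<^sub>R A)) $ i $ j"])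
  qed
  then show ?thesis
    unfolding has_vector_derivative_def by (subst has_derivative_componentwise_within) simp
qed

lemma has_vector_derivative_mexp_shift:
  "((\<lambda>s. mexp ((a * s + t) *\<^sub>R A)) has_vector_derivative a *\<^sub>R (A ** mexp ((a * s + t) *\<^sub>R A))) (at s)"
  for A :: "real^'n^'n"
proof -
  have "((\<lambda>s. a * s + t) has_vector_derivative a) (at s)"
    by (auto intro!: derivative_eq_intros simp: has_real_derivative_iff_has_vector_derivative[symmetric])
  from vector_diff_chain_at[OF this has_vector_derivative_mexp[of A "a * s + t"]]
  show ?thesis by (simp add: o_def)
qed

text \<open>For fixed t the left-hand side has derivative zero in s, because A commutes with its
  exponential, so it keeps its value at s = 0. Both the inverse and the addition formula are
  consequences.\<close>

lemma mexp_add_inverse: "mexp (-(s *\<^sub>R A)) ** mexp ((s + t) *\<^sub>R A) = mexp (t *\<^sub>R A)" for A :: "real^'n^'n"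
proof -
  let ?f = "\<lambda>s. mexp ((-1 * s + 0) *\<^sub>R A) ** mexp ((1 * s + t) *\<^sub>R A)"
  have "(?f has_vector_derivative 0) (at x)" for x
  proof -
    have "(?f has_vector_derivative mexp ((-1 * x + 0) *\<^sub>R A) ** (1 *\<^sub>R (A ** mexp ((1 * x + t) *\<^sub>R A)))
        + ((-1) *\<^sub>R (A ** mexp ((-1 * x + 0) *\<^sub>R A))) ** mexp ((1 * x + t) *\<^sub>R A)) (at x)"
      by (rule bounded_bilinear.has_vector_derivative[OF bounded_bilinear_matrix_mult
            has_vector_derivative_mexp_shift has_vector_derivative_mexp_shift])
    moreover have "mexp ((-1 * x + 0) *\<^sub>R A) ** (1 *\<^sub>R (A ** mexp ((1 * x + t) *\<^sub>R A)))
        + ((-1) *\<^sub>R (A ** mexp ((-1 * x + 0) *\<^sub>R A))) ** mexp ((1 * x + t) *\<^sub>R A) = 0"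
      by (simp only: mexp_commute[of A "-1 * x + 0"]) (simp add: matrix_mult_uminus_left matrix_mul_assoc)
    ultimately show ?thesis by simp
  qed
  then have "?f s = ?f 0"
    by (intro has_derivative_zero_unique[of UNIV]) (auto simp: has_vector_derivative_def)
  then show ?thesis using mexp_0[of A] by simp
qed

lemma mexp_minus: "mexp ((-s) *\<^sub>R A) ** mexp (s *\<^sub>R A) = mat 1" for A :: "real^'n^'n"
  using mexp_add_inverse[of s A 0] mexp_0[of A] by simp

lemma mexp_add: "mexp ((s + t) *\<^sub>R A) = mexp (s *\<^sub>R A) ** mexp (t *\<^sub>R A)" for A :: "real^'n^'n"
proof -
  have "mexp (s *\<^sub>R A) ** mexp (t *\<^sub>R A) = (mexp (s *\<^sub>R A) ** mexp ((-s) *\<^sub>R A)) ** mexp ((s + t) *\<^sub>R A)"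
    using mexp_add_inverse[of s A t] by (simp add: matrix_mul_assoc[symmetric])
  also have "\<dots> = mexp ((s + t) *\<^sub>R A)" using mexp_minus[of "-s" A] by simp
  finally show ?thesis ..
qed

lemma invertible_mexp: "invertible (mexp (s *\<^sub>R A))" for A :: "real^'n^'n"
  unfolding invertible_def using mexp_minus[of s A] mexp_minus[of "-s" A] by auto

lemma continuous_on_mexp: "continuous_on X (\<lambda>s. mexp (s *\<^sub>R A))" for A :: "real^'n^'n"
  by (intro continuous_at_imp_continuous_on ballI has_vector_derivative_continuous)
    (rule has_vector_derivative_mexp)

section \<open>The covariance matrices and the Kalman condition\<close>

primrec fdiff :: "real \<Rightarrow> nat \<Rightarrow> (real \<Rightarrow> real) \<Rightarrow> real \<Rightarrow> real" where
  "fdiff h 0 g = g"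
| "fdiff h (Suc j) g = fdiff h j (\<lambda>x. g (x + h) - g x)"

text \<open>Here g i plays the role of the i-th derivative of g 0. The mean value theorem trades one
  derivative for a factor h, and the differences k i form again a chain of derivatives, on an
  interval shorter by h.\<close>

lemma fdiff_ge:
  assumes "h > 0" and "a + real j * h \<le> b"
    and "\<And>i x. i < j \<Longrightarrow> x \<in> {a..b} \<Longrightarrow> (g i has_real_derivative g (Suc i) x) (at x)"
    and "\<And>x. x \<in> {a..b} \<Longrightarrow> m \<le> g j x"
  shows "h ^ j * m \<le> fdiff h j (g 0) a"
  using assms(2-)
proof (induction j arbitrary: g m b)
  case (Suc j)
  define k where "k i x = g i (x + h) - g i x" for i x
  have b': "a + real j * h \<le> b - h" using Suc.prems(1) by (simp add: algebra_simps)
  have "h ^ j * (h * m) \<le> fdiff h j (k 0) a"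
  proof (rule Suc.IH[OF b'])
    fix i x assume "i < j" "x \<in> {a..b - h}"
    then show "(k i has_real_derivative k (Suc i) x) (at x)"
      using \<open>h > 0\<close> Suc.prems(2)[of i x] DERIV_shift[of "g i" "g (Suc i) (x + h)" x h]
        Suc.prems(2)[of i "x + h"]
      by (auto simp: k_def[abs_def] intro!: derivative_eq_intros)
  next
    fix x assume x: "x \<in> {a..b - h}"
    obtain z where z: "x < z" "z < x + h" "g j (x + h) - g j x = (x + h - x) * g (Suc j) z"
      using MVT2[of x "x + h" "g j" "g (Suc j)"] \<open>h > 0\<close> x Suc.prems(2)[of j] by auto
    moreover have "m \<le> g (Suc j) z" using z x by (intro Suc.prems(3)) auto
    ultimately show "h * m \<le> k j x" using \<open>h > 0\<close> by (simp add: k_def)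
  qed
  then show ?case by (simp add: k_def[abs_def] algebra_simps)
qed auto

lemma continuous_on_fdiff:
  "continuous_on UNIV g \<Longrightarrow> continuous_on UNIV (fdiff h j g)"
proof (induction j arbitrary: g)
  case (Suc j)
  have "continuous_on UNIV (\<lambda>x. g (x + h))"
    by (rule continuous_on_compose2[OF Suc.prems]) (auto intro!: continuous_intros)
  then show ?case using Suc.prems by (auto intro!: Suc.IH continuous_intros)
qed auto

text \<open>Since (u - v)^2 \<le> 2 u^2 + 2 v^2, each difference costs a factor 4 and lengthens the
  interval by h. Together with \<open>fdiff_ge\<close>, a lower bound on a derivative becomes a
  lower bound on the square integral of the function itself.\<close>

lemma integral_fdiff_le:
  assumes "continuous_on UNIV g" "h \<ge> 0"
  shows "integral {0..h} (\<lambda>s. (fdiff h j g s)\<^sup>2) \<le> 4 ^ j * integral {0..real (Suc j) * h} (\<lambda>s. (g s)\<^sup>2)"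
  using assms(1)
proof (induction j arbitrary: g)
  case (Suc j)
  define k where "k x = g (x + h) - g x" for x
  have cg: "continuous_on X g" for X using Suc.prems continuous_on_subset by blast
  have cgh: "continuous_on X (\<lambda>x. g (x + h))" for X
    by (rule continuous_on_compose2[OF Suc.prems]) (auto intro!: continuous_intros)
  have ck: "continuous_on X k" for X unfolding k_def by (intro continuous_intros cg cgh)
  let ?r = "real (Suc j) * h"
  have r: "0 \<le> ?r" using assms(2) by simp
  have i1: "integral {0..?r} (\<lambda>s. (g s)\<^sup>2) \<le> integral {0..?r + h} (\<lambda>s. (g s)\<^sup>2)"
    using assms(2) by (intro integral_subset_le integrable_continuous_real continuous_intros cg) auto
  have "integral {0..?r} (\<lambda>s. (g (s + h))\<^sup>2) = integral {h..?r + h} (\<lambda>s. (g s)\<^sup>2)"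
    using integral_shift_real_ivl[of h h "?r + h" "\<lambda>s. (g s)\<^sup>2"] by simp
  also have "\<dots> \<le> integral {0..?r + h} (\<lambda>s. (g s)\<^sup>2)"
    using assms(2) by (intro integral_subset_le integrable_continuous_real continuous_intros cg) auto
  finally have i2: "integral {0..?r} (\<lambda>s. (g (s + h))\<^sup>2) \<le> integral {0..?r + h} (\<lambda>s. (g s)\<^sup>2)" .
  have "integral {0..?r} (\<lambda>s. (k s)\<^sup>2) \<le> integral {0..?r} (\<lambda>s. 2 * (g (s + h))\<^sup>2 + 2 * (g s)\<^sup>2)"
  proof (intro integral_le integrable_continuous_real continuous_intros cg cgh ck)
    fix s show "(k s)\<^sup>2 \<le> 2 * (g (s + h))\<^sup>2 + 2 * (g s)\<^sup>2"
      using sum_squares_bound[of "g (s + h)" "- g s"] by (simp add: k_def power2_diff)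
  qed
  also have "\<dots> = 2 * integral {0..?r} (\<lambda>s. (g (s + h))\<^sup>2) + 2 * integral {0..?r} (\<lambda>s. (g s)\<^sup>2)"
    by (subst integral_add) (auto intro!: integrable_continuous_real continuous_intros cg cgh)
  also have "\<dots> \<le> 4 * integral {0..?r + h} (\<lambda>s. (g s)\<^sup>2)" using i1 i2 by simp
  finally have "integral {0..?r} (\<lambda>s. (k s)\<^sup>2) \<le> 4 * integral {0..?r + h} (\<lambda>s. (g s)\<^sup>2)" .
  then have "4 ^ j * integral {0..?r} (\<lambda>s. (k s)\<^sup>2) \<le> 4 ^ j * (4 * integral {0..?r + h} (\<lambda>s. (g s)\<^sup>2))"
    by (rule mult_left_mono) simp
  moreover have "integral {0..h} (\<lambda>s. (fdiff h j k s)\<^sup>2) \<le> 4 ^ j * integral {0..?r} (\<lambda>s. (k s)\<^sup>2)"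
    by (rule Suc.IH[OF ck])
  moreover have "fdiff h (Suc j) g = fdiff h j k" by (simp add: k_def[abs_def])
  moreover have "real (Suc (Suc j)) * h = ?r + h" by (simp add: distrib_right)
  ultimately show ?case by (simp only: power_Suc mult.assoc mult.left_commute[of 4])
qed simp

section \<open>The covariance form and its lower bound\<close>

definition pos_def :: "real^'n^'n \<Rightarrow> bool" where
  "pos_def A \<longleftrightarrow> transpose A = A \<and> (\<forall>x. x \<noteq> 0 \<longrightarrow> 0 < (A *v x) \<bullet> x)"

context
  fixes Q B :: "real^'n^'n"
  assumes Q: "sym_psd Q"
begin

lemma continuous_on_cov_integrand:
  "continuous_on X (\<lambda>s. mexp (s *\<^sub>R B) ** Q ** mexp (s *\<^sub>R transpose B))"
  by (intro bounded_bilinear.continuous_on[OF bounded_bilinear_matrix_mult] continuous_on_mexp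
      continuous_on_const)

lemma integrable_cov_integrand:
  "(\<lambda>s. mexp (s *\<^sub>R B) ** Q ** mexp (s *\<^sub>R transpose B)) integrable_on {a..b}"
  by (intro integrable_continuous_real continuous_on_cov_integrand)

lemma transpose_ou_covariance: "transpose (ou_covariance Q B t) = ou_covariance Q B t"
proof -
  have "transpose (ou_covariance Q B t) =
      integral {0..t} (transpose \<circ> (\<lambda>s. mexp (s *\<^sub>R B) ** Q ** mexp (s *\<^sub>R transpose B)))"
    unfolding ou_covariance_def
    by (rule integral_linear[symmetric, OF integrable_cov_integrand bounded_linear_transpose])
  also have "\<dots> = ou_covariance Q B t"
    using Q by (simp add: ou_covariance_def o_def matrix_transpose_mul transpose_mexp sym_psd_def matrix_mul_assoc)
  finally show ?thesis .
qed

lemma ou_covariance_form: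
  "(ou_covariance Q B t *v x) \<bullet> x = integral {0..t} (\<lambda>s. (norm (msqrt Q *v (mexp (s *\<^sub>R transpose B) *v x)))\<^sup>2)"
proof -
  have bl: "bounded_linear (\<lambda>M :: real^'n^'n. (M *v x) \<bullet> x)"
    by (rule bounded_linear_compose[OF bounded_linear_inner_left
          bounded_bilinear.bounded_linear_left[OF bounded_bilinear_matrix_vector_mult]])
  have *: "((mexp (s *\<^sub>R B) ** Q ** mexp (s *\<^sub>R transpose B)) *v x) \<bullet> x =
     (norm (msqrt Q *v (mexp (s *\<^sub>R transpose B) *v x)))\<^sup>2" for s
  proof -
    define y where "y = mexp (s *\<^sub>R transpose B) *v x"
    have "((mexp (s *\<^sub>R B) ** Q ** mexp (s *\<^sub>R transpose B)) *v x) \<bullet> x = (Q *v y) \<bullet> y"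
      by (simp add: y_def inner_matrix_vector[of "mexp (s *\<^sub>R B)"] transpose_mexp flip: matrix_vector_mul_assoc)
    also have "\<dots> = (msqrt Q *v (msqrt Q *v y)) \<bullet> y"
      using msqrt_square[OF Q] by (simp add: matrix_vector_mul_assoc)
    also have "\<dots> = (msqrt Q *v y) \<bullet> (msqrt Q *v y)"
      using sym_psd_msqrt[OF Q] inner_matrix_vector[of "msqrt Q" "msqrt Q *v y" y] by (simp only: sym_psd_def)
    finally show ?thesis by (simp add: y_def power2_norm_eq_inner)
  qed
  show ?thesis
    using integral_linear[OF integrable_cov_integrand bl, of 0 t]
    by (simp add: o_def * ou_covariance_def)
qed

lemma continuous_cov_form:
  "continuous_on X (\<lambda>s. (norm (msqrt Q *v (mexp (s *\<^sub>R transpose B) *v x)))\<^sup>2)"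
  by (intro continuous_intros bounded_bilinear.continuous_on[OF bounded_bilinear_matrix_vector_mult]
      continuous_on_mexp)

lemma ou_covariance_mono:
  assumes "s \<le> t" shows "(ou_covariance Q B s *v x) \<bullet> x \<le> (ou_covariance Q B t *v x) \<bullet> x"
  unfolding ou_covariance_form using assms
  by (intro integral_subset_le integrable_continuous_real continuous_cov_form) auto

text \<open>Shifting the integration variable by s carries the part over [s, s + t] back to [0, t]
  and conjugates it by \<open>mexp (s *\<^sub>R B)\<close>. The Chapman-Kolmogorov equation rests on
  this identity.\<close>

lemma ou_covariance_add:
  assumes "0 \<le> s" "0 \<le> t"
  shows "ou_covariance Q B (s + t) = ou_covariance Q B s + mexp (s *\<^sub>R B) ** ou_covariance Q B t ** transpose (mexp (s *\<^sub>R B))"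
proof -
  let ?M = "\<lambda>s. mexp (s *\<^sub>R B) ** Q ** mexp (s *\<^sub>R transpose B)"
  let ?L = "\<lambda>M :: real^'n^'n. mexp (s *\<^sub>R B) ** M ** transpose (mexp (s *\<^sub>R B))"
  have bl: "bounded_linear ?L"
    by (rule bounded_linear_compose[OF bounded_bilinear.bounded_linear_left[OF bounded_bilinear_matrix_mult]
          bounded_bilinear.bounded_linear_right[OF bounded_bilinear_matrix_mult]])
  have sh: "?M (r + s) = ?L (?M r)" for r
    using mexp_add[of s r B] mexp_add[of r s "transpose B"]
    by (simp add: matrix_mul_assoc transpose_mexp add.commute)
  have "ou_covariance Q B (s + t) = ou_covariance Q B s + integral {s..s + t} ?M"
    unfolding ou_covariance_def
    by (subst Henstock_Kurzweil_Integration.integral_combine[of 0 s "s + t"])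
      (use assms in \<open>auto intro: integrable_cov_integrand\<close>)
  also have "integral {s..s + t} ?M = integral {0..t} (?M \<circ> (\<lambda>r. r + s))"
    using integral_shift_real_ivl[of s s "s + t" ?M] by (simp add: o_def)
  also have "\<dots> = integral {0..t} (?L \<circ> ?M)"
    using sh by (simp add: o_def)
  also have "\<dots> = ?L (ou_covariance Q B t)"
    unfolding ou_covariance_def by (rule integral_linear[OF integrable_cov_integrand bl])
  finally show ?thesis .
qed

lemma continuous_on_ou_covariance: "continuous_on {0..T} (ou_covariance Q B)"
  unfolding ou_covariance_def[abs_def]
  by (rule indefinite_integral_continuous_1[OF integrable_cov_integrand])

text \<open>Full row rank makes the transposed matrix injective, and its blocks are the transposes
  of B^j \<open>msqrt Q\<close>, that is \<open>msqrt Q\<close> times powers of the transpose of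
  B.\<close>

lemma kalman_nonzero:
  assumes K: "rank (kalman_matrix Q B) = CARD('n)" and x: "x \<noteq> 0"
  shows "\<exists>p :: 'n. msqrt Q *v (matpow (transpose B) (to_nat_on (UNIV :: 'n set) p) *v x) \<noteq> 0"
proof (rule ccontr)
  assume "\<not> ?thesis"
  then have z: "msqrt Q *v (matpow (transpose B) (to_nat_on (UNIV :: 'n set) p) *v x) = 0" for p by auto
  have "transpose (kalman_matrix Q B) *v x = 0"
  proof (rule vec_eq_iff[THEN iffD2], rule allI)
    fix pq :: "'n \<times> 'n"
    obtain p q where pq: "pq = (p, q)" by fastforce
    let ?j = "to_nat_on (UNIV :: 'n set) p"
    have "(transpose (kalman_matrix Q B) *v x) $ (p, q) = (transpose (matpow B ?j ** msqrt Q) *v x) $ q"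
      by (simp add: matrix_vector_mult_def transpose_def kalman_matrix_def)
    also have "transpose (matpow B ?j ** msqrt Q) *v x = msqrt Q *v (matpow (transpose B) ?j *v x)"
      using sym_psd_msqrt[OF Q]
      by (simp add: matrix_transpose_mul matpow_transpose sym_psd_def flip: matrix_vector_mul_assoc)
    finally show "(transpose (kalman_matrix Q B) *v x) $ pq = 0 $ pq" using z[of p] by (simp add: pq)
  qed
  moreover have "inj ((*v) (transpose (kalman_matrix Q B)))"
    using K rank_transpose[of "kalman_matrix Q B"]
    by (intro full_rank_injective[THEN iffD1]) (rule trans)
  ultimately have "x = 0" by (intro injD[of "(*v) (transpose (kalman_matrix Q B))" x 0]) auto
  then show False using x by simp
qed

text \<open>The form is the square integral of the curve s ->
  \<open>msqrt Q *v (mexp (s *\<^sub>R transpose B) *v x)\<close>, and g e x i is the i-th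
  derivative of its component e. For unit vectors x some derivative of order j p is bounded away
  from 0 at s = 0, uniformly by compactness. The difference estimates turn this into a lower bound
  on the square integral over [0, t].\<close>

lemma kalman_lower_bound:
  assumes K: "rank (kalman_matrix Q B) = CARD('n)" and T: "0 < T"
  obtains c k where "c > 0"
    "\<And>t x. 0 < t \<Longrightarrow> t \<le> T \<Longrightarrow> c * t ^ k * (x \<bullet> x) \<le> (ou_covariance Q B t *v x) \<bullet> x"
proof -
  define g where "g e x i s = (msqrt Q *v (mexp (s *\<^sub>R transpose B) *v (matpow (transpose B) i *v x))) $ e"
    for e :: 'n and x and i :: nat and s
  have bl: "bounded_linear (\<lambda>M. (msqrt Q *v (M *v y)) $ e)" for e :: 'n and y :: "real^'n"
    by (intro bounded_linear_compose[OF bounded_linear_vec_nth]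
        bounded_linear_compose[OF matrix_vector_mul_bounded_linear]
        bounded_bilinear.bounded_linear_left[OF bounded_bilinear_matrix_vector_mult])
  have der: "(g e x i has_real_derivative g e x (Suc i) s) (at s)" for e x i s
    using bounded_linear.has_vector_derivative[OF bl has_vector_derivative_mexp[of "transpose B" s], of "matpow (transpose B) i *v x" e]
    unfolding g_def has_real_derivative_iff_has_vector_derivative
    by (simp add: matpow_Suc mexp_commute flip: matrix_vector_mul_assoc)
  have blx: "bounded_linear (\<lambda>x. g e x i s)" for e i s
    unfolding g_def
    by (rule bounded_linear_compose[OF bounded_linear_vec_nth], rule bounded_linear_compose[OF matrix_vector_mul_bounded_linear],
        rule bounded_linear_compose[OF matrix_vector_mul_bounded_linear], rule matrix_vector_mul_bounded_linear)
  have contg: "continuous_on X (g e x i)" for e x i X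
    by (rule continuous_at_imp_continuous_on) (blast intro: DERIV_isCont der)
  define j where "j p = to_nat_on (UNIV :: 'n set) p" for p :: 'n
  define N where "N = Max (range j)"
  have jN: "j p \<le> N" for p by (simp add: N_def)
  let ?S = "sphere 0 1 :: (real^'n) set"
  obtain c0 where c0: "c0 > 0" "\<And>x. x \<in> ?S \<Longrightarrow> \<exists>p e. c0 \<le> \<bar>g e x (j p) 0\<bar>"
  proof -
    define m where "m x = (\<Sum>p\<in>UNIV. \<Sum>e\<in>UNIV. \<bar>g e x (j p) 0\<bar>)" for x
    have "continuous_on ?S m"
      unfolding m_def by (intro continuous_on_sum continuous_on_rabs linear_continuous_on blx)
    moreover have "?S \<noteq> {}" using vector_choose_size[of 1] by fastforce
    ultimately obtain x0 where x0: "x0 \<in> ?S" "\<And>x. x \<in> ?S \<Longrightarrow> m x0 \<le> m x"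
      using continuous_attains_inf[of ?S m] by auto
    have "m x0 > 0"
    proof -
      have "x0 \<noteq> 0" using x0 by auto
      from kalman_nonzero[OF K this] obtain p where
        "msqrt Q *v (matpow (transpose B) (to_nat_on (UNIV :: 'n set) p) *v x0) \<noteq> 0" by blast
      then obtain e where "(msqrt Q *v (matpow (transpose B) (j p) *v x0)) $ e \<noteq> 0"
        unfolding j_def by (metis vec_eq_iff zero_index)
      then have "g e x0 (j p) 0 \<noteq> 0" by (simp only: g_def mexp_0 matrix_vector_mul_lid not_False_eq_True)
      then show ?thesis unfolding m_def
        by (intro sum_pos2[of _ p] sum_pos2[of _ e] sum_nonneg) auto
    qed
    \<comment> \<open>The largest of the n^2 summands of m x is at least their average.\<close>
    define c0 where "c0 = m x0 / (real CARD('n))\<^sup>2"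
    have "\<exists>p e. c0 \<le> \<bar>g e x (j p) 0\<bar>" if "x \<in> ?S" for x
    proof (rule ccontr)
      assume "\<not> ?thesis"
      then have "\<bar>g e x (j p) 0\<bar> < c0" for p e by (meson not_le)
      then have "m x < (\<Sum>p\<in>(UNIV :: 'n set). \<Sum>e\<in>(UNIV :: 'n set). c0)"
        unfolding m_def by (intro sum_strict_mono) auto
      also have "\<dots> = m x0" by (simp add: c0_def power2_eq_square)
      finally show False using x0(2)[OF that] by simp
    qed
    then show ?thesis using that[of c0] \<open>m x0 > 0\<close> by (simp add: c0_def)
  qed
  have "\<exists>L. \<forall>x\<in>?S. \<forall>s\<in>{0..1}. \<forall>e. \<bar>g e x i s\<bar> \<le> L" for i
  proof -
    let ?h = "\<lambda>y :: real \<times> (real^'n). msqrt Q *v (mexp (fst y *\<^sub>R transpose B) *v (matpow (transpose B) i *v snd y))"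
    have "continuous_on ({0..1} \<times> ?S) ?h"
      by (rule bounded_linear.continuous_on[OF matrix_vector_mul_bounded_linear],
          rule bounded_bilinear.continuous_on[OF bounded_bilinear_matrix_vector_mult],
          rule continuous_on_compose2[OF continuous_on_mexp[of UNIV "transpose B"]], 
          (rule continuous_on_fst continuous_on_snd continuous_on_id subset_UNIV
            bounded_linear.continuous_on[OF matrix_vector_mul_bounded_linear])+)
    then have "compact (?h ` ({0..1} \<times> ?S))"
      by (intro compact_continuous_image compact_Times) auto
    then obtain L where L: "\<And>y. y \<in> ?h ` ({0..1} \<times> ?S) \<Longrightarrow> norm y \<le> L"
      using compact_imp_bounded[of "?h ` ({0..1} \<times> ?S)"] unfolding bounded_iff by blast
    show ?thesis
    proof (intro exI ballI allI)
      fix x s e assume xs: "x \<in> ?S" "s \<in> {0..1 :: real}"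
      have "\<bar>g e x i s\<bar> \<le> norm (?h (s, x))"
        unfolding g_def fst_conv snd_conv by (rule component_le_norm_cart)
      also have "\<dots> \<le> L" using xs by (intro L imageI) simp
      finally show "\<bar>g e x i s\<bar> \<le> L" .
    qed
  qed
  then obtain L' where L': "\<And>i x s e. x \<in> ?S \<Longrightarrow> s \<in> {0..1} \<Longrightarrow> \<bar>g e x i s\<bar> \<le> L' i" by metis
  define L where "L = 1 + (\<Sum>i\<le>Suc N. \<bar>L' i\<bar>)"
  have L0: "L > 0" unfolding L_def by (intro add_pos_nonneg sum_nonneg) auto
  have LL: "\<bar>g e x i s\<bar> \<le> L" if "i \<le> Suc N" "x \<in> ?S" "s \<in> {0..1}" for e x i s
  proof -
    have "\<bar>L' i\<bar> \<le> (\<Sum>i\<le>Suc N. \<bar>L' i\<bar>)" using that(1) by (intro member_le_sum) auto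
    then show ?thesis using L'[OF that(2,3), of e i] by (simp add: L_def)
  qed
  \<comment> \<open>L bounds the next derivative on [0, 1], so up to time t0 the chosen derivative
    keeps at least half of its value at 0.\<close>
  define t0 where "t0 = min 1 (c0 / (2 * L))"
  have t0: "0 < t0" "t0 \<le> 1" "t0 * L \<le> c0 / 2" using c0 L0 by (auto simp: t0_def min_def field_simps)
  define k where "k = 2 * N + 1"
  \<comment> \<open>The factor 4^N comes from \<open>integral_fdiff_le\<close> and (c0 / 2)^2 from
    \<open>fdiff_ge\<close>. The exponent k = 2 N + 1 counts the squared h^J and the length h of the
    interval, and the powers of \<open>Suc N\<close> come from h = t / (J + 1).\<close>
  define c1 where "c1 = (c0 / 2)\<^sup>2 / (4 ^ N * real (Suc N) ^ k)"
  have c1: "c1 > 0" using c0 by (simp add: c1_def)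
  have main: "c1 * t ^ k \<le> (ou_covariance Q B t *v x) \<bullet> x" if t: "0 < t" "t \<le> t0" and x: "x \<in> ?S" for t x
  proof -
    obtain p e where pe: "c0 \<le> \<bar>g e x (j p) 0\<bar>" using c0(2)[OF x] by blast
    \<comment> \<open>The sign makes the chosen derivative positive; the quadratic form does not see
      it.\<close>
    define y where "y = (if 0 \<le> g e x (j p) 0 then x else - x)"
    have gm: "g e (- x) i s = - g e x i s" for i s
      by (rule linear_neg[OF bounded_linear.linear[OF blx]])
    have y: "y \<in> ?S" "c0 \<le> g e y (j p) 0" using x pe by (auto simp: y_def gm)
    define J where "J = j p"
    have J: "J \<le> N" by (simp add: J_def jN)
    have low: "c0 / 2 \<le> g e y J s" if "s \<in> {0..t}" for s
    proof (cases "s = 0")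
      case True then show ?thesis using y c0 by (simp add: J_def)
    next
      case False
      then have s: "0 < s" "s \<le> t" using that by auto
      obtain z where z: "0 < z" "z < s" "g e y J s - g e y J 0 = (s - 0) * g e y (Suc J) z"
        using MVT2[of 0 s "g e y J" "g e y (Suc J)"] s der by auto
      have "\<bar>g e y (Suc J) z\<bar> \<le> L" using J z s t t0 y by (intro LL) auto
      then have "\<bar>s * g e y (Suc J) z\<bar> \<le> t0 * L"
        unfolding abs_mult using s t by (intro mult_mono) auto
      then show ?thesis using z y t0 unfolding J_def by auto
    qed
    \<comment> \<open>J differences of step h starting in [0, h] stay in [0, (J + 1) h] =
      [0, t].\<close>
    define h where "h = t / real (Suc J)"
    have h: "h > 0" "real (Suc J) * h = t" using t by (auto simp: h_def)
    have fd: "(h ^ J * (c0 / 2))\<^sup>2 \<le> (fdiff h J (g e y 0) s)\<^sup>2" if "s \<in> {0..h}" for s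
    proof -
      have "h ^ J * (c0 / 2) \<le> fdiff h J (g e y 0) s"
      proof (rule fdiff_ge[where b = t])
        show "s + real J * h \<le> t" using that h by (simp add: algebra_simps)
        show "c0 / 2 \<le> g e y J x" if "x \<in> {s..t}" for x
          using that \<open>s \<in> {0..h}\<close> by (intro low) auto
      qed (use h der in auto)
      then show ?thesis using h c0 by (intro power_mono) auto
    qed
    have "h * (h ^ J * (c0 / 2))\<^sup>2 = integral {0..h} (\<lambda>s. (h ^ J * (c0 / 2))\<^sup>2)" using h by simp
    also have "\<dots> \<le> integral {0..h} (\<lambda>s. (fdiff h J (g e y 0) s)\<^sup>2)"
    proof (rule integral_le)
      show "(\<lambda>s. (fdiff h J (g e y 0) s)\<^sup>2) integrable_on {0..h}"
        by (intro integrable_continuous_real continuous_on_power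
            continuous_on_subset[OF continuous_on_fdiff[OF contg] subset_UNIV])
      show "(\<lambda>s. (h ^ J * (c0 / 2))\<^sup>2) integrable_on {0..h}" by (rule integrable_const_ivl)
    qed (rule fd)
    also have "\<dots> \<le> 4 ^ J * integral {0..real (Suc J) * h} (\<lambda>s. (g e y 0 s)\<^sup>2)"
      using h by (intro integral_fdiff_le contg) auto
    also have "\<dots> \<le> 4 ^ J * integral {0..t} (\<lambda>s. (norm (msqrt Q *v (mexp (s *\<^sub>R transpose B) *v y)))\<^sup>2)"
      unfolding h
    proof (intro mult_left_mono integral_le)
      show "(\<lambda>s. (g e y 0 s)\<^sup>2) integrable_on {0..t}"
        by (intro integrable_continuous_real continuous_on_power contg)
      show "(\<lambda>s. (norm (msqrt Q *v (mexp (s *\<^sub>R transpose B) *v y)))\<^sup>2) integrable_on {0..t}"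
        by (intro integrable_continuous_real continuous_cov_form)
    next
      fix s
      have "\<bar>g e y 0 s\<bar> \<le> norm (msqrt Q *v (mexp (s *\<^sub>R transpose B) *v y))"
        unfolding g_def matpow_0 matrix_vector_mul_lid by (rule component_le_norm_cart)
      then have "\<bar>g e y 0 s\<bar>\<^sup>2 \<le> (norm (msqrt Q *v (mexp (s *\<^sub>R transpose B) *v y)))\<^sup>2"
        by (rule power_mono) simp
      then show "(g e y 0 s)\<^sup>2 \<le> (norm (msqrt Q *v (mexp (s *\<^sub>R transpose B) *v y)))\<^sup>2" by simp
    qed auto
    also have "\<dots> = 4 ^ J * ((ou_covariance Q B t *v y) \<bullet> y)" by (simp add: ou_covariance_form)
    also have "(ou_covariance Q B t *v y) \<bullet> y = (ou_covariance Q B t *v x) \<bullet> x"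
      by (simp add: y_def linear_neg[OF matrix_vector_mul_linear])
    finally have "h * (h ^ J * (c0 / 2))\<^sup>2 \<le> 4 ^ J * ((ou_covariance Q B t *v x) \<bullet> x)" .
    moreover have "h * (h ^ J * (c0 / 2))\<^sup>2 = h ^ (2 * J + 1) * (c0 / 2)\<^sup>2"
      by (simp only: power_mult_distrib power_mult[symmetric] mult.commute[of 2 J] power_add power_one_right) (simp only: mult_ac)
    ultimately have "h ^ (2 * J + 1) * (c0 / 2)\<^sup>2 \<le> 4 ^ J * ((ou_covariance Q B t *v x) \<bullet> x)" by (simp only:)
    also have "\<dots> \<le> 4 ^ N * ((ou_covariance Q B t *v x) \<bullet> x)"
      using J t by (intro mult_right_mono power_increasing)
        (auto simp: ou_covariance_form intro!: integral_nonneg integrable_continuous_real continuous_cov_form)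
    finally have 1: "h ^ (2 * J + 1) * (c0 / 2)\<^sup>2 \<le> 4 ^ N * ((ou_covariance Q B t *v x) \<bullet> x)" .
    have "(t / real (Suc N)) ^ k \<le> h ^ k"
      unfolding h_def using J t by (intro power_mono divide_left_mono) auto
    also have "\<dots> \<le> h ^ (2 * J + 1)"
    proof -
      have "h \<le> t" using h t J by (auto simp: h_def divide_le_eq)
      then show ?thesis using h t t0 J by (intro power_decreasing) (auto simp: k_def)
    qed
    finally have "(t / real (Suc N)) ^ k \<le> h ^ (2 * J + 1)" .
    then have "(t / real (Suc N)) ^ k * (c0 / 2)\<^sup>2 \<le> h ^ (2 * J + 1) * (c0 / 2)\<^sup>2"
      by (rule mult_right_mono) simp
    also note 1
    finally have "(t / real (Suc N)) ^ k * (c0 / 2)\<^sup>2 / 4 ^ N \<le> (ou_covariance Q B t *v x) \<bullet> x"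
      by (subst divide_le_eq) (simp only: mult.commute[of "4 ^ N"], simp)
    moreover have "c1 * t ^ k = (t / real (Suc N)) ^ k * (c0 / 2)\<^sup>2 / 4 ^ N"
      by (simp add: c1_def power_divide ac_simps del: of_nat_Suc)
    ultimately show ?thesis by (simp only:)
  qed
  \<comment> \<open>Times beyond t0 are compared with \<open>min t t0\<close> by monotonicity of the
    covariance. The factor \<open>min 1 (t0 / T)\<close> scales every t \<le> T below t0 while
    leaving it at most t.\<close>
  define c where "c = c1 * (min 1 (t0 / T)) ^ k"
  have cpos: "c > 0" using c1 t0 T by (simp add: c_def)
  moreover have "c * t ^ k * (x \<bullet> x) \<le> (ou_covariance Q B t *v x) \<bullet> x" if t: "0 < t" "t \<le> T" for t x
  proof (cases "x = 0")
    case False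
    define y where "y = (1 / norm x) *\<^sub>R x"
    have y: "y \<in> ?S" using False by (simp add: y_def)
    have "min 1 (t0 / T) * t \<le> min t t0"
    proof (rule min.boundedI)
      show "min 1 (t0 / T) * t \<le> t" using t t0 T by (intro mult_left_le_one_le) auto
      have "min 1 (t0 / T) * t \<le> (t0 / T) * T" using t t0 T by (intro mult_mono) auto
      then show "min 1 (t0 / T) * t \<le> t0" using T by simp
    qed
    then have "(min 1 (t0 / T) * t) ^ k \<le> (min t t0) ^ k" using t t0 T by (intro power_mono) auto
    then have "c * t ^ k \<le> c1 * (min t t0) ^ k"
      using c1 by (simp add: c_def power_mult_distrib mult.assoc)
    also have "\<dots> \<le> (ou_covariance Q B (min t t0) *v y) \<bullet> y" using t t0 y by (intro main) auto
    also have "\<dots> \<le> (ou_covariance Q B t *v y) \<bullet> y" by (rule ou_covariance_mono) simp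
    also have "\<dots> = ((ou_covariance Q B t *v x) \<bullet> x) / (norm x)\<^sup>2"
      by (simp add: y_def matrix_vector_mult_scaleR power2_eq_square)
    finally show ?thesis using False
      by (simp add: field_simps power2_norm_eq_inner)
  qed simp
  ultimately show ?thesis using that by blast
qed

end

section \<open>Gaussian integrals\<close>

lemma matrix_inv_works:
  fixes A :: "real^'n^'n"
  assumes "invertible A"
  shows matrix_inv_right: "A ** matrix_inv A = mat 1" and matrix_inv_left: "matrix_inv A ** A = mat 1"
proof -
  have "\<exists>A'. A ** A' = mat 1 \<and> A' ** A = mat 1" using assms by (simp add: invertible_def)
  from someI_ex[OF this] show "A ** matrix_inv A = mat 1" "matrix_inv A ** A = mat 1"
    by (auto simp: matrix_inv_def)
qed

lemma pos_def_invertible: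
  fixes A :: "real^'n^'n"
  assumes "pos_def A" shows "invertible A"
proof -
  have "x = 0" if "A *v x = 0" for x
    using assms that unfolding pos_def_def by (metis inner_zero_left less_irrefl)
  then show ?thesis
    by (simp add: invertible_left_inverse matrix_left_invertible_ker)
qed

lemma pos_def_inverse:
  fixes A :: "real^'n^'n"
  assumes "pos_def A"
  shows "pos_def (matrix_inv A)"
proof -
  note inv = pos_def_invertible[OF assms]
  have sym: "transpose A = A" using assms by (simp add: pos_def_def)
  have "transpose (matrix_inv A) = transpose (matrix_inv A) ** (A ** matrix_inv A)"
    by (simp add: matrix_inv_right[OF inv])
  also have "\<dots> = transpose (A ** matrix_inv A) ** matrix_inv A"
    by (simp only: matrix_transpose_mul sym matrix_mul_assoc)
  also have "\<dots> = matrix_inv A" by (simp add: matrix_inv_right[OF inv] transpose_mat)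
  finally have 1: "transpose (matrix_inv A) = matrix_inv A" .
  have "0 < (matrix_inv A *v x) \<bullet> x" if "x \<noteq> 0" for x
  proof -
    define y where "y = matrix_inv A *v x"
    have x: "x = A *v y" by (simp add: y_def matrix_vector_mul_assoc matrix_inv_right[OF inv])
    then have "y \<noteq> 0" using that by auto
    then have "0 < (A *v y) \<bullet> y" using assms by (simp add: pos_def_def)
    then have "0 < x \<bullet> y" unfolding x[symmetric] .
    then show ?thesis unfolding y_def by (subst inner_commute)
  qed
  then show ?thesis using 1 by (simp add: pos_def_def)
qed

lemma symmetric_diagonalization:
  fixes A :: "real^'n^'n"
  assumes sym: "transpose A = A"
  obtains P d where "orthogonal_matrix P" "A = P ** (\<chi> i j. if i = j then d i else 0) ** transpose P"
proof -
  obtain E where E: "finite E" "pairwise orthogonal E" "\<And>e. e \<in> E \<Longrightarrow> norm e = 1"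
    "\<And>e. e \<in> E \<Longrightarrow> A *v e = ((A *v e) \<bullet> e) *\<^sub>R e" "span E = UNIV"
    using symmetric_eigenbasis[OF sym] by metis
  have "0 \<notin> E" using E(3)[of 0] by auto
  then have "independent E" using E(2) by (intro pairwise_orthogonal_independent)
  then have "card E = CARD('n)"
    using dim_span_eq_card_independent[of E] E(5) by simp
  then obtain b where b: "bij_betw b (UNIV :: 'n set) E"
    using finite_same_card_bij[of "UNIV :: 'n set" E] E(1) by auto
  have bE: "b j \<in> E" for j using b by (auto simp: bij_betw_def)
  have bi: "b i = b j \<longleftrightarrow> i = j" for i j using b by (auto simp: bij_betw_def inj_on_def)
  define P where "P = (\<chi> i j. b j $ i)"
  define d where "d j = (A *v b j) \<bullet> b j" for j
  have bb: "b i \<bullet> b j = (if i = j then 1 else 0)" for i j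
    using E(2,3) bE bi by (auto simp: pairwise_def orthogonal_def norm_eq_1)
  have PP: "transpose P ** P = mat 1"
    by (simp add: vec_eq_iff matrix_matrix_mult_def transpose_def P_def mat_def bb[unfolded inner_vec_def inner_real_def])
  then have o: "orthogonal_matrix P" by (simp add: orthogonal_matrix)
  have "A ** P = P ** (\<chi> i j. if i = j then d i else 0)"
  proof -
    have "(A ** P) $ i $ j = (A *v b j) $ i" for i j
      by (simp add: matrix_matrix_mult_def matrix_vector_mult_def P_def)
    moreover have "(P ** (\<chi> i j. if i = j then d i else 0)) $ i $ j = (d j *\<^sub>R b j) $ i" for i j
      by (simp add: matrix_matrix_mult_def P_def if_distrib cong: if_cong)
    ultimately show ?thesis using E(4)[OF bE] by (simp add: vec_eq_iff d_def)
  qed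
  then have "A = P ** (\<chi> i j. if i = j then d i else 0) ** transpose P"
    by (metis matrix_mul_assoc matrix_mul_rid o orthogonal_matrix_def)
  then show ?thesis using that o by blast
qed

section \<open>Lebesgue measure under reflections, translations and linear maps\<close>

lemma lborel_distr_reflect: "distr lborel borel (\<lambda>y. a - y) = (lborel :: 'a::euclidean_space measure)"
proof -
  have "(\<Sum>j\<in>Basis. ((-1) * (x \<bullet> j)) *\<^sub>R j) = - x" for x :: 'a
    by (simp add: sum_negf euclidean_representation)
  then show ?thesis
    using lborel_affine_euclidean[of "\<lambda>_. -1" a, symmetric] by (simp add: density_1)
qed

lemma lborel_distr_shift: "distr lborel borel (\<lambda>y. y + a) = (lborel :: 'a::euclidean_space measure)"
  using lborel_distr_plus[of a] by (simp add: add.commute[of _ a])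

lemma nn_integral_lborel_shift:
  fixes f :: "'a::euclidean_space \<Rightarrow> ennreal"
  assumes [measurable]: "f \<in> borel_measurable borel"
  shows "(\<integral>\<^sup>+y. f (y + a) \<partial>lborel) = (\<integral>\<^sup>+y. f y \<partial>lborel)"
  by (subst (2) lborel_distr_shift[of a, symmetric], subst nn_integral_distr) auto

lemma nn_integral_lborel_reflect:
  fixes f :: "'a::euclidean_space \<Rightarrow> ennreal"
  assumes [measurable]: "f \<in> borel_measurable borel"
  shows "(\<integral>\<^sup>+y. f (a - y) \<partial>lborel) = (\<integral>\<^sup>+y. f y \<partial>lborel)"
  by (subst (2) lborel_distr_reflect[of a, symmetric], subst nn_integral_distr) auto

lemma matrix_vector_measurable [measurable]:
  "(\<lambda>x. A *v x) \<in> borel_measurable borel" for A :: "real^'n^'m"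
  by (intro borel_measurable_continuous_onI linear_continuous_on matrix_vector_mul_bounded_linear)

text \<open>
  Any two translation invariant measures are proportional; this is the Fubini proof of that fact,
  specialised to the image of Lebesgue measure under \<open>A\<close>. The library's determinant formula for
  this factor requires a well-ordered index type.
\<close>

lemma nn_integral_lborel_linear:
  fixes A :: "real^'n^'n"
  assumes inv: "invertible A"
  obtains c where "c > 0" "\<And>f :: real^'n \<Rightarrow> ennreal. f \<in> borel_measurable borel \<Longrightarrow>
      (\<integral>\<^sup>+x. f (A *v x) \<partial>lborel) = ennreal c * (\<integral>\<^sup>+x. f x \<partial>lborel)"
proof -
  \<comment> \<open>A test function for which both G and C are positive and finite; the factor of
    proportionality is C / G.\<close>
  define g :: "real^'n \<Rightarrow> ennreal" where "g = indicator (ball 0 1)"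
  have [measurable]: "g \<in> borel_measurable borel" 
    unfolding g_def by (intro borel_measurable_indicator borel_open open_ball)
  define G where "G = (\<integral>\<^sup>+x. g x \<partial>lborel)"
  define C where "C = (\<integral>\<^sup>+x. g (- (A *v x)) \<partial>lborel)"
  have prod: "(\<integral>\<^sup>+x. f (A *v x) \<partial>lborel) * G = C * (\<integral>\<^sup>+x. f x \<partial>lborel)"
    if [measurable]: "f \<in> borel_measurable borel" for f
  proof -
    have "(\<integral>\<^sup>+y. f (A *v x) * g (y + - (A *v x)) \<partial>lborel) = f (A *v x) * G" for x
      unfolding G_def by (subst nn_integral_cmult, measurable) (subst nn_integral_lborel_shift, auto)
    then have "(\<integral>\<^sup>+x. f (A *v x) \<partial>lborel) * G = (\<integral>\<^sup>+x. (\<integral>\<^sup>+y. f (A *v x) * g (y + - (A *v x)) \<partial>lborel) \<partial>lborel)"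
      by (simp only:) (rule nn_integral_multc[symmetric], measurable)
    also have "\<dots> = (\<integral>\<^sup>+y. (\<integral>\<^sup>+x. f (A *v x) * g (y + - (A *v x)) \<partial>lborel) \<partial>lborel)"
      by (rule lborel_pair.Fubini'[symmetric]) measurable
    also have "\<dots> = (\<integral>\<^sup>+y. (\<integral>\<^sup>+x. f (A *v x + y) * g (- (A *v x)) \<partial>lborel) \<partial>lborel)"
    proof (rule nn_integral_cong)
      fix y
      \<comment> \<open>Translating x by the preimage of y moves the dependence on y from g to f,
        after which the integral in y can be carried out first.\<close>
      have s: "A *v (x + matrix_inv A *v y) = A *v x + y" for x
        by (simp add: matrix_vector_right_distrib matrix_vector_mul_assoc matrix_inv_right[OF inv])
      show "(\<integral>\<^sup>+x. f (A *v x) * g (y + - (A *v x)) \<partial>lborel) = (\<integral>\<^sup>+x. f (A *v x + y) * g (- (A *v x)) \<partial>lborel)"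
        by (subst nn_integral_lborel_shift[of _ "matrix_inv A *v y", symmetric]) (auto simp: s)
    qed
    also have "\<dots> = (\<integral>\<^sup>+x. (\<integral>\<^sup>+y. f (A *v x + y) * g (- (A *v x)) \<partial>lborel) \<partial>lborel)"
      by (rule lborel_pair.Fubini') measurable
    also have "\<dots> = (\<integral>\<^sup>+x. (\<integral>\<^sup>+y. f y \<partial>lborel) * g (- (A *v x)) \<partial>lborel)"
    proof (rule nn_integral_cong)
      fix x
      have "(\<integral>\<^sup>+y. f (y + A *v x) \<partial>lborel) = (\<integral>\<^sup>+y. f y \<partial>lborel)" by (rule nn_integral_lborel_shift) measurable
      then show "(\<integral>\<^sup>+y. f (A *v x + y) * g (- (A *v x)) \<partial>lborel) = (\<integral>\<^sup>+y. f y \<partial>lborel) * g (- (A *v x))"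
        by (subst nn_integral_multc) (auto simp: add.commute)
    qed
    also have "\<dots> = (\<integral>\<^sup>+y. f y \<partial>lborel) * C"
      unfolding C_def by (rule nn_integral_cmult) measurable
    finally show ?thesis by (simp add: mult.commute)
  qed
  have G0: "0 < G" "G < \<infinity>"
    using emeasure_lborel_ball_finite[of "0 :: real^'n" 1]
    by (auto simp: G_def g_def emeasure_ball)
  obtain K where K: "K > 0" "\<And>x. norm (A *v x) \<le> norm x * K"
    using bounded_linear.pos_bounded[OF matrix_vector_mul_bounded_linear] by blast
  obtain K' where K': "K' > 0" "\<And>x. norm (matrix_inv A *v x) \<le> norm x * K'"
    using bounded_linear.pos_bounded[OF matrix_vector_mul_bounded_linear] by blast
  have "C \<le> (\<integral>\<^sup>+x. indicator (ball 0 K') x \<partial>(lborel :: (real^'n) measure))"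
    unfolding C_def
  proof (rule nn_integral_mono)
    fix x :: "real^'n"
    have "norm x \<le> norm (A *v x) * K'"
      using K'(2)[of "A *v x"] by (simp add: matrix_vector_mul_assoc matrix_inv_left[OF inv])
    moreover have "norm (A *v x) * K' < 1 * K'" if "norm (A *v x) < 1"
      using that K'(1) by (rule mult_strict_right_mono)
    ultimately show "g (- (A *v x)) \<le> indicator (ball 0 K') x"
      by (auto simp: g_def indicator_def)
  qed
  also have "\<dots> < \<infinity>" using emeasure_lborel_ball_finite[of 0 K'] by simp
  finally have Cfin: "C < \<infinity>" .
  have "0 < (\<integral>\<^sup>+x. indicator (ball 0 (1 / K)) x \<partial>(lborel :: (real^'n) measure))"
    using K by (simp add: emeasure_ball)
  also have "\<dots> \<le> C"
    unfolding C_def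
  proof (rule nn_integral_mono)
    fix x :: "real^'n"
    have "norm (A *v x) < 1" if "norm x < 1 / K"
    proof -
      have "norm (A *v x) \<le> norm x * K" by (rule K)
      also have "\<dots> < 1" using that K(1) by (simp add: field_simps)
      finally show ?thesis .
    qed
    then show "indicator (ball 0 (1 / K)) x \<le> g (- (A *v x))"
      by (auto simp: g_def indicator_def)
  qed
  finally have C0: "C > 0" .
  define c where "c = enn2real C / enn2real G"
  have "c > 0" using C0 Cfin G0 by (simp add: c_def enn2real_positive_iff)
  moreover have "(\<integral>\<^sup>+x. f (A *v x) \<partial>lborel) = ennreal c * (\<integral>\<^sup>+x. f x \<partial>lborel)"
    if "f \<in> borel_measurable borel" for f
  proof -
    have eG: "ennreal (enn2real G) = G" and eC: "ennreal (enn2real C) = C" using G0 Cfin by auto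
    have pG: "0 < enn2real G" using G0 by (simp add: enn2real_positive_iff)
    have cG: "ennreal c * G = C"
      by (subst eG[symmetric], subst eC[symmetric], subst ennreal_mult'[symmetric])
        (use pG in \<open>auto simp: c_def\<close>)
    have "(\<integral>\<^sup>+x. f (A *v x) \<partial>lborel) * G = (ennreal c * (\<integral>\<^sup>+x. f x \<partial>lborel)) * G"
      unfolding prod[OF that] cG[symmetric] by (simp only: mult_ac)
    then show ?thesis using G0 by (metis ennreal_mult_cancel_left mult.commute less_irrefl infinity_ennreal_def)
  qed
  ultimately show ?thesis using that by blast
qed

text \<open>The factor of the linear substitution is determined by testing it on the unit ball,
  which an isometry preserves.\<close>

lemma nn_integral_lborel_orthogonal:
  fixes f :: "real^'n \<Rightarrow> ennreal"
  assumes P: "orthogonal_matrix P" and f: "f \<in> borel_measurable borel"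
  shows "(\<integral>\<^sup>+x. f (P *v x) \<partial>lborel) = (\<integral>\<^sup>+x. f x \<partial>lborel)"
proof -
  have inv: "invertible P" using P by (auto simp: orthogonal_matrix_def invertible_def)
  obtain c where c: "c > 0" "\<And>f :: real^'n \<Rightarrow> ennreal. f \<in> borel_measurable borel \<Longrightarrow>
      (\<integral>\<^sup>+x. f (P *v x) \<partial>lborel) = ennreal c * (\<integral>\<^sup>+x. f x \<partial>lborel)"
    using nn_integral_lborel_linear[OF inv] by blast
  have n: "norm (P *v x) = norm x" for x
  proof -
    have "(P *v x) \<bullet> (P *v x) = x \<bullet> x"
      using P by (simp only: inner_matrix_vector matrix_vector_mul_assoc orthogonal_matrix_def matrix_vector_mul_lid)
    then show ?thesis by (simp add: norm_eq_sqrt_inner)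
  qed
  let ?b = "emeasure lborel (ball 0 1 :: (real^'n) set)"
  have "?b = ennreal c * ?b"
  proof -
    have "indicator (ball 0 1) (P *v x) = (indicator (ball 0 1) x :: ennreal)" for x
      using n[of x] by (auto simp: indicator_def)
    then show ?thesis
      using c(2)[of "indicator (ball 0 1)", OF borel_measurable_indicator[OF borel_open[OF open_ball]]] by simp
  qed
  moreover have "?b \<noteq> 0" using unit_ball_vol_pos[of "real CARD('n)"] by (simp add: emeasure_ball del: unit_ball_vol_pos)
  moreover have "?b \<noteq> \<infinity>" by (metis emeasure_lborel_ball_finite less_irrefl)
  ultimately have "ennreal c = 1"
    by (metis ennreal_mult_cancel_left infinity_ennreal_def mult.commute mult_1)
  then show ?thesis using c(2)[OF f] by simp
qed

section \<open>The centred Gaussian density with covariance A\<close>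

definition gauss_const :: "real^'n^'n \<Rightarrow> real" where
  "gauss_const A = 1 / ((2 * pi) powr (real CARD('n) / 2) * sqrt (det A))"

definition gauss_form :: "real^'n^'n \<Rightarrow> real^'n \<Rightarrow> real" where
  "gauss_form A x = (matrix_inv A *v x) \<bullet> x"

definition gauss :: "real^'n^'n \<Rightarrow> real^'n \<Rightarrow> real" where
  "gauss A x = gauss_const A * exp (- (1/2) * gauss_form A x)"

lemma gauss_form_measurable [measurable]: "gauss_form A \<in> borel_measurable borel"
  unfolding gauss_form_def[abs_def] by measurable

lemma gauss_measurable [measurable]: "gauss A \<in> borel_measurable borel"
  unfolding gauss_def[abs_def] by measurable

lemma nn_integral_gauss_real:
  assumes "d > 0"
  shows "(\<integral>\<^sup>+x. ennreal (exp (- (x\<^sup>2) / (2 * d))) \<partial>lborel) = ennreal (sqrt (2 * pi * d))"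
proof -
  have "exp (- (x\<^sup>2) / (2 * d)) = sqrt (2 * pi * d) * normal_density 0 (sqrt d) x" for x
    using assms by (simp add: normal_density_def)
  then have "(\<integral>\<^sup>+x. ennreal (exp (- (x\<^sup>2) / (2 * d))) \<partial>lborel)
      = (\<integral>\<^sup>+x. ennreal (sqrt (2 * pi * d)) * ennreal (normal_density 0 (sqrt d) x) \<partial>lborel)"
    using assms by (simp add: ennreal_mult'')
  also have "\<dots> = ennreal (sqrt (2 * pi * d)) * (\<integral>\<^sup>+x. ennreal (normal_density 0 (sqrt d) x) \<partial>lborel)"
    by (rule nn_integral_cmult) auto
  also have "(\<integral>\<^sup>+x. ennreal (normal_density 0 (sqrt d) x) \<partial>lborel) = ennreal 1"
    using assms by (subst nn_integral_eq_integral) auto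
  finally show ?thesis by simp
qed

text \<open>In the orthonormal eigenbasis the form is the sum of x_i^2 / d_i and the integral
  factors into one-dimensional Gaussian integrals, while the determinant is the product of the
  d_i.\<close>

lemma pos_def_det_and_integral:
  fixes A :: "real^'n^'n"
  assumes "pos_def A"
  shows pos_def_det: "det A > 0"
    and nn_integral_exp_gauss_form: "(\<integral>\<^sup>+x. ennreal (exp (- (1/2) * gauss_form A x)) \<partial>lborel)
      = ennreal ((2 * pi) powr (real CARD('n) / 2) * sqrt (det A))"
proof -
  have sym: "transpose A = A" using assms by (simp add: pos_def_def)
  obtain P d where P: "orthogonal_matrix P" and A: "A = P ** (\<chi> i j. if i = j then d i else 0) ** transpose P"
    using symmetric_diagonalization[OF sym] by blast
  let ?D = "(\<chi> i j. if i = j then d i else 0) :: real^'n^'n"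
  have PP: "transpose P ** P = mat 1" "P ** transpose P = mat 1" using P by (auto simp: orthogonal_matrix_def)
  have dpos: "d i > 0" for i
  proof -
    define x where "x = P *v axis i 1"
    have tx: "transpose P *v x = axis i 1" by (simp add: x_def matrix_vector_mul_assoc PP)
    then have "x \<noteq> 0" by (metis axis_eq_0_iff matrix_vector_mult_0_right zero_neq_one)
    then have "0 < (A *v x) \<bullet> x" using assms by (simp add: pos_def_def)
    also have "(A *v x) \<bullet> x = (P *v (?D *v axis i 1)) \<bullet> x"
      by (simp only: A matrix_vector_mul_assoc[symmetric] tx)
    also have "\<dots> = (?D *v axis i 1) \<bullet> axis i 1"
      by (simp only: inner_matrix_vector[of P] tx)
    also have "\<dots> = d i"
      by (simp add: inner_axis matrix_vector_mult_basis column_def)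
    finally show ?thesis .
  qed
  have detD: "det ?D = (\<Prod>i\<in>UNIV. d i)"
    by (subst det_diagonal) auto
  have "det P * det (transpose P) = 1" using PP(2) by (metis det_I det_mul)
  then have detA: "det A = (\<Prod>i\<in>UNIV. d i)" by (simp add: A det_mul detD[symmetric])
  then show "det A > 0" using dpos by (simp add: prod_pos)
  let ?Di = "(\<chi> i j. if i = j then 1 / d i else 0) :: real^'n^'n"
  have d0: "d i \<noteq> 0" for i using dpos[of i] by simp
  have DD: "?D ** ?Di = mat 1"
  proof -
    have "(?D ** ?Di) $ i $ j = (mat 1 :: real^'n^'n) $ i $ j" for i j
    proof -
      have "(?D ** ?Di) $ i $ j = (\<Sum>k\<in>UNIV. if k = i then (if i = j then 1 else 0) else 0)"
        unfolding matrix_matrix_mult_def vec_lambda_beta by (intro sum.cong) (use d0 in auto)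
      then show ?thesis by (simp add: mat_def)
    qed
    then show ?thesis by (simp only: vec_eq_iff) blast
  qed
  have "A ** (P ** ?Di ** transpose P) = P ** ?D ** (transpose P ** P) ** ?Di ** transpose P"
    by (simp only: A matrix_mul_assoc)
  also have "\<dots> = P ** (?D ** ?Di) ** transpose P" by (simp only: PP matrix_mul_rid matrix_mul_assoc)
  also have "\<dots> = mat 1" by (simp only: DD PP matrix_mul_rid)
  finally have "matrix_inv A ** (A ** (P ** ?Di ** transpose P)) = matrix_inv A" by simp
  then have inv: "matrix_inv A = P ** ?Di ** transpose P"
    by (simp add: matrix_mul_assoc matrix_inv_left[OF pos_def_invertible[OF assms]])
  have form: "gauss_form A (P *v x) = (\<Sum>i\<in>UNIV. (x $ i)\<^sup>2 / d i)" for x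
  proof -
    have "gauss_form A (P *v x) = (P *v (?Di *v ((transpose P ** P) *v x))) \<bullet> (P *v x)"
      by (simp only: gauss_form_def inv matrix_vector_mul_assoc matrix_mul_assoc)
    also have "\<dots> = (?Di *v ((transpose P ** P) *v x)) \<bullet> ((transpose P ** P) *v x)"
      by (subst inner_matrix_vector) (simp only: matrix_vector_mul_assoc matrix_mul_assoc)
    also have "\<dots> = (?Di *v x) \<bullet> x" by (simp only: PP matrix_vector_mul_lid)
    also have "\<dots> = (\<Sum>i\<in>UNIV. (x $ i)\<^sup>2 / d i)"
    proof -
      have "(?Di *v x) $ i = x $ i / d i" for i
      proof -
        have "(?Di *v x) $ i = (\<Sum>k\<in>UNIV. if k = i then x $ i / d i else 0)"
          unfolding matrix_vector_mult_def vec_lambda_beta by (intro sum.cong) auto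
        then show ?thesis by simp
      qed
      then show ?thesis by (simp add: inner_vec_def power2_eq_square)
    qed
    finally show ?thesis .
  qed
  \<comment> \<open>The product formula for Lebesgue measure runs over \<open>Basis\<close>, the
    eigenvalues over the index type; \<open>ix\<close> translates between them.\<close>
  define ix where "ix b = (SOME i :: 'n. b = axis i (1 :: real))" for b
  have ix: "ix (axis i 1) = i" for i by (simp add: ix_def axis_eq_axis)
  have Bas: "(Basis :: (real^'n) set) = (\<lambda>i. axis i 1) ` UNIV" by (auto simp: Basis_vec_def)
  have inj: "inj (\<lambda>i :: 'n. axis i (1 :: real))" by (auto simp: inj_on_def axis_eq_axis)
  have "(\<integral>\<^sup>+x. ennreal (exp (- (1/2) * gauss_form A x)) \<partial>lborel) = (\<integral>\<^sup>+x. ennreal (exp (- (1/2) * gauss_form A (P *v x))) \<partial>lborel)"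
    by (rule nn_integral_lborel_orthogonal[OF P, symmetric]) measurable
  also have "\<dots> = (\<integral>\<^sup>+x. (\<Prod>b\<in>Basis. ennreal (exp (- ((x \<bullet> b)\<^sup>2) / (2 * d (ix b))))) \<partial>(lborel :: (real^'n) measure))"
  proof (rule nn_integral_cong)
    fix x :: "real^'n"
    have "(\<Prod>b\<in>Basis. exp (- ((x \<bullet> b)\<^sup>2) / (2 * d (ix b)))) = (\<Prod>i\<in>UNIV. exp (- ((x $ i)\<^sup>2) / (2 * d i)))"
      unfolding Bas by (subst prod.reindex) (auto simp: inj ix inner_axis)
    also have "\<dots> = exp (- (1/2) * gauss_form A (P *v x))"
      by (simp add: form exp_sum[symmetric] sum_distrib_left sum_negf)
    finally show "ennreal (exp (- (1/2) * gauss_form A (P *v x))) = (\<Prod>b\<in>Basis. ennreal (exp (- ((x \<bullet> b)\<^sup>2) / (2 * d (ix b)))))"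
      by (simp add: prod_ennreal)
  qed
  also have "\<dots> = (\<Prod>b\<in>(Basis :: (real^'n) set). \<integral>\<^sup>+y. ennreal (exp (- (y\<^sup>2) / (2 * d (ix b)))) \<partial>lborel)"
    by (rule nn_integral_lborel_prod) auto
  also have "\<dots> = (\<Prod>b\<in>(Basis :: (real^'n) set). ennreal (sqrt (2 * pi * d (ix b))))"
    by (simp only: nn_integral_gauss_real[OF dpos])
  also have "\<dots> = (\<Prod>i\<in>(UNIV :: 'n set). ennreal (sqrt (2 * pi * d i)))"
    unfolding Bas by (subst prod.reindex) (auto simp: inj ix)
  also have "\<dots> = ennreal (\<Prod>i\<in>(UNIV :: 'n set). sqrt (2 * pi * d i))"
    using dpos by (intro prod_ennreal) (simp add: less_imp_le)
  also have "(\<Prod>i\<in>(UNIV :: 'n set). sqrt (2 * pi * d i)) = sqrt (2 * pi) ^ CARD('n) * sqrt (det A)"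
  proof -
    have "(\<Prod>i\<in>I. sqrt (d i)) = sqrt (\<Prod>i\<in>I. d i)" if "finite I" for I
      using that by induction (auto simp: real_sqrt_mult)
    then show ?thesis by (simp add: real_sqrt_mult prod.distrib detA)
  qed
  also have "sqrt (2 * pi) ^ CARD('n) = (2 * pi) powr (real CARD('n) / 2)"
    by (simp add: powr_half_sqrt[symmetric] powr_powr powr_realpow[symmetric] mult.commute)
  finally show "(\<integral>\<^sup>+x. ennreal (exp (- (1/2) * gauss_form A x)) \<partial>lborel)
      = ennreal ((2 * pi) powr (real CARD('n) / 2) * sqrt (det A))" .
qed

lemma gauss_const_pos: "pos_def A \<Longrightarrow> gauss_const A > 0"
  by (simp add: gauss_const_def pos_def_det)

lemma gauss_nonneg: "pos_def A \<Longrightarrow> gauss A x \<ge> 0"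
  using gauss_const_pos[of A] by (simp add: gauss_def)

lemma gauss_form_nonneg: "pos_def A \<Longrightarrow> gauss_form A x \<ge> 0"
  using pos_def_inverse[of A] by (cases "x = 0") (auto simp: gauss_form_def pos_def_def less_imp_le)

lemma gauss_le: "pos_def A \<Longrightarrow> gauss A x \<le> gauss_const A"
  using gauss_const_pos[of A] gauss_form_nonneg[of A x] by (simp add: gauss_def)

lemma nn_integral_gauss:
  fixes A :: "real^'n^'n"
  assumes "pos_def A"
  shows "(\<integral>\<^sup>+x. ennreal (gauss A x) \<partial>lborel) = 1"
proof -
  have "(\<integral>\<^sup>+x. ennreal (gauss A x) \<partial>lborel)
      = ennreal (gauss_const A) * (\<integral>\<^sup>+x. ennreal (exp (- (1/2) * gauss_form A x)) \<partial>lborel)"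
    using gauss_const_pos[OF assms]
    by (subst nn_integral_cmult[symmetric]) (auto simp: gauss_def ennreal_mult)
  also have "\<dots> = 1"
    unfolding nn_integral_exp_gauss_form[OF assms] using pos_def_det[OF assms]
    by (subst ennreal_mult[symmetric]) (auto simp: gauss_const_def)
  finally show ?thesis .
qed

text \<open>The substitution of sqrt 2 * x restores the exponent 1/2, so the value is the inverse of
  the scaling factor of \<open>S\<close> and is the same for every A. The exponent 1/4 is what
  \<open>gauss_interpolation\<close> leaves of 1/2.\<close>

lemma nn_integral_gauss_quarter:
  obtains c where "c > 0"
    "\<And>A :: real^'n^'n. pos_def A \<Longrightarrow> (\<integral>\<^sup>+x. ennreal (gauss_const A * exp (- (1/4) * gauss_form A x)) \<partial>lborel) = ennreal c"
proof -
  define S :: "real^'n^'n" where "S = sqrt 2 *\<^sub>R mat 1"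
  have Sx: "S *v x = sqrt 2 *\<^sub>R x" for x
    by (simp add: S_def bounded_bilinear.scaleR_left[OF bounded_bilinear_matrix_vector_mult])
  have "S ** ((1 / sqrt 2) *\<^sub>R mat 1) = mat 1" "((1 / sqrt 2) *\<^sub>R mat 1) ** S = mat 1"
    by (simp_all add: S_def bounded_bilinear.scaleR_left[OF bounded_bilinear_matrix_mult]
        bounded_bilinear.scaleR_right[OF bounded_bilinear_matrix_mult])
  then have "invertible S" unfolding invertible_def by blast
  from nn_integral_lborel_linear[OF this] obtain c where c: "c > 0"
    "\<And>f :: real^'n \<Rightarrow> ennreal. f \<in> borel_measurable borel \<Longrightarrow>
      (\<integral>\<^sup>+x. f (S *v x) \<partial>lborel) = ennreal c * (\<integral>\<^sup>+x. f x \<partial>lborel)" by blast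
  have "(\<integral>\<^sup>+x. ennreal (gauss_const A * exp (- (1/4) * gauss_form A x)) \<partial>lborel) = ennreal (1 / c)"
    if A: "pos_def A" for A :: "real^'n^'n"
  proof -
    have f: "gauss_form A (S *v x) = 2 * gauss_form A x" for x
      by (simp add: Sx gauss_form_def matrix_vector_mult_scaleR)
    let ?I = "\<integral>\<^sup>+x. ennreal (gauss_const A * exp (- (1/4) * gauss_form A x)) \<partial>lborel"
    have "ennreal c * ?I = (\<integral>\<^sup>+x. ennreal (gauss_const A * exp (- (1/4) * gauss_form A (S *v x))) \<partial>lborel)"
      by (rule c(2)[symmetric]) measurable
    also have "\<dots> = (\<integral>\<^sup>+x. ennreal (gauss A x) \<partial>lborel)" by (simp add: f gauss_def)
    also have "\<dots> = 1" by (rule nn_integral_gauss[OF A])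
    finally have "ennreal (1 / c) * (ennreal c * ?I) = ennreal (1 / c)" by simp
    moreover have "ennreal (1 / c) * ennreal c = 1" using c(1) by (simp add: ennreal_mult[symmetric])
    ultimately show ?thesis by (simp add: mult.assoc[symmetric])
  qed
  then show ?thesis using that[of "1 / c"] c(1) by simp
qed

section \<open>Convolution of Gaussians\<close>

lemma pos_def_add_conj:
  fixes A C E :: "real^'n^'n"
  assumes A: "pos_def A" and C: "pos_def C"
  shows "pos_def (C + E ** A ** transpose E)"
proof -
  have "0 < ((C + E ** A ** transpose E) *v x) \<bullet> x" if "x \<noteq> 0" for x
  proof -
    have "((E ** A ** transpose E) *v x) \<bullet> x = (A *v (transpose E *v x)) \<bullet> (transpose E *v x)"
      by (simp only: matrix_vector_mul_assoc[symmetric] inner_matrix_vector[of E])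
    also have "\<dots> \<ge> 0" using A by (cases "transpose E *v x = 0") (auto simp: pos_def_def less_imp_le)
    finally have "0 \<le> ((E ** A ** transpose E) *v x) \<bullet> x" .
    moreover have "0 < (C *v x) \<bullet> x" using C that by (simp add: pos_def_def)
    ultimately show ?thesis by (simp add: matrix_vector_mult_add_rdistrib inner_add_left)
  qed
  moreover have "transpose (C + E ** A ** transpose E) = C + E ** A ** transpose E"
    using A C linear_add[OF bounded_linear.linear[OF bounded_linear_transpose], of C "E ** A ** transpose E"]
    by (simp add: pos_def_def matrix_transpose_mul matrix_mul_assoc)
  ultimately show ?thesis by (simp add: pos_def_def)
qed

text \<open>The minimiser is \<open>m = A E\<^sup>T (C + E A E\<^sup>T)\<^sup>-\<^sup>1 a\<close>.\<close>

lemma gauss_form_complete_square: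
  fixes A C E :: "real^'n^'n"
  assumes A: "pos_def A" and C: "pos_def C"
  defines "S \<equiv> C + E ** A ** transpose E"
  obtains m where "\<And>z. gauss_form A (z + m) + gauss_form C (a - E *v (z + m))
      = gauss_form A z + gauss_form C (E *v z) + gauss_form S a"
proof -
  have S: "pos_def S" unfolding S_def by (rule pos_def_add_conj[OF A C])
  define b where "b = matrix_inv S *v a"
  define w where "w = transpose E *v b"
  define m where "m = A *v w"
  \<comment> \<open>Consequently the inverse of C sends a - E m to b and the inverse of A sends m to
    w, the image of b under the transpose of E. This is why the terms linear in z cancel
    below.\<close>
  have a: "a = C *v b + E *v m"
  proof -
    have "a = S *v b" by (simp add: b_def matrix_vector_mul_assoc matrix_inv_right[OF pos_def_invertible[OF S]])
    also have "\<dots> = C *v b + E *v m"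
      unfolding S_def m_def w_def
      by (simp only: matrix_vector_mult_add_rdistrib matrix_vector_mul_assoc matrix_mul_assoc)
    finally show ?thesis .
  qed
  have iA: "matrix_inv A *v m = w"
    by (simp add: m_def matrix_vector_mul_assoc matrix_inv_left[OF pos_def_invertible[OF A]])
  have iC: "matrix_inv C *v (C *v b) = b"
    by (simp add: matrix_vector_mul_assoc matrix_inv_left[OF pos_def_invertible[OF C]])
  have sA: "transpose (matrix_inv A) = matrix_inv A" and sC: "transpose (matrix_inv C) = matrix_inv C"
    using pos_def_inverse[OF A] pos_def_inverse[OF C] by (auto simp: pos_def_def)
  have "gauss_form A (z + m) + gauss_form C (a - E *v (z + m))
      = gauss_form A z + gauss_form C (E *v z) + gauss_form S a" for z
  proof -
    have 1: "gauss_form A (z + m) = gauss_form A z + 2 * (w \<bullet> z) + w \<bullet> m"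
    proof -
      have "(matrix_inv A *v z) \<bullet> m = z \<bullet> w"
        using inner_matrix_vector[of "matrix_inv A" z m] by (simp only: sA iA)
      then show ?thesis
        unfolding gauss_form_def matrix_vector_right_distrib iA
        by (simp add: inner_add_left inner_add_right inner_commute[of z w])
    qed
    have r: "a - E *v (z + m) = C *v b - E *v z"
      by (subst a) (simp add: matrix_vector_right_distrib)
    have wz: "b \<bullet> (E *v z) = w \<bullet> z"
      using inner_matrix_vector[of E z b] by (simp add: w_def inner_commute)
    have 2: "gauss_form C (a - E *v (z + m)) = gauss_form C (E *v z) - 2 * (w \<bullet> z) + b \<bullet> (C *v b)"
    proof -
      have "(matrix_inv C *v (E *v z)) \<bullet> (C *v b) = (E *v z) \<bullet> b"
        using inner_matrix_vector[of "matrix_inv C" "E *v z" "C *v b"] by (simp only: sC iC)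
      then show ?thesis
        unfolding gauss_form_def r matrix_vector_mult_diff_distrib iC
        by (simp add: inner_diff_left inner_diff_right wz inner_commute[of "E *v z" b])
    qed
    have "w \<bullet> m = b \<bullet> (E *v m)"
      using inner_matrix_vector[of E m b] by (simp add: w_def inner_commute)
    then have "w \<bullet> m + b \<bullet> (C *v b) = b \<bullet> a"
      using arg_cong[OF a, of "inner b"] by (simp add: inner_add_right)
    also have "b \<bullet> a = gauss_form S a" by (simp add: gauss_form_def b_def)
    finally show ?thesis using 1 2 by linarith
  qed
  then show ?thesis using that by blast
qed

text \<open>Completing the square gives the right-hand side up to a factor k that does not depend on
  a. Integrating over a, where all three densities have mass one, gives k = 1.\<close>

lemma gauss_convolution:
  fixes A C E :: "real^'n^'n"
  assumes A: "pos_def A" and C: "pos_def C"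
  shows "(\<integral>\<^sup>+y. ennreal (gauss A y) * ennreal (gauss C (a - E *v y)) \<partial>lborel)
    = ennreal (gauss (C + E ** A ** transpose E) a)"
proof -
  let ?S = "C + E ** A ** transpose E"
  have S: "pos_def ?S" by (rule pos_def_add_conj[OF A C])
  note [simp] = gauss_const_pos[OF A] gauss_const_pos[OF C] gauss_const_pos[OF S]
    gauss_nonneg[OF A] gauss_nonneg[OF C] gauss_nonneg[OF S]
  let ?F = "\<lambda>a. \<integral>\<^sup>+y. ennreal (gauss A y) * ennreal (gauss C (a - E *v y)) \<partial>lborel"
  let ?g = "\<lambda>z. gauss A z * gauss C (E *v z) / gauss_const ?S"
  define k where "k = (\<integral>\<^sup>+z. ennreal (?g z) \<partial>lborel)"
  have F: "?F a = k * ennreal (gauss ?S a)" for a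
  proof -
    obtain m where m: "\<And>z. gauss_form A (z + m) + gauss_form C (a - E *v (z + m))
      = gauss_form A z + gauss_form C (E *v z) + gauss_form ?S a"
      using gauss_form_complete_square[OF A C] by blast
    have "gauss A (z + m) * gauss C (a - E *v (z + m)) = ?g z * gauss ?S a" for z
    proof -
      have "gauss A (z + m) * gauss C (a - E *v (z + m))
         = gauss_const A * gauss_const C * exp (- (1/2) * (gauss_form A (z + m) + gauss_form C (a - E *v (z + m))))"
        by (simp add: gauss_def exp_add[symmetric] algebra_simps)
      also have "\<dots> = gauss_const A * gauss_const C * exp (- (1/2) * (gauss_form A z + gauss_form C (E *v z) + gauss_form ?S a))"
        unfolding m ..
      also have "\<dots> = gauss_const A * gauss_const C * (exp (- (1/2) * gauss_form A z) * exp (- (1/2) * gauss_form C (E *v z)) * exp (- (1/2) * gauss_form ?S a))"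
        by (simp add: exp_add[symmetric] algebra_simps)
      also have "\<dots> = ?g z * gauss ?S a"
      proof -
        have "gauss_const ?S \<noteq> 0" using gauss_const_pos[OF S] by linarith
        then show ?thesis by (simp add: gauss_def)
      qed
      finally show ?thesis .
    qed
    then have e: "ennreal (gauss A (z + m)) * ennreal (gauss C (a - E *v (z + m))) = ennreal (?g z) * ennreal (gauss ?S a)" for z
      by (simp add: ennreal_mult[symmetric] less_imp_le)
    have "?F a = (\<integral>\<^sup>+z. ennreal (gauss A (z + m)) * ennreal (gauss C (a - E *v (z + m))) \<partial>lborel)"
      by (rule nn_integral_lborel_shift[symmetric]) measurable
    also have "\<dots> = k * ennreal (gauss ?S a)"
      unfolding e k_def by (rule nn_integral_multc) measurable
    finally show ?thesis .
  qed
  have "(\<integral>\<^sup>+a. ennreal (gauss C (a + - (E *v y))) \<partial>lborel) = 1" for y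
    by (subst nn_integral_lborel_shift, measurable) (rule nn_integral_gauss[OF C])
  then have "1 = (\<integral>\<^sup>+y. ennreal (gauss A y) * (\<integral>\<^sup>+a. ennreal (gauss C (a + - (E *v y))) \<partial>lborel) \<partial>lborel)"
    by (simp only: nn_integral_gauss[OF A] mult_1_right)
  also have "\<dots> = (\<integral>\<^sup>+y. (\<integral>\<^sup>+a. ennreal (gauss A y) * ennreal (gauss C (a - E *v y)) \<partial>lborel) \<partial>lborel)"
    by (subst nn_integral_cmult[symmetric]) auto
  also have "\<dots> = (\<integral>\<^sup>+a. ?F a \<partial>lborel)" by (rule lborel_pair.Fubini') measurable
  also have "\<dots> = k" unfolding F by (subst nn_integral_cmult) (auto simp: nn_integral_gauss[OF S])
  finally show ?thesis using F by simp
qed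

section \<open>Extrapolation of Gaussians by Lagrange interpolation\<close>

text \<open>The value at 1 of the j-th Lagrange basis polynomial for the nodes t 0, ..., t
  M.\<close>

definition lagrange_weight :: "(nat \<Rightarrow> real) \<Rightarrow> nat \<Rightarrow> nat \<Rightarrow> real" where
  "lagrange_weight t M j = (\<Prod>i\<in>{..M} - {j}. (1 - t i) / (t j - t i))"

text \<open>The interpolation polynomial of x^m minus x^m itself has degree at most M and M + 1
  roots. Hence it is zero, in particular at 1.\<close>

lemma lagrange_weight_exact:
  assumes inj: "inj_on t {..M}" and m: "m \<le> M"
  shows "(\<Sum>j\<le>M. lagrange_weight t M j * t j ^ m) = 1"
proof -
  define L where "L j = (\<Prod>i\<in>{..M} - {j}. smult (1 / (t j - t i)) [:- t i, 1:])" for j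
  have L: "poly (L j) x = (\<Prod>i\<in>{..M} - {j}. (x - t i) / (t j - t i))" for j x
    by (simp add: L_def poly_prod diff_divide_distrib)
  have dL: "degree (L j) \<le> M" if "j \<le> M" for j
  proof -
    have "degree (L j) \<le> (\<Sum>i\<in>{..M} - {j}. degree (smult (1 / (t j - t i)) [:- t i, 1:]))"
      unfolding L_def
      by (rule order_trans[OF degree_prod_sum_le]) (simp_all only: o_def finite_Diff finite_atMost order_refl)
    also have "\<dots> \<le> (\<Sum>i\<in>{..M} - {j}. 1)" by (intro sum_mono) (simp add: degree_smult_eq)
    also have "\<dots> = M" using that by simp
    finally show ?thesis .
  qed
  have Lk: "poly (L j) (t k) = (if k = j then 1 else 0)" if "j \<le> M" "k \<le> M" for j k
  proof (cases "k = j")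
    case True
    have "t j \<noteq> t i" if "i \<in> {..M} - {j}" for i
      using inj \<open>j \<le> M\<close> that by (auto simp: inj_on_def)
    then show ?thesis using True by (simp add: L)
  next
    case False
    then have "k \<in> {..M} - {j}" using that by simp
    then show ?thesis using False unfolding L by (auto intro!: prod_zero)
  qed
  define p where "p = (\<Sum>j\<le>M. smult (t j ^ m) (L j)) - monom 1 m"
  have dp: "degree p \<le> M"
    unfolding p_def using m
    by (intro degree_diff_le degree_sum_le) (auto intro: order_trans[OF degree_smult_le] dL simp: degree_monom_eq)
  have root: "poly p (t k) = 0" if "k \<le> M" for k
  proof -
    have "(\<Sum>j\<le>M. t j ^ m * poly (L j) (t k)) = (\<Sum>j\<le>M. if j = k then t k ^ m else 0)"
      using that by (intro sum.cong) (auto simp: Lk)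
    then show ?thesis using that by (simp add: p_def poly_sum poly_monom)
  qed
  have "p = 0"
  proof (rule ccontr)
    assume "p \<noteq> 0"
    have "Suc M = card (t ` {..M})" using inj by (simp add: card_image)
    also have "\<dots> \<le> card {x. poly p x = 0}"
      using root \<open>p \<noteq> 0\<close> by (intro card_mono poly_roots_finite) auto
    also have "\<dots> \<le> degree p" by (rule card_poly_roots_bound[OF \<open>p \<noteq> 0\<close>])
    finally show False using dp by simp
  qed
  then have "poly p 1 = 0" by simp
  then show ?thesis
    by (simp add: p_def poly_sum poly_monom L lagrange_weight_def mult.commute)
qed

text \<open>Staying above \<rho> / 2 keeps the Jacobians of the contractions bounded independently
  of M.\<close>

definition unif_node :: "real \<Rightarrow> nat \<Rightarrow> nat \<Rightarrow> real" where
  "unif_node \<rho> M j = \<rho> / 2 + \<rho> / 2 * (real j / real M)"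

lemma unif_node_bounds:
  assumes "0 < \<rho>" "1 \<le> M" "j \<le> M"
  shows "\<rho> / 2 \<le> unif_node \<rho> M j" "unif_node \<rho> M j \<le> \<rho>"
proof -
  have "real j / real M \<le> 1" using assms by simp
  then have "\<rho> / 2 * (real j / real M) \<le> \<rho> / 2 * 1" using assms by (intro mult_left_mono) auto
  then show "unif_node \<rho> M j \<le> \<rho>" by (simp add: unif_node_def)
  show "\<rho> / 2 \<le> unif_node \<rho> M j" using assms by (simp add: unif_node_def)
qed

lemma inj_unif_node: "0 < \<rho> \<Longrightarrow> 1 \<le> M \<Longrightarrow> inj (unif_node \<rho> M)"
  by (auto simp: inj_on_def unif_node_def)

lemma prod_abs_diff_fact:
  assumes "j \<le> M"
  shows "(\<Prod>i\<in>{..M} - {j}. \<bar>real j - real i\<bar>) = fact j * fact (M - j)"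
proof -
  have "(\<Prod>i\<in>{..M} - {j}. \<bar>real j - real i\<bar>) = (\<Prod>i\<in>{..<j} \<union> {j<..M}. \<bar>real j - real i\<bar>)"
    using assms by (intro prod.cong) auto
  also have "\<dots> = (\<Prod>i<j. \<bar>real j - real i\<bar>) * (\<Prod>i\<in>{j<..M}. \<bar>real j - real i\<bar>)"
    by (rule prod.union_disjoint) auto
  also have "(\<Prod>i<j. \<bar>real j - real i\<bar>) = (\<Prod>i\<in>{1..j}. real i)"
    by (rule prod.reindex_bij_witness[of _ "\<lambda>i. j - i" "\<lambda>i. j - i"]) (auto simp: of_nat_diff)
  also have "(\<Prod>i\<in>{j<..M}. \<bar>real j - real i\<bar>) = (\<Prod>i\<in>{1..M - j}. real i)"
    by (rule prod.reindex_bij_witness[of _ "\<lambda>i. i + j" "\<lambda>i. i - j"]) (auto simp: of_nat_diff)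
  finally show ?thesis by (simp add: fact_prod)
qed

text \<open>The left-hand side over M! is a single term of the exponential series at M.\<close>

lemma power_self_le_exp_fact: "real M ^ M \<le> exp (real M) * fact M"
proof -
  have "(\<Sum>n\<in>{M}. real M ^ n /\<^sub>R fact n) \<le> (\<Sum>n. real M ^ n /\<^sub>R fact n)"
    using exp_converges[of "real M"] by (intro sum_le_suminf) (auto simp: sums_iff)
  also have "\<dots> = exp (real M)" using exp_converges[of "real M"] by (simp add: sums_iff)
  finally show ?thesis by (simp add: field_simps)
qed

text \<open>The nodes have spacing \<rho> / (2 M) and |1 - t_i| \<le> 1, so a weight is at most (2 M
  / \<rho>)^M / (j! (M - j)!). The binomial coefficients sum to 2^M, and M^M / M! \<le> e^M. What
  matters later is only that the growth is exponential in M.\<close>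

lemma sum_abs_lagrange_weight_le:
  assumes \<rho>: "0 < \<rho>" "\<rho> \<le> 1" and M: "1 \<le> M"
  shows "(\<Sum>j\<le>M. \<bar>lagrange_weight (unif_node \<rho> M) M j\<bar>) \<le> (4 * exp 1 / \<rho>) ^ M"
proof -
  have "\<bar>lagrange_weight (unif_node \<rho> M) M j\<bar> \<le> (2 * real M / \<rho>) ^ M * (real (M choose j) / fact M)"
    if j: "j \<le> M" for j
  proof -
    have "\<bar>lagrange_weight (unif_node \<rho> M) M j\<bar> \<le> (\<Prod>i\<in>{..M} - {j}. (2 * real M / \<rho>) / \<bar>real j - real i\<bar>)"
      unfolding lagrange_weight_def abs_prod
    proof (intro prod_mono conjI)
      fix i assume i: "i \<in> {..M} - {j}"
      have 1: "\<bar>1 - unif_node \<rho> M i\<bar> \<le> 1" using unif_node_bounds[OF \<rho>(1) M, of i] \<rho> i by auto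
      have "unif_node \<rho> M j - unif_node \<rho> M i = \<rho> / (2 * real M) * (real j - real i)"
        by (simp add: unif_node_def algebra_simps diff_divide_distrib)
      then have 2: "\<bar>unif_node \<rho> M j - unif_node \<rho> M i\<bar> = \<rho> / (2 * real M) * \<bar>real j - real i\<bar>"
        using \<rho> by (simp add: abs_mult)
      have "0 < \<rho> / (2 * real M) * \<bar>real j - real i\<bar>" using \<rho> M i by auto
      then have "\<bar>1 - unif_node \<rho> M i\<bar> / (\<rho> / (2 * real M) * \<bar>real j - real i\<bar>) \<le> 1 / (\<rho> / (2 * real M) * \<bar>real j - real i\<bar>)"
        by (intro divide_right_mono 1) auto
      also have "\<dots> = (2 * real M / \<rho>) / \<bar>real j - real i\<bar>" using \<rho> M by (simp add: field_simps)
      finally show "\<bar>(1 - unif_node \<rho> M i) / (unif_node \<rho> M j - unif_node \<rho> M i)\<bar> \<le> (2 * real M / \<rho>) / \<bar>real j - real i\<bar>"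
        unfolding abs_divide 2 .
    qed simp
    also have "\<dots> = (2 * real M / \<rho>) ^ M / (\<Prod>i\<in>{..M} - {j}. \<bar>real j - real i\<bar>)"
      unfolding prod_dividef using j by (simp add: power_divide power_mult_distrib)
    also have "\<dots> = (2 * real M / \<rho>) ^ M * (real (M choose j) / fact M)"
      unfolding prod_abs_diff_fact[OF j] by (simp add: binomial_fact[OF j])
    finally show ?thesis .
  qed
  then have "(\<Sum>j\<le>M. \<bar>lagrange_weight (unif_node \<rho> M) M j\<bar>) \<le> (\<Sum>j\<le>M. (2 * real M / \<rho>) ^ M * (real (M choose j) / fact M))"
    by (intro sum_mono) auto
  also have "\<dots> = (2 * real M / \<rho>) ^ M * (real (\<Sum>j\<le>M. M choose j) / fact M)"
    by (simp add: sum_distrib_left sum_divide_distrib)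
  also have "\<dots> = (4 / \<rho>) ^ M * (real M ^ M / fact M)"
  proof -
    have "(4 :: real) ^ M = 2 ^ M * 2 ^ M" by (simp flip: power_mult_distrib)
    then show ?thesis unfolding choose_row_sum by (simp add: power_mult_distrib power_divide)
  qed
  also have "\<dots> \<le> (4 / \<rho>) ^ M * exp (real M)"
    using \<rho> power_self_le_exp_fact[of M] by (intro mult_left_mono) (auto simp: field_simps)
  also have "\<dots> = (4 * exp 1 / \<rho>) ^ M"
    using exp_of_nat_mult[of M "1::real"] by (simp add: power_mult_distrib power_divide)
  finally show ?thesis .
qed

lemma abs_sums_le:
  fixes f g :: "nat \<Rightarrow> real"
  assumes "f sums s" "g sums u" "\<And>n. norm (f n) \<le> g n"
  shows "\<bar>s\<bar> \<le> u"
  using norm_suminf_le[of f g, OF assms(3) sums_summable[OF assms(2)]] sums_unique[OF assms(1)] sums_unique[OF assms(2)] by simp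

text \<open>Expand exp (b z - a z^2 / 2) in powers of z. The extrapolation error of z^m vanishes for
  m \<le> M and is at most \<open>1 + (\<Sum>j\<le>M. \<bar>w j\<bar>)\<close> for m > M, where an
  extra factor R^(m - M) \<ge> 1 may be inserted. Summing up leaves R^(-M) times the series with
  absolute values, evaluated at R.\<close>

lemma exp_quadratic_interpolation:
  fixes w t :: "nat \<Rightarrow> real"
  assumes t: "\<And>j. j \<le> M \<Longrightarrow> 0 \<le> t j \<and> t j \<le> 1"
    and exact: "\<And>m. m \<le> M \<Longrightarrow> (\<Sum>j\<le>M. w j * t j ^ m) = 1"
    and R: "R \<ge> 1" and a: "a \<ge> 0"
  shows "\<bar>exp (b - a / 2) - (\<Sum>j\<le>M. w j * exp (b * t j - a / 2 * (t j)\<^sup>2))\<bar>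
    \<le> (1 + (\<Sum>j\<le>M. \<bar>w j\<bar>)) / R ^ M * exp (\<bar>b\<bar> * R + a / 2 * R\<^sup>2)"
proof -
  define \<Lambda> where "\<Lambda> = 1 + (\<Sum>j\<le>M. \<bar>w j\<bar>)"
  have \<Lambda>: "\<Lambda> \<ge> 0" unfolding \<Lambda>_def by (intro add_nonneg_nonneg sum_nonneg) auto
  have mom: "\<bar>1 - (\<Sum>j\<le>M. w j * t j ^ m)\<bar> \<le> \<Lambda> / R ^ M * R ^ m" for m
  proof (cases "m \<le> M")
    case True
    then show ?thesis using exact \<Lambda> R by simp
  next
    case False
    have "\<bar>1 - (\<Sum>j\<le>M. w j * t j ^ m)\<bar> \<le> 1 + \<bar>\<Sum>j\<le>M. w j * t j ^ m\<bar>" by linarith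
    also have "\<bar>\<Sum>j\<le>M. w j * t j ^ m\<bar> \<le> (\<Sum>j\<le>M. \<bar>w j\<bar>)"
    proof (rule order_trans[OF sum_abs], rule sum_mono)
      fix j assume "j \<in> {..M}"
      then have "\<bar>t j ^ m\<bar> \<le> 1" using t by (simp add: power_abs power_le_one)
      then show "\<bar>w j * t j ^ m\<bar> \<le> \<bar>w j\<bar>" unfolding abs_mult by (rule mult_left_le) simp
    qed
    finally have "\<bar>1 - (\<Sum>j\<le>M. w j * t j ^ m)\<bar> \<le> \<Lambda> * 1" by (simp add: \<Lambda>_def)
    also have "\<dots> \<le> \<Lambda> * (R ^ m / R ^ M)"
      using False R \<Lambda> by (intro mult_left_mono) (auto intro!: power_increasing simp: le_divide_eq)
    finally show ?thesis by simp
  qed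
  \<comment> \<open>E q is the extrapolation error of z^(2q) exp (b z). The series in b is summed
    here, the series in a afterwards.\<close>
  define E where "E q = exp b - (\<Sum>j\<le>M. w j * t j ^ (2 * q) * exp (b * t j))" for q
  have E: "\<bar>E q\<bar> \<le> \<Lambda> / R ^ M * R ^ (2 * q) * exp (\<bar>b\<bar> * R)" for q
  proof -
    have s: "(\<lambda>p. b ^ p /\<^sub>R fact p - (\<Sum>j\<le>M. w j * t j ^ (2 * q) * ((b * t j) ^ p /\<^sub>R fact p))) sums E q"
      unfolding E_def by (intro sums_diff sums_sum sums_mult exp_converges)
    have s2: "(\<lambda>p. \<Lambda> / R ^ M * R ^ (2 * q) * ((\<bar>b\<bar> * R) ^ p /\<^sub>R fact p)) sums (\<Lambda> / R ^ M * R ^ (2 * q) * exp (\<bar>b\<bar> * R))"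
      by (intro sums_mult exp_converges)
    have le: "norm (b ^ p /\<^sub>R fact p - (\<Sum>j\<le>M. w j * t j ^ (2 * q) * ((b * t j) ^ p /\<^sub>R fact p)))
        \<le> \<Lambda> / R ^ M * R ^ (2 * q) * ((\<bar>b\<bar> * R) ^ p /\<^sub>R fact p)" for p
    proof -
      have "b ^ p /\<^sub>R fact p - (\<Sum>j\<le>M. w j * t j ^ (2 * q) * ((b * t j) ^ p /\<^sub>R fact p))
          = (b ^ p / fact p) * (1 - (\<Sum>j\<le>M. w j * t j ^ (2 * q + p)))"
        by (simp add: right_diff_distrib sum_distrib_left power_mult_distrib power_add field_simps)
      then have "norm (b ^ p /\<^sub>R fact p - (\<Sum>j\<le>M. w j * t j ^ (2 * q) * ((b * t j) ^ p /\<^sub>R fact p)))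
          = \<bar>b\<bar> ^ p / fact p * \<bar>1 - (\<Sum>j\<le>M. w j * t j ^ (2 * q + p))\<bar>"
        by (simp add: abs_mult power_abs)
      also have "\<dots> \<le> \<bar>b\<bar> ^ p / fact p * (\<Lambda> / R ^ M * R ^ (2 * q + p))"
        by (intro mult_left_mono mom) auto
      finally show ?thesis by (simp add: power_mult_distrib power_add field_simps)
    qed
    show ?thesis by (rule abs_sums_le[OF s s2 le])
  qed
  let ?c = "\<lambda>q. (- (a / 2)) ^ q /\<^sub>R fact q"
  have "(\<lambda>q. ?c q * E q) sums (exp (- (a / 2)) * exp b - (\<Sum>j\<le>M. w j * exp (b * t j) * exp (- (a / 2) * (t j)\<^sup>2)))"
  proof -
    have "(\<lambda>q. ?c q * exp b - (\<Sum>j\<le>M. w j * exp (b * t j) * ((- (a / 2) * (t j)\<^sup>2) ^ q /\<^sub>R fact q)))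
      sums (exp (- (a / 2)) * exp b - (\<Sum>j\<le>M. w j * exp (b * t j) * exp (- (a / 2) * (t j)\<^sup>2)))"
      by (intro sums_diff sums_sum sums_mult sums_mult2 exp_converges)
    moreover have "?c q * exp b - (\<Sum>j\<le>M. w j * exp (b * t j) * ((- (a / 2) * (t j)\<^sup>2) ^ q /\<^sub>R fact q)) = ?c q * E q" for q
    proof -
      have "w j * exp (b * t j) * ((- (a / 2) * (t j)\<^sup>2) ^ q /\<^sub>R fact q) = ?c q * (w j * t j ^ (2 * q) * exp (b * t j))" for j
        by (simp only: power_mult_distrib power_mult) (simp add: field_simps)
      then show ?thesis by (simp only: E_def right_diff_distrib sum_distrib_left)
    qed
    ultimately show ?thesis by (simp only:)
  qed
  moreover have "exp (- (a / 2)) * exp b - (\<Sum>j\<le>M. w j * exp (b * t j) * exp (- (a / 2) * (t j)\<^sup>2))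
      = exp (b - a / 2) - (\<Sum>j\<le>M. w j * exp (b * t j - a / 2 * (t j)\<^sup>2))"
    by (simp add: exp_add[symmetric] mult.assoc)
  ultimately have s: "(\<lambda>q. ?c q * E q) sums (exp (b - a / 2) - (\<Sum>j\<le>M. w j * exp (b * t j - a / 2 * (t j)\<^sup>2)))"
    by (simp only:)
  have s2: "(\<lambda>q. \<Lambda> / R ^ M * exp (\<bar>b\<bar> * R) * ((a / 2 * R\<^sup>2) ^ q /\<^sub>R fact q)) sums (\<Lambda> / R ^ M * exp (\<bar>b\<bar> * R) * exp (a / 2 * R\<^sup>2))"
    by (intro sums_mult exp_converges)
  have le: "norm (?c q * E q) \<le> \<Lambda> / R ^ M * exp (\<bar>b\<bar> * R) * ((a / 2 * R\<^sup>2) ^ q /\<^sub>R fact q)" for q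
  proof -
    have "norm (?c q * E q) = (a / 2) ^ q / fact q * \<bar>E q\<bar>"
      using a by (simp add: abs_mult power_abs field_simps)
    also have "\<dots> \<le> (a / 2) ^ q / fact q * (\<Lambda> / R ^ M * R ^ (2 * q) * exp (\<bar>b\<bar> * R))"
      using a by (intro mult_left_mono E) auto
    also have "\<dots> = \<Lambda> / R ^ M * exp (\<bar>b\<bar> * R) * ((a / 2 * R\<^sup>2) ^ q /\<^sub>R fact q)"
      by (simp only: power_mult_distrib power_mult) (simp add: field_simps)
    finally show ?thesis .
  qed
  show ?thesis using abs_sums_le[OF s s2 le] by (simp add: \<Lambda>_def exp_add mult.assoc)
qed

text \<open>Along the line z -> x - z v a Gaussian is the exponential of a quadratic polynomial, so
  the preceding estimate applies. The mixed term is split so that it uses up half of the decay in x: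
  the remaining factor exp (- q / 4) keeps the error integrable in x, and the powers of v collect to
  3/2 R^2 a.\<close>

lemma gauss_interpolation:
  fixes w t :: "nat \<Rightarrow> real" and A :: "real^'n^'n"
  assumes A: "pos_def A"
    and t: "\<And>j. j \<le> M \<Longrightarrow> 0 \<le> t j \<and> t j \<le> 1"
    and exact: "\<And>m. m \<le> M \<Longrightarrow> (\<Sum>j\<le>M. w j * t j ^ m) = 1"
    and R: "R \<ge> 1"
  shows "\<bar>(\<Sum>j\<le>M. w j * gauss A (x - t j *\<^sub>R v)) - gauss A (x - v)\<bar>
    \<le> (1 + (\<Sum>j\<le>M. \<bar>w j\<bar>)) / R ^ M * exp (3 / 2 * R\<^sup>2 * gauss_form A v)
       * (gauss_const A * exp (- (1/4) * gauss_form A x))"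
proof -
  define a where "a = gauss_form A v"
  define b where "b = (matrix_inv A *v x) \<bullet> v"
  define q where "q = gauss_form A x"
  have sA: "transpose (matrix_inv A) = matrix_inv A" using pos_def_inverse[OF A] by (simp add: pos_def_def)
  have vx: "(matrix_inv A *v v) \<bullet> x = b"
    using inner_matrix_vector[of "matrix_inv A" v x] by (simp add: sA b_def inner_commute)
  have form: "gauss_form A (s *\<^sub>R x - z *\<^sub>R v) = s\<^sup>2 * q - 2 * s * z * b + z\<^sup>2 * a" for s z
    unfolding gauss_form_def matrix_vector_mult_diff_distrib matrix_vector_mult_scaleR
    by (simp add: inner_diff_left inner_diff_right vx a_def q_def gauss_form_def power2_eq_square algebra_simps)
      (simp add: b_def)
  have form1: "gauss_form A (x - z *\<^sub>R v) = q - 2 * z * b + z\<^sup>2 * a" for z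
    using form[of 1 z] by simp
  have a0: "a \<ge> 0" unfolding a_def by (rule gauss_form_nonneg[OF A])
  \<comment> \<open>Nonnegativity of the form at x / 2 - R v and x / 2 + R v.\<close>
  have bR: "\<bar>b\<bar> * R \<le> q / 4 + R\<^sup>2 * a"
    using gauss_form_nonneg[OF A, of "(1/2) *\<^sub>R x - R *\<^sub>R v"] gauss_form_nonneg[OF A, of "(1/2) *\<^sub>R x - (-R) *\<^sub>R v"]
    unfolding form by (simp add: abs_if power2_eq_square algebra_simps)
  have g: "gauss A (x - z *\<^sub>R v) = gauss_const A * exp (- q / 2) * exp (b * z - a / 2 * z\<^sup>2)" for z
    unfolding gauss_def form1 by (simp add: exp_add[symmetric] algebra_simps)
  have "(\<Sum>j\<le>M. w j * gauss A (x - t j *\<^sub>R v)) - gauss A (x - v)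
      = - (gauss_const A * exp (- q / 2) * (exp (b - a / 2) - (\<Sum>j\<le>M. w j * exp (b * t j - a / 2 * (t j)\<^sup>2))))"
    using g[of 1] by (simp add: g right_diff_distrib sum_distrib_left mult.left_commute mult.assoc)
  then have "\<bar>(\<Sum>j\<le>M. w j * gauss A (x - t j *\<^sub>R v)) - gauss A (x - v)\<bar>
      = gauss_const A * exp (- q / 2) * \<bar>exp (b - a / 2) - (\<Sum>j\<le>M. w j * exp (b * t j - a / 2 * (t j)\<^sup>2))\<bar>"
    using gauss_const_pos[OF A] by (simp add: abs_mult)
  also have "\<dots> \<le> gauss_const A * exp (- q / 2) * ((1 + (\<Sum>j\<le>M. \<bar>w j\<bar>)) / R ^ M * exp (\<bar>b\<bar> * R + a / 2 * R\<^sup>2))"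
    using gauss_const_pos[OF A] by (intro mult_left_mono exp_quadratic_interpolation t exact R a0) auto
  also have "\<dots> \<le> gauss_const A * exp (- q / 2) * ((1 + (\<Sum>j\<le>M. \<bar>w j\<bar>)) / R ^ M * exp ((q / 4 + R\<^sup>2 * a) + a / 2 * R\<^sup>2))"
  proof -
    have "0 \<le> (1 + (\<Sum>j\<le>M. \<bar>w j\<bar>)) / R ^ M"
      using R by (intro divide_nonneg_nonneg add_nonneg_nonneg sum_nonneg) auto
    moreover have "\<bar>b\<bar> * R + a / 2 * R\<^sup>2 \<le> (q / 4 + R\<^sup>2 * a) + a / 2 * R\<^sup>2" using bR by linarith
    ultimately show ?thesis
      using gauss_const_pos[OF A] by (intro mult_left_mono iffD2[OF exp_le_cancel_iff]) (auto simp: less_imp_le)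
  qed
  also have "\<dots> = (1 + (\<Sum>j\<le>M. \<bar>w j\<bar>)) / R ^ M * (gauss_const A * (exp (- q / 2) * exp ((q / 4 + R\<^sup>2 * a) + a / 2 * R\<^sup>2)))"
    by (simp only: mult_ac)
  also have "exp (- q / 2) * exp ((q / 4 + R\<^sup>2 * a) + a / 2 * R\<^sup>2) = exp (3 / 2 * R\<^sup>2 * a) * exp (- (1/4) * q)"
    by (simp add: exp_add[symmetric] algebra_simps)
  finally show ?thesis unfolding a_def q_def by (simp only: mult_ac)
qed

lemma gauss_form_le:
  fixes A :: "real^'n^'n"
  assumes A: "pos_def A" and l: "l > 0" "\<And>x. l * (x \<bullet> x) \<le> (A *v x) \<bullet> x"
  shows "gauss_form A v \<le> (norm v)\<^sup>2 / l"
proof -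
  define w where "w = matrix_inv A *v v"
  have v: "A *v w = v" by (simp add: w_def matrix_vector_mul_assoc matrix_inv_right[OF pos_def_invertible[OF A]])
  have "l * (norm w)\<^sup>2 \<le> v \<bullet> w" using l(2)[of w] by (simp add: v power2_norm_eq_inner)
  also have "\<dots> \<le> norm v * norm w" by (rule norm_cauchy_schwarz)
  finally have "l * norm w \<le> norm v" by (cases "norm w = 0") (auto simp: power2_eq_square)
  then have nw: "norm w \<le> norm v / l" using l(1) by (simp add: field_simps)
  have "gauss_form A v = w \<bullet> v" by (simp add: gauss_form_def w_def)
  also have "\<dots> \<le> norm w * norm v" by (rule norm_cauchy_schwarz)
  also have "\<dots> \<le> norm v / l * norm v" using nw by (intro mult_right_mono) auto
  finally show ?thesis by (simp add: power2_eq_square)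
qed

section \<open>Cells contracted into the control set\<close>

text \<open>Every preimage is a countable union of level sets of c. As F is arbitrary, this covers
  the centres of the balls, which are picked by choice, one for each cell.\<close>

lemma measurable_countable_range:
  fixes c :: "'a \<Rightarrow> 'b::t1_space" and F :: "'b \<Rightarrow> 'c::topological_space"
  assumes c: "c \<in> borel_measurable M" and cnt: "countable (range c)"
  shows "(\<lambda>x. F (c x)) \<in> borel_measurable M"
proof (rule measurableI)
  fix S :: "'c set" assume "S \<in> sets borel"
  have "(\<lambda>x. F (c x)) -` S \<inter> space M = (\<Union>k\<in>{k \<in> range c. F k \<in> S}. c -` {k} \<inter> space M)" by auto
  also have "\<dots> \<in> sets M"
    using cnt by (intro sets.countable_UN'' measurable_sets[OF c]) (auto intro: countable_subset)
  finally show "(\<lambda>x. F (c x)) -` S \<inter> space M \<in> sets M" .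
qed auto

text \<open>
  The cells are half-open cubes, large enough for each of them to contain one of the balls
  \<open>B(y', r)\<close> in \<open>\<omega>\<close>. The maps \<open>x \<mapsto> y x + t (x - y x)\<close> with small \<open>t\<close> contract each cell into its ball,
  hence are injective. Here \<open>c x\<close> labels the cell of \<open>x\<close>.
\<close>

lemma cells_exist:
  fixes \<omega> :: "(real^'n) set"
  assumes "0 < \<delta>" "0 < r"
    and dense: "\<forall>y. \<exists>y'\<in>\<omega>. ball y' r \<subseteq> \<omega> \<and> norm (y - y') < \<delta>"
  obtains c y :: "real^'n \<Rightarrow> real^'n" and D \<rho> :: real where
    "0 < D" "0 < \<rho>" "\<rho> \<le> 1"
    "c \<in> borel_measurable borel" "y \<in> borel_measurable borel" "countable (range c)"
    "\<And>x x'. c x = c x' \<Longrightarrow> y x = y x'"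
    "\<And>x. norm (x - y x) \<le> D"
    "\<And>x t. 0 < t \<Longrightarrow> t \<le> \<rho> \<Longrightarrow> c (y x + t *\<^sub>R (x - y x)) = c x"
    "\<And>x t. 0 < t \<Longrightarrow> t \<le> \<rho> \<Longrightarrow> y x + t *\<^sub>R (x - y x) \<in> \<omega>"
proof -
  \<comment> \<open>Half the side is \<delta> + r, so a ball of radius r whose centre is within
    \<delta> of the centre of a cube stays inside that cube.\<close>
  define L where "L = 2 * (\<delta> + r)"
  have L: "L > 0" using assms by (simp add: L_def)
  define c :: "real^'n \<Rightarrow> real^'n" where "c x = (\<chi> i. of_int \<lfloor>x $ i / L\<rfloor>)" for x
  define z :: "real^'n \<Rightarrow> real^'n" where "z k = (\<chi> i. L * k $ i + L / 2)" for k
  obtain Y where Y: "\<And>x. Y x \<in> \<omega>" "\<And>x. ball (Y x) r \<subseteq> \<omega>" "\<And>x. norm (x - Y x) < \<delta>"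
    using dense by metis
  define y where "y x = Y (z (c x))" for x
  have cm: "c \<in> borel_measurable borel"
  proof (subst borel_measurable_euclidean_space, rule ballI)
    fix b :: "real^'n" assume "b \<in> Basis"
    then obtain i where b: "b = axis i 1" by (auto simp: Basis_vec_def)
    have "(\<lambda>x :: real^'n. x $ i) \<in> borel_measurable borel"
      by (intro borel_measurable_continuous_onI continuous_intros)
    then show "(\<lambda>x. c x \<bullet> b) \<in> borel_measurable borel"
      by (simp add: b inner_axis c_def)
  qed
  have cnt: "countable (range c)"
  proof -
    have "range c \<subseteq> range (\<lambda>k :: 'n \<Rightarrow> int. \<chi> i. of_int (k i))" by (auto simp: c_def)
    moreover have "countable (range (\<lambda>k :: 'n \<Rightarrow> int. \<chi> i. real_of_int (k i)))"
      by (intro countable_image) (rule countableI_type)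
    ultimately show ?thesis by (rule countable_subset)
  qed
  have ym: "y \<in> borel_measurable borel"
    unfolding y_def by (rule measurable_countable_range[OF cm cnt])
  \<comment> \<open>Half a side for each of the n coordinates bounds the distance to the centre of
    the cube, and \<delta> that from there to the centre of the ball.\<close>
  define D where "D = real CARD('n) * (L / 2) + \<delta>"
  have D: "D > 0" using L assms by (auto simp: D_def intro: add_nonneg_pos)
  have comp: "\<bar>x $ i - z (c x) $ i\<bar> \<le> L / 2" for x i
  proof -
    have "L * of_int \<lfloor>x $ i / L\<rfloor> \<le> L * (x $ i / L)" "L * (x $ i / L) \<le> L * (of_int \<lfloor>x $ i / L\<rfloor> + 1)"
      using L by (intro mult_left_mono; linarith)+
    moreover have "L * (x $ i / L) = x $ i" using L by simp
    ultimately have "L * of_int \<lfloor>x $ i / L\<rfloor> \<le> x $ i" "x $ i \<le> L * of_int \<lfloor>x $ i / L\<rfloor> + L"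
      by (simp_all add: distrib_left)
    moreover have "z (c x) $ i = L * of_int \<lfloor>x $ i / L\<rfloor> + L / 2" by (simp add: z_def c_def)
    ultimately show ?thesis unfolding abs_le_iff by linarith
  qed
  have nD: "norm (x - y x) \<le> D" for x
  proof -
    have "norm (x - z (c x)) \<le> (\<Sum>i\<in>UNIV. \<bar>(x - z (c x)) $ i\<bar>)" by (rule norm_le_l1_cart)
    also have "\<dots> \<le> (\<Sum>i\<in>(UNIV :: 'n set). L / 2)" using comp by (intro sum_mono) simp
    finally have "norm (x - z (c x)) \<le> real CARD('n) * (L / 2)" by simp
    moreover have "norm (z (c x) - y x) < \<delta>" unfolding y_def by (rule Y)
    ultimately show ?thesis
      using norm_triangle_ineq[of "x - z (c x)" "z (c x) - y x"] by (simp add: D_def)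
  qed
  have cell: "c p = c x" if "norm (p - y x) < r" for p x
  proof -
    have "norm (p - z (c x)) < L / 2"
      using that Y(3)[of "z (c x)"] norm_triangle_ineq[of "p - y x" "y x - z (c x)"]
      by (simp add: L_def y_def norm_minus_commute)
    then have n: "\<bar>p $ i - z (c x) $ i\<bar> < L / 2" for i
      using component_le_norm_cart[of "p - z (c x)" i] by simp
    have "\<lfloor>p $ i / L\<rfloor> = \<lfloor>x $ i / L\<rfloor>" for i
    proof (rule floor_unique)
      have zi: "z (c x) $ i = L * of_int \<lfloor>x $ i / L\<rfloor> + L / 2" by (simp add: z_def c_def)
      have "L * of_int \<lfloor>x $ i / L\<rfloor> \<le> p $ i" "p $ i < L * of_int \<lfloor>x $ i / L\<rfloor> + L"
        using n[of i] unfolding zi abs_less_iff by linarith+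
      then show "of_int \<lfloor>x $ i / L\<rfloor> \<le> p $ i / L" "p $ i / L < of_int \<lfloor>x $ i / L\<rfloor> + 1"
        using L by (auto simp: field_simps)
    qed
    then show ?thesis by (simp add: c_def)
  qed
  \<comment> \<open>A contraction by t \<le> \<rho> moves x to within \<rho> D = r / 2 of the centre
    of the ball.\<close>
  define \<rho> where "\<rho> = r / (2 * D)"
  have rD: "r \<le> D"
  proof -
    have "1 * (L / 2) \<le> real CARD('n) * (L / 2)" using L by (intro mult_right_mono) auto
    then show ?thesis using assms by (simp add: D_def L_def)
  qed
  have small: "norm (y x + t *\<^sub>R (x - y x) - y x) < r" if "0 < t" "t \<le> \<rho>" for x t
  proof -
    have "norm (y x + t *\<^sub>R (x - y x) - y x) = t * norm (x - y x)" using that by simp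
    also have "\<dots> \<le> \<rho> * D" using that nD D by (intro mult_mono) auto
    also have "\<dots> < r" using D assms by (simp add: \<rho>_def)
    finally show ?thesis .
  qed
  show ?thesis
  proof (rule that[of D \<rho> c y])
    show "0 < D" "0 < \<rho>" "\<rho> \<le> 1" using D assms rD by (auto simp: \<rho>_def divide_le_eq)
    show "y x = y x'" if "c x = c x'" for x x' using that by (simp add: y_def)
    show "c (y x + t *\<^sub>R (x - y x)) = c x" if "0 < t" "t \<le> \<rho>" for x t
      by (rule cell[OF small[OF that]])
    show "y x + t *\<^sub>R (x - y x) \<in> \<omega>" if "0 < t" "t \<le> \<rho>" for x t
    proof -
      have "y x + t *\<^sub>R (x - y x) \<in> ball (y x) r"
        using small[OF that, of x] by (simp add: dist_norm norm_minus_commute)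
      then show ?thesis using Y(2) unfolding y_def by blast
    qed
  qed (fact cm ym cnt nD)+
qed

lemma emeasure_lborel_affine_vimage:
  fixes b :: "'a::euclidean_space"
  assumes t: "t > 0" and A: "A \<in> sets borel"
  shows "ennreal (t ^ DIM('a)) * emeasure lborel {x. b + t *\<^sub>R x \<in> A} = emeasure lborel A"
proof -
  have "emeasure lborel A = emeasure (density (distr lborel borel (\<lambda>x. b + t *\<^sub>R x)) (\<lambda>_. ennreal (\<bar>t\<bar> ^ DIM('a)))) A"
    using lborel_affine[of t b] t by simp
  also have "\<dots> = ennreal (t ^ DIM('a)) * emeasure lborel {x. b + t *\<^sub>R x \<in> A}"
    using t A by (subst emeasure_density_const) (auto simp: emeasure_distr vimage_def)
  finally show ?thesis ..
qed

context
  fixes c y :: "real^'n \<Rightarrow> real^'n" and t :: real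
  assumes c[measurable]: "c \<in> borel_measurable borel" and y[measurable]: "y \<in> borel_measurable borel"
    and cnt: "countable (range c)"
    and yc: "\<And>x x'. c x = c x' \<Longrightarrow> y x = y x'"
    and t: "t > 0" and inv: "\<And>x. c (y x + t *\<^sub>R (x - y x)) = c x"
begin

text \<open>On each cell the map is affine with ratio t, which gives the Jacobian; it maps the cell
  into itself, so images of different cells do not overlap. A point belongs to the image exactly
  when its expansion by 1 / t does not leave its cell, which is the set in the indicator. The
  contributions are summed over the countably many cells.\<close>

lemma distr_cell_contraction:
  "distr lborel borel (\<lambda>x. y x + t *\<^sub>R (x - y x)) =
   density lborel (\<lambda>x. ennreal ((1 / t) ^ CARD('n)) * indicator {x. c (y x + (1 / t) *\<^sub>R (x - y x)) = c x} x)"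
  (is "_ = density lborel (\<lambda>x. _ * indicator ?D x)")
proof (rule measure_eqI)
  fix A assume "A \<in> sets (distr lborel borel (\<lambda>x. y x + t *\<^sub>R (x - y x)))"
  then have [measurable]: "A \<in> sets borel" by simp
  have D[measurable]: "?D \<in> sets borel" by measurable
  let ?C = "\<lambda>k. {x. c x = k}"
  have C[measurable]: "?C k \<in> sets borel" for k by measurable
  let ?P = "{x. y x + t *\<^sub>R (x - y x) \<in> A}"
  have [measurable]: "?P \<in> sets borel" by measurable
  have part: "emeasure lborel S = (\<integral>\<^sup>+k. emeasure lborel (S \<inter> ?C k) \<partial>count_space (range c))"
    if [measurable]: "S \<in> sets borel" for S
  proof -
    have "S = (\<Union>k\<in>range c. S \<inter> ?C k)" by auto
    then have "emeasure lborel S = emeasure lborel (\<Union>k\<in>range c. S \<inter> ?C k)" by simp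
    also have "\<dots> = (\<integral>\<^sup>+k. emeasure lborel (S \<inter> ?C k) \<partial>count_space (range c))"
      by (rule emeasure_UN_countable) (auto simp: cnt disjoint_family_on_def)
    finally show ?thesis .
  qed
  have cell: "ennreal (t ^ CARD('n)) * emeasure lborel (?P \<inter> ?C k) = emeasure lborel (A \<inter> ?D \<inter> ?C k)"
    if "k \<in> range c" for k
  proof -
    obtain x0 where k: "k = c x0" using \<open>k \<in> range c\<close> by blast
    define b where "b = y x0 - t *\<^sub>R y x0"
    have yk: "y x = y x0" if "c x = k" for x using yc[of x x0] that k by simp
    have bt: "b + t *\<^sub>R x = y x0 + t *\<^sub>R (x - y x0)" for x by (simp add: b_def algebra_simps)
    have "?P \<inter> ?C k = {x. b + t *\<^sub>R x \<in> A \<inter> ?D \<inter> ?C k}"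
    proof (intro equalityI subsetI)
      fix x assume x: "x \<in> ?P \<inter> ?C k"
      then have e: "b + t *\<^sub>R x = y x + t *\<^sub>R (x - y x)" using yk[of x] by (simp add: bt)
      have ck: "c (b + t *\<^sub>R x) = k" using inv[of x] x by (simp add: e)
      have "y (b + t *\<^sub>R x) + (1 / t) *\<^sub>R (b + t *\<^sub>R x - y (b + t *\<^sub>R x)) = x"
        unfolding yk[OF ck] unfolding bt using t by simp
      then show "x \<in> {x. b + t *\<^sub>R x \<in> A \<inter> ?D \<inter> ?C k}" using x ck e by auto
    next
      fix x assume "x \<in> {x. b + t *\<^sub>R x \<in> A \<inter> ?D \<inter> ?C k}"
      then have xA: "b + t *\<^sub>R x \<in> A" and xD: "b + t *\<^sub>R x \<in> ?D" and ck: "c (b + t *\<^sub>R x) = k" by auto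
      have "y (b + t *\<^sub>R x) + (1 / t) *\<^sub>R (b + t *\<^sub>R x - y (b + t *\<^sub>R x)) = x"
        unfolding yk[OF ck] unfolding bt using t by simp
      then have cx: "c x = k" using xD ck by auto
      then show "x \<in> ?P \<inter> ?C k" using xA yk[OF cx] by (simp add: bt)
    qed
    then show ?thesis
      using emeasure_lborel_affine_vimage[OF t, of "A \<inter> ?D \<inter> ?C k" b] by simp
  qed
  have tt: "ennreal ((1 / t) ^ CARD('n)) * ennreal (t ^ CARD('n)) = 1"
    using t by (simp add: ennreal_mult[symmetric] power_mult_distrib[symmetric])
  have P: "ennreal (t ^ CARD('n)) * emeasure lborel ?P = emeasure lborel (A \<inter> ?D)"
    unfolding part[OF \<open>?P \<in> sets borel\<close>]
    by (subst part, measurable, subst nn_integral_cmult[symmetric]) (auto intro!: nn_integral_cong simp: cell)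
  have "emeasure (distr lborel borel (\<lambda>x. y x + t *\<^sub>R (x - y x))) A = emeasure lborel ?P"
    by (subst emeasure_distr) (auto simp: vimage_def)
  also have "\<dots> = ennreal ((1 / t) ^ CARD('n)) * (ennreal (t ^ CARD('n)) * emeasure lborel ?P)"
    by (simp only: mult.assoc[symmetric] tt mult_1)
  also have "\<dots> = ennreal ((1 / t) ^ CARD('n)) * emeasure lborel (A \<inter> ?D)" unfolding P ..
  also have "\<dots> = emeasure (density lborel (\<lambda>x. ennreal ((1 / t) ^ CARD('n)) * indicator ?D x)) A"
    by (subst emeasure_density)
      (auto simp: mult.assoc nn_integral_cmult indicator_inter_arith[symmetric] Int_commute)
  finally show "emeasure (distr lborel borel (\<lambda>x. y x + t *\<^sub>R (x - y x))) A
    = emeasure (density lborel (\<lambda>x. ennreal ((1 / t) ^ CARD('n)) * indicator ?D x)) A" .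
qed simp

end

section \<open>The transition kernel\<close>

text \<open>\<open>matrix_inv\<close> is defined by choice. Cramer's rule turns the form into a
  rational expression in the entries of A and w, from which measurability of the transition kernel
  in all variables can be read off.\<close>

lemma gauss_form_cramer:
  fixes A :: "real^'n^'n"
  assumes "pos_def A"
  shows "gauss_form A w = (\<Sum>k\<in>UNIV. det (\<chi> i j. if j = k then w $ i else A $ i $ j) / det A * w $ k)"
proof -
  have "A *v (matrix_inv A *v w) = w"
    by (simp add: matrix_vector_mul_assoc matrix_inv_right[OF pos_def_invertible[OF assms]])
  then have "matrix_inv A *v w = (\<chi> k. det (\<chi> i j. if j = k then w $ i else A $ i $ j) / det A)"
    using cramer[of A "matrix_inv A *v w" w] pos_def_det[OF assms] by simp
  then show ?thesis by (simp add: gauss_form_def inner_vec_def)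
qed

lemma borel_measurable_vec_nth [measurable (raw)]:
  fixes f :: "'a \<Rightarrow> ('b::euclidean_space)^'n"
  assumes "f \<in> borel_measurable M" shows "(\<lambda>x. f x $ i) \<in> borel_measurable M"
  using measurable_compose[OF assms borel_measurable_continuous_onI[of "\<lambda>v. v $ i"]]
  by (simp add: continuous_on_component continuous_on_id)

text \<open>The Kalman condition enters only through \<open>low\<close>, with the constants of
  \<open>kalman_lower_bound\<close>.\<close>

locale ou_kernel =
  fixes Q B :: "real^'n^'n" and T cl :: real and \<kappa> :: nat
  assumes Q: "sym_psd Q" and T: "0 < T" and cl: "0 < cl"
    and low: "\<And>t x. 0 < t \<Longrightarrow> t \<le> T \<Longrightarrow> cl * t ^ \<kappa> * (x \<bullet> x) \<le> (ou_covariance Q B t *v x) \<bullet> x"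
begin

definition C :: "real \<Rightarrow> real^'n^'n" where "C t = ou_covariance Q B t"
definition E :: "real \<Rightarrow> real^'n^'n" where "E t = mexp (t *\<^sub>R B)"

text \<open>The kernel is cut off outside \<open>(0, T]\<close> in order to be Borel measurable in all variables.\<close>

definition p :: "real \<Rightarrow> real^'n \<Rightarrow> real^'n \<Rightarrow> real" where
  "p t x y = (if 0 < t \<and> t \<le> T then gauss (C t) (E t *v x - y) else 0)"

definition W :: "real \<Rightarrow> (real^'n \<Rightarrow> complex) \<Rightarrow> real^'n \<Rightarrow> complex" where
  "W t F x = (LINT y|lborel. complex_of_real (p t x y) * F y)"

lemma pos_def_C: "0 < t \<Longrightarrow> t \<le> T \<Longrightarrow> pos_def (C t)"
proof -
  assume t: "0 < t" "t \<le> T"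
  have "0 < (C t *v x) \<bullet> x" if "x \<noteq> 0" for x
  proof -
    have "0 < cl * t ^ \<kappa> * (x \<bullet> x)" using cl t that by simp
    also have "\<dots> \<le> (C t *v x) \<bullet> x" unfolding C_def by (rule low[OF t])
    finally show ?thesis .
  qed
  then show ?thesis by (simp add: pos_def_def C_def transpose_ou_covariance[OF Q])
qed

lemma p_nonneg: "0 \<le> p t x y"
  using gauss_nonneg[OF pos_def_C, of t] by (auto simp: p_def)

lemma E_invertible: "invertible (E t)" unfolding E_def by (rule invertible_mexp)

lemma E_measurable [measurable]: "E \<in> borel_measurable borel"
  unfolding E_def by (intro borel_measurable_continuous_onI continuous_on_mexp)

lemma C_measurable [measurable]: "C \<in> borel_measurable borel"
proof -
  have c0: "continuous_on {0..} C"
    unfolding continuous_on_eq_continuous_within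
  proof
    fix x :: real assume x: "x \<in> {0..}"
    have "continuous_on {0..x + 1} C"
      unfolding C_def by (rule continuous_on_ou_covariance[OF Q])
    then have "continuous (at x within {0..x + 1}) C"
      using x by (simp add: continuous_on_eq_continuous_within)
    moreover have "at x within {0..x + 1} = at x within {0..}"
      by (rule at_within_nhd[of _ "{..<x + 1}"]) auto
    ultimately show "continuous (at x within {0..}) C" by simp
  qed
  have "continuous_on UNIV (\<lambda>t. C (max 0 t))"
    by (rule continuous_on_compose2[OF c0]) (auto intro!: continuous_intros)
  \<comment> \<open>For t < 0 the interval {0..t} is empty, and the integral has the same value 0 as
    at t = 0.\<close>
  moreover have "C (max 0 t) = C t" for t
    by (cases "t \<ge> 0") (auto simp: C_def ou_covariance_def max_def)
  ultimately show ?thesis by (simp add: borel_measurable_continuous_onI)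
qed

lemma p_measurable [measurable (raw)]:
  assumes [measurable]: "f \<in> borel_measurable M" "g \<in> borel_measurable M" "h \<in> borel_measurable M"
  shows "(\<lambda>w. p (f w) (g w) (h w)) \<in> borel_measurable M"
proof -
  define v where "v i w = (\<Sum>j\<in>UNIV. E (f w) $ i $ j * g w $ j) - h w $ i" for i w
  have [measurable]: "v i \<in> borel_measurable M" for i unfolding v_def by measurable
  define d where "d w = det (C (f w))" for w
  have [measurable]: "d \<in> borel_measurable M" unfolding d_def det_def by measurable
  define e where "e k w = det (\<chi> i j. if j = k then v i w else C (f w) $ i $ j)" for k w
  have [measurable]: "e k \<in> borel_measurable M" for k
    unfolding e_def det_def vec_lambda_beta by measurable
  have "p (f w) (g w) (h w) = (if 0 < f w \<and> f w \<le> T then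
      1 / ((2 * pi) powr (real CARD('n) / 2) * sqrt (d w)) * exp (- (1/2) * (\<Sum>k\<in>UNIV. e k w / d w * v k w)) else 0)" for w
  proof (cases "0 < f w \<and> f w \<le> T")
    case True
    have vi: "(E (f w) *v g w - h w) $ i = v i w" for i by (simp add: v_def matrix_vector_mult_def)
    have pd: "pos_def (C (f w))" using True by (intro pos_def_C) auto
    have "gauss_form (C (f w)) (E (f w) *v g w - h w) = (\<Sum>k\<in>UNIV. e k w / d w * v k w)"
      unfolding gauss_form_cramer[OF pd] vi e_def d_def ..
    then show ?thesis using True by (simp add: p_def gauss_def gauss_const_def d_def)
  qed (auto simp: p_def)
  then show ?thesis by simp
qed

lemma nn_integral_p: 
  assumes "0 < t" "t \<le> T" shows "(\<integral>\<^sup>+y. ennreal (p t x y) \<partial>lborel) = 1"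
  using assms nn_integral_lborel_reflect[of "\<lambda>y. ennreal (gauss (C t) y)" "E t *v x"]
  by (simp add: p_def nn_integral_gauss[OF pos_def_C])

lemma nn_integral_p_le: "(\<integral>\<^sup>+y. ennreal (p t x y) \<partial>lborel) \<le> 1"
proof (cases "0 < t \<and> t \<le> T")
  case True then show ?thesis by (simp add: nn_integral_p)
next
  case False then show ?thesis by (auto simp: p_def)
qed

text \<open>A bound on the inverse Jacobian of the flow, uniform on [0, T]. The preimage of the unit
  ball under E t lies in a ball of radius K', because the matrices
  \<open>mexp ((-t) *\<^sub>R B)\<close> form a compact set.\<close>

lemma nn_integral_E_le:
  obtains c where "c > 0" "\<And>t f. 0 \<le> t \<Longrightarrow> t \<le> T \<Longrightarrow> f \<in> borel_measurable borel \<Longrightarrow>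
    (\<integral>\<^sup>+x. f (E t *v x) \<partial>lborel) \<le> ennreal c * (\<integral>\<^sup>+x. f x \<partial>lborel)"
proof -
  have "compact ((\<lambda>t. mexp (t *\<^sub>R B)) ` {-T..0})"
    by (intro compact_continuous_image continuous_on_mexp) auto
  then obtain K where K: "\<And>t. t \<in> {-T..0} \<Longrightarrow> norm (mexp (t *\<^sub>R B)) \<le> K"
    using compact_imp_bounded[of "(\<lambda>t. mexp (t *\<^sub>R B)) ` {-T..0}"] unfolding bounded_iff by blast
  obtain b where b: "b > 0" "\<And>(A :: real^'n^'n) x. norm (A *v x) \<le> norm A * norm x * b"
    using bounded_bilinear.pos_bounded[OF bounded_bilinear_matrix_vector_mult] by blast
  define K' where "K' = max 1 (K * b)"
  have K': "norm x \<le> K' * norm (E t *v x)" if "0 \<le> t" "t \<le> T" for t x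
  proof -
    have "norm x = norm (mexp ((-t) *\<^sub>R B) *v (E t *v x))"
      unfolding E_def matrix_vector_mul_assoc mexp_minus by simp
    also have "\<dots> \<le> norm (mexp ((-t) *\<^sub>R B)) * norm (E t *v x) * b" by (rule b)
    also have "\<dots> \<le> K * norm (E t *v x) * b"
      using that K[of "-t"] b(1) by (intro mult_right_mono) auto
    also have "\<dots> = (K * b) * norm (E t *v x)" by simp
    also have "\<dots> \<le> K' * norm (E t *v x)" by (intro mult_right_mono) (auto simp: K'_def)
    finally show ?thesis .
  qed
  define V where "V r = emeasure lborel (ball 0 r :: (real^'n) set)" for r
  have V1: "0 < V 1" "V 1 < \<infinity>"
    using emeasure_lborel_ball_finite[of "0 :: real^'n" 1] by (auto simp: V_def emeasure_ball)
  have VK: "V K' < \<infinity>" unfolding V_def by (rule emeasure_lborel_ball_finite)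
  define c where "c = enn2real (V K') / enn2real (V 1) + 1"
  have e1: "ennreal (enn2real (V 1)) = V 1" and eK: "ennreal (enn2real (V K')) = V K'" using V1 VK by auto
  have p1: "0 < enn2real (V 1)" using V1 by (simp add: enn2real_positive_iff)
  have c: "c > 0" using p1 by (simp add: c_def add_nonneg_pos)
  have "(\<integral>\<^sup>+x. f (E t *v x) \<partial>lborel) \<le> ennreal c * (\<integral>\<^sup>+x. f x \<partial>lborel)"
    if t: "0 \<le> t" "t \<le> T" and f: "f \<in> borel_measurable borel" for t f
  proof -
    obtain d where d: "d > 0" "\<And>f :: real^'n \<Rightarrow> ennreal. f \<in> borel_measurable borel \<Longrightarrow>
      (\<integral>\<^sup>+x. f (E t *v x) \<partial>lborel) = ennreal d * (\<integral>\<^sup>+x. f x \<partial>lborel)"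
      using nn_integral_lborel_linear[OF E_invertible] by blast
    have "ennreal d * V 1 = (\<integral>\<^sup>+x. indicator (ball 0 1) (E t *v x) \<partial>lborel)"
      using d(2)[of "indicator (ball 0 1)"] by (simp add: V_def borel_measurable_indicator)
    also have "\<dots> \<le> (\<integral>\<^sup>+x. indicator (ball 0 K') x \<partial>(lborel :: (real^'n) measure))"
    proof (rule nn_integral_mono)
      fix x :: "real^'n"
      have "norm x < K'" if "norm (E t *v x) < 1"
      proof -
        have "K' * norm (E t *v x) < K' * 1" using that by (intro mult_strict_left_mono) (auto simp: K'_def)
        then show ?thesis using K'[OF t, of x] by simp
      qed
      then show "indicator (ball 0 1) (E t *v x) \<le> (indicator (ball 0 K') x :: ennreal)"
        by (auto simp: indicator_def)
    qed
    also have "\<dots> = V K'" by (simp add: V_def)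
    finally have "ennreal (d * enn2real (V 1)) \<le> ennreal (enn2real (V K'))"
      using d(1) by (simp add: ennreal_mult e1 eK less_imp_le)
    then have "d * enn2real (V 1) \<le> enn2real (V K')" by (simp add: ennreal_le_iff)
    then have "d \<le> c" using p1 by (simp add: c_def field_simps)
    then show ?thesis unfolding d(2)[OF f] by (intro mult_right_mono ennreal_leI) auto
  qed
  then show ?thesis using that c by blast
qed

text \<open>The reflection y -> \<open>E t *v x - y\<close> brings the integral to the form of
  \<open>gauss_convolution\<close>, and \<open>ou_covariance_add\<close> identifies the resulting
  covariance.\<close>

lemma chapman_kolmogorov:
  assumes "0 < t" "0 < s" "t + s \<le> T"
  shows "(\<integral>\<^sup>+y. ennreal (p t x y) * ennreal (p s y z) \<partial>lborel) = ennreal (p (t + s) x z)"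
proof -
  define a where "a = E (t + s) *v x - z"
  have Ets: "E (t + s) *v x = E s *v (E t *v x)"
    unfolding E_def matrix_vector_mul_assoc mexp_add[symmetric] by (simp add: add.commute)
  have "(\<integral>\<^sup>+y. ennreal (p t x y) * ennreal (p s y z) \<partial>lborel)
      = (\<integral>\<^sup>+y. ennreal (p t x (E t *v x - y)) * ennreal (p s (E t *v x - y) z) \<partial>lborel)"
    by (rule nn_integral_lborel_reflect[symmetric]) measurable
  also have "\<dots> = (\<integral>\<^sup>+y. ennreal (gauss (C t) y) * ennreal (gauss (C s) (a - E s *v y)) \<partial>lborel)"
  proof -
    have "E s *v (E t *v x - y) - z = a - E s *v y" for y
      by (simp add: a_def Ets matrix_vector_mult_diff_distrib)
    then show ?thesis using assms by (simp add: p_def)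
  qed
  also have "\<dots> = ennreal (gauss (C s + E s ** C t ** transpose (E s)) a)"
    using assms by (intro gauss_convolution pos_def_C) auto
  also have "C s + E s ** C t ** transpose (E s) = C (t + s)"
    using ou_covariance_add[OF Q, of s t B] assms by (simp add: C_def E_def add.commute)
  finally show ?thesis using assms by (simp add: p_def a_def)
qed

text \<open>A Gaussian is largest at its centre, so it suffices that det (C t) has a positive
  minimum on [\<theta>, T]; beyond T the kernel is 0.\<close>

lemma p_bounded:
  assumes "0 < \<theta>"
  obtains c where "c > 0" "\<And>t x y. \<theta> \<le> t \<Longrightarrow> p t x y \<le> c"
proof (cases "\<theta> \<le> T")
  case True
  have "continuous_on {\<theta>..T} C"
    unfolding C_def using assms
    by (intro continuous_on_subset[OF continuous_on_ou_covariance[OF Q, of T B]]) auto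
  then have "continuous_on {\<theta>..T} (\<lambda>t. C t $ i $ j)" for i j
    by (intro continuous_on_component)
  then have "continuous_on {\<theta>..T} (\<lambda>t. det (C t))"
    unfolding det_def by (intro continuous_on_sum continuous_on_mult continuous_on_prod continuous_on_const)
  then obtain t0 where t0: "t0 \<in> {\<theta>..T}" "\<And>t. t \<in> {\<theta>..T} \<Longrightarrow> det (C t0) \<le> det (C t)"
    using continuous_attains_inf[of "{\<theta>..T}" "\<lambda>t. det (C t)"] True by auto
  have d0: "det (C t0) > 0" using t0 assms by (intro pos_def_det pos_def_C) auto
  have "p t x y \<le> gauss_const (C t0)" if "\<theta> \<le> t" for t x y
  proof (cases "t \<le> T")
    case tT: True
    have pd: "pos_def (C t)" using that assms tT by (intro pos_def_C) auto
    have "p t x y = gauss (C t) (E t *v x - y)" using that tT assms by (simp add: p_def)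
    also have "\<dots> \<le> gauss_const (C t)" by (rule gauss_le[OF pd])
    also have "\<dots> \<le> gauss_const (C t0)"
      unfolding gauss_const_def using t0(2)[of t] that tT d0 pos_def_det[OF pd]
      by (intro divide_left_mono mult_left_mono) auto
    finally show ?thesis .
  next
    case False
    then show ?thesis using d0 by (auto simp: p_def gauss_const_def)
  qed
  moreover have "gauss_const (C t0) > 0" using t0 assms by (intro gauss_const_pos pos_def_C) auto
  ultimately show ?thesis using that by blast
next
  case False
  then show ?thesis using that[of 1] by (auto simp: p_def)
qed

lemma ou_semigroup_eq_W:
  assumes t: "0 < t" "t \<le> T" and [measurable]: "f \<in> borel_measurable borel"
  shows "ou_semigroup Q B t f x = W t f x"
proof -
  have "ou_semigroup Q B t f x = (LINT y|lborel. complex_of_real (gauss (C t) y) * f (E t *v x - y))"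
    unfolding ou_semigroup_def
    by (subst integral_mult_right_zero[symmetric])
      (simp add: gauss_def gauss_const_def gauss_form_def C_def E_def mult.assoc)
  also have "\<dots> = (LINT y|lborel. complex_of_real (p t x (E t *v x - y)) * f (E t *v x - y))"
    using t by (simp add: p_def)
  also have "\<dots> = (LINT y|distr lborel borel (\<lambda>y. E t *v x - y). complex_of_real (p t x y) * f y)"
    by (subst integral_distr) auto
  also have "\<dots> = W t f x" by (simp add: W_def lborel_distr_reflect)
  finally show ?thesis .
qed

end

section \<open>Square-integrable functions and Schur bounds\<close>

text \<open>Valued in \<open>ennreal\<close>, so that operator bounds can be stated and chained for
  all measurable functions, with finiteness brought in separately.\<close>

definition L2sq :: "('a::euclidean_space \<Rightarrow> complex) \<Rightarrow> ennreal" where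
  "L2sq F = (\<integral>\<^sup>+x. ennreal ((cmod (F x))\<^sup>2) \<partial>lborel)"

text \<open>In the non-integrable case the Bochner integral is 0 by convention.\<close>

lemma norm_integral_le_nn_integral:
  fixes f :: "'a \<Rightarrow> 'b::{banach, second_countable_topology}"
  shows "ennreal (norm (LINT x|M. f x)) \<le> (\<integral>\<^sup>+x. ennreal (norm (f x)) \<partial>M)"
proof (cases "integrable M f")
  case True then show ?thesis by (rule integral_norm_bound_ennreal)
qed (simp add: not_integrable_integral_eq)

lemma L2_mult_integrable:
  fixes \<kappa> :: "'a \<Rightarrow> real" and F :: "'a \<Rightarrow> complex"
  assumes [measurable]: "\<kappa> \<in> borel_measurable M" "F \<in> borel_measurable M"
    and \<kappa>: "(\<integral>\<^sup>+x. ennreal ((\<kappa> x)\<^sup>2) \<partial>M) < \<infinity>" and F: "(\<integral>\<^sup>+x. ennreal ((cmod (F x))\<^sup>2) \<partial>M) < \<infinity>"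
  shows "integrable M (\<lambda>x. complex_of_real (\<kappa> x) * F x)"
proof (rule integrableI_bounded)
  have "(\<integral>\<^sup>+x. ennreal (norm (complex_of_real (\<kappa> x) * F x)) \<partial>M)
      \<le> (\<integral>\<^sup>+x. ennreal ((\<kappa> x)\<^sup>2) + ennreal ((cmod (F x))\<^sup>2) \<partial>M)"
  proof (rule nn_integral_mono)
    fix x
    have "\<bar>\<kappa> x\<bar> * cmod (F x) \<le> (\<kappa> x)\<^sup>2 + (cmod (F x))\<^sup>2"
      using sum_squares_bound[of "\<bar>\<kappa> x\<bar>" "cmod (F x)"] mult_nonneg_nonneg[OF abs_ge_zero norm_ge_zero, of "\<kappa> x" "F x"]
      unfolding power2_abs by linarith
    then show "ennreal (norm (complex_of_real (\<kappa> x) * F x)) \<le> ennreal ((\<kappa> x)\<^sup>2) + ennreal ((cmod (F x))\<^sup>2)"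
      by (simp add: norm_mult ennreal_plus[symmetric] del: ennreal_plus)
  qed
  also have "\<dots> = (\<integral>\<^sup>+x. ennreal ((\<kappa> x)\<^sup>2) \<partial>M) + (\<integral>\<^sup>+x. ennreal ((cmod (F x))\<^sup>2) \<partial>M)"
    by (rule nn_integral_add) measurable
  also have "\<dots> < \<infinity>" using \<kappa> F by simp
  finally show "(\<integral>\<^sup>+x. ennreal (norm (complex_of_real (\<kappa> x) * F x)) \<partial>M) < \<infinity>" .
qed measurable

lemma nn_integral_mult_square_le:
  fixes \<kappa> :: "'a \<Rightarrow> real" and g :: "'a \<Rightarrow> real"
  assumes [measurable]: "\<kappa> \<in> borel_measurable M" "g \<in> borel_measurable M"
    and pos: "\<And>x. 0 \<le> \<kappa> x" "\<And>x. 0 \<le> g x"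
  shows "(\<integral>\<^sup>+x. ennreal (\<kappa> x * g x) \<partial>M)\<^sup>2 \<le> (\<integral>\<^sup>+x. ennreal (\<kappa> x) \<partial>M) * (\<integral>\<^sup>+x. ennreal (\<kappa> x) * ennreal ((g x)\<^sup>2) \<partial>M)"
proof -
  have 1: "ennreal (\<kappa> x * g x) = ennreal (sqrt (\<kappa> x)) * ennreal (sqrt (\<kappa> x) * g x)" for x
    using pos by (simp add: ennreal_mult[symmetric] mult.assoc[symmetric])
  have 2: "(ennreal (sqrt (\<kappa> x)))\<^sup>2 = ennreal (\<kappa> x)" for x
    using pos by (simp add: ennreal_power)
  have 3: "(ennreal (sqrt (\<kappa> x) * g x))\<^sup>2 = ennreal (\<kappa> x) * ennreal ((g x)\<^sup>2)" for x
    using pos by (simp add: ennreal_power power_mult_distrib ennreal_mult)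
  show ?thesis
    unfolding 1
    by (rule order_trans[OF Cauchy_Schwarz_nn_integral]) (auto simp: 2 3)
qed

text \<open>Cauchy-Schwarz with |K| split into two square roots, then Fubini. The two bounds enter
  as a product, so it is enough for one of them to be small.\<close>

lemma schur_test:
  fixes K :: "'a::euclidean_space \<Rightarrow> 'b::euclidean_space \<Rightarrow> real" and F :: "'b \<Rightarrow> complex"
  assumes K[measurable]: "(\<lambda>w. K (fst w) (snd w)) \<in> borel_measurable (borel \<Otimes>\<^sub>M borel)"
    and F[measurable]: "F \<in> borel_measurable borel"
    and a: "\<And>z. (\<integral>\<^sup>+x. ennreal \<bar>K z x\<bar> \<partial>lborel) \<le> \<alpha>"
    and b: "\<And>x. (\<integral>\<^sup>+z. ennreal \<bar>K z x\<bar> \<partial>lborel) \<le> \<beta>"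
  shows "L2sq (\<lambda>z. LINT x|lborel. complex_of_real (K z x) * F x) \<le> \<alpha> * \<beta> * L2sq F"
proof -
  have [measurable]: "K z \<in> borel_measurable borel" for z
    using measurable_compose[OF measurable_Pair[OF measurable_const measurable_ident] K, of z] by simp
  have [measurable]: "(\<lambda>z. K z x) \<in> borel_measurable borel" for x
    using measurable_compose[OF measurable_Pair[OF measurable_ident measurable_const] K, of x] by simp
  have Km[measurable]: "(\<lambda>(z, x). K z x) \<in> borel_measurable (lborel \<Otimes>\<^sub>M lborel)"
    using K by (simp add: split_beta' cong: measurable_cong_sets sets_pair_measure_cong)
  have "L2sq (\<lambda>z. LINT x|lborel. complex_of_real (K z x) * F x)
      \<le> (\<integral>\<^sup>+z. \<alpha> * (\<integral>\<^sup>+x. ennreal \<bar>K z x\<bar> * ennreal ((cmod (F x))\<^sup>2) \<partial>lborel) \<partial>lborel)"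
    unfolding L2sq_def
  proof (rule nn_integral_mono)
    fix z
    have "ennreal ((cmod (LINT x|lborel. complex_of_real (K z x) * F x))\<^sup>2)
        = (ennreal (cmod (LINT x|lborel. complex_of_real (K z x) * F x)))\<^sup>2"
      by (simp add: ennreal_power)
    also have "\<dots> \<le> (\<integral>\<^sup>+x. ennreal (\<bar>K z x\<bar> * cmod (F x)) \<partial>lborel)\<^sup>2"
      using norm_integral_le_nn_integral[of lborel "\<lambda>x. complex_of_real (K z x) * F x"]
      by (intro power_mono) (auto simp: norm_mult)
    also have "\<dots> \<le> (\<integral>\<^sup>+x. ennreal \<bar>K z x\<bar> \<partial>lborel) * (\<integral>\<^sup>+x. ennreal \<bar>K z x\<bar> * ennreal ((cmod (F x))\<^sup>2) \<partial>lborel)"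
      by (rule nn_integral_mult_square_le) auto
    also have "\<dots> \<le> \<alpha> * (\<integral>\<^sup>+x. ennreal \<bar>K z x\<bar> * ennreal ((cmod (F x))\<^sup>2) \<partial>lborel)"
      by (intro mult_right_mono a) auto
    finally show "ennreal ((cmod (LINT x|lborel. complex_of_real (K z x) * F x))\<^sup>2)
      \<le> \<alpha> * (\<integral>\<^sup>+x. ennreal \<bar>K z x\<bar> * ennreal ((cmod (F x))\<^sup>2) \<partial>lborel)" .
  qed
  also have "\<dots> = \<alpha> * (\<integral>\<^sup>+z. (\<integral>\<^sup>+x. ennreal \<bar>K z x\<bar> * ennreal ((cmod (F x))\<^sup>2) \<partial>lborel) \<partial>lborel)"
    by (rule nn_integral_cmult) measurable
  also have "(\<integral>\<^sup>+z. (\<integral>\<^sup>+x. ennreal \<bar>K z x\<bar> * ennreal ((cmod (F x))\<^sup>2) \<partial>lborel) \<partial>lborel)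
      = (\<integral>\<^sup>+x. (\<integral>\<^sup>+z. ennreal \<bar>K z x\<bar> * ennreal ((cmod (F x))\<^sup>2) \<partial>lborel) \<partial>lborel)"
    by (rule lborel_pair.Fubini') measurable
  also have "\<dots> = (\<integral>\<^sup>+x. (\<integral>\<^sup>+z. ennreal \<bar>K z x\<bar> \<partial>lborel) * ennreal ((cmod (F x))\<^sup>2) \<partial>lborel)"
    by (intro nn_integral_cong nn_integral_multc) measurable
  also have "\<dots> \<le> (\<integral>\<^sup>+x. \<beta> * ennreal ((cmod (F x))\<^sup>2) \<partial>lborel)"
    by (intro nn_integral_mono mult_right_mono b) auto
  also have "\<dots> = \<beta> * L2sq F"
    unfolding L2sq_def by (rule nn_integral_cmult) measurable
  finally show ?thesis by (simp add: mult.assoc mult_left_mono)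
qed

text \<open>
  In \<open>ou_control\<close>, \<open>c x\<close> labels the cell of \<open>x\<close> and \<open>y x\<close> is the centre of the ball in that cell. The assumption
  on \<open>Dc\<close> bounds \<open>|det exp(-t B)|\<close> on \<open>[0, T]\<close>; the one on \<open>c4\<close> holds with \<open>2\<^sup>n\<^sup>/\<^sup>2\<close>.
\<close>

locale ou_control = ou_kernel Q B T cl \<kappa>
  for Q B :: "real^'n^'n" and T cl :: real and \<kappa> :: nat +
  fixes \<omega> :: "(real^'n) set" and c y :: "real^'n \<Rightarrow> real^'n" and D \<rho> Dc c4 :: real
  assumes D: "0 < D" and \<rho>: "0 < \<rho>" "\<rho> \<le> 1"
    and c_meas [measurable]: "c \<in> borel_measurable borel" and y_meas [measurable]: "y \<in> borel_measurable borel"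
    and c_cnt: "countable (range c)" and yc: "\<And>x x'. c x = c x' \<Longrightarrow> y x = y x'"
    and y_dist: "\<And>x. norm (x - y x) \<le> D"
    and c_inv: "\<And>x t. 0 < t \<Longrightarrow> t \<le> \<rho> \<Longrightarrow> c (y x + t *\<^sub>R (x - y x)) = c x"
    and in_\<omega>: "\<And>x t. 0 < t \<Longrightarrow> t \<le> \<rho> \<Longrightarrow> y x + t *\<^sub>R (x - y x) \<in> \<omega>"
    and Dc: "1 \<le> Dc" "\<And>t f. 0 \<le> t \<Longrightarrow> t \<le> T \<Longrightarrow> f \<in> borel_measurable borel \<Longrightarrow>
      (\<integral>\<^sup>+x. f (mexp (t *\<^sub>R B) *v x) \<partial>lborel) \<le> ennreal Dc * (\<integral>\<^sup>+x. f x \<partial>lborel)"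
    and c4: "1 \<le> c4" "\<And>A :: real^'n^'n. pos_def A \<Longrightarrow>
      (\<integral>\<^sup>+x. ennreal (gauss_const A * exp (- (1/4) * gauss_form A x)) \<partial>lborel) \<le> ennreal c4"
begin

lemma nn_integral_p_left: "(\<integral>\<^sup>+x. ennreal (p t x y') \<partial>lborel) \<le> ennreal Dc"
proof (cases "0 < t \<and> t \<le> T")
  case True
  have "(\<integral>\<^sup>+x. ennreal (p t x y') \<partial>lborel) = (\<integral>\<^sup>+x. ennreal (gauss (C t) (E t *v x + - y')) \<partial>lborel)"
    using True by (simp add: p_def)
  also have "\<dots> \<le> ennreal Dc * (\<integral>\<^sup>+x. ennreal (gauss (C t) (x + - y')) \<partial>lborel)"
    unfolding E_def using True by (intro Dc(2)) auto
  also have "(\<integral>\<^sup>+x. ennreal (gauss (C t) (x + - y')) \<partial>lborel) = 1"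
    using True by (subst nn_integral_lborel_shift) (auto simp: nn_integral_gauss[OF pos_def_C])
  finally show ?thesis by simp
next
  case False then show ?thesis by (auto simp: p_def)
qed

lemma nn_integral_p_square: "(\<integral>\<^sup>+y. ennreal ((p t x y)\<^sup>2) \<partial>lborel) < \<infinity>"
proof (cases "0 < t")
  case True
  obtain c where c: "c > 0" "\<And>s x y. t \<le> s \<Longrightarrow> p s x y \<le> c" using p_bounded[OF True] by blast
  have "(\<integral>\<^sup>+y. ennreal ((p t x y)\<^sup>2) \<partial>lborel) \<le> (\<integral>\<^sup>+y. ennreal c * ennreal (p t x y) \<partial>lborel)"
    using c p_nonneg by (intro nn_integral_mono) (auto simp: power2_eq_square ennreal_mult[symmetric] intro!: ennreal_leI mult_right_mono)
  also have "\<dots> = ennreal c * (\<integral>\<^sup>+y. ennreal (p t x y) \<partial>lborel)" by (rule nn_integral_cmult) measurable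
  also have "\<dots> \<le> ennreal c * 1" by (intro mult_left_mono nn_integral_p_le) auto
  also have "\<dots> < \<infinity>" by simp
  finally show ?thesis .
next
  case False then show ?thesis by (simp add: p_def)
qed

lemma W_integrable:
  assumes [measurable]: "F \<in> borel_measurable borel" and "L2sq F < \<infinity>"
  shows "integrable lborel (\<lambda>y. complex_of_real (p t x y) * F y)"
  using assms(2) nn_integral_p_square[of t x] by (intro L2_mult_integrable) (auto simp: L2sq_def)

lemma W_measurable [measurable (raw)]:
  assumes [measurable]: "f \<in> borel_measurable M" "g \<in> borel_measurable M"
    "(\<lambda>w. F (fst w) (snd w)) \<in> borel_measurable (M \<Otimes>\<^sub>M borel)"
  shows "(\<lambda>w. W (f w) (F w) (g w)) \<in> borel_measurable M"
proof -
  have [measurable]: "(\<lambda>w. F (fst w) (snd w)) \<in> borel_measurable (M \<Otimes>\<^sub>M lborel)"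
    using assms(3) by (simp cong: measurable_cong_sets sets_pair_measure_cong)
  have "(\<lambda>(w, y). complex_of_real (p (f w) (g w) y) * F w y) \<in> borel_measurable (M \<Otimes>\<^sub>M lborel)"
    unfolding split_beta' by measurable
  then show ?thesis unfolding W_def by (rule lborel.borel_measurable_lebesgue_integral)
qed

lemma L2sq_W:
  assumes [measurable]: "F \<in> borel_measurable borel"
  shows "L2sq (W t F) \<le> ennreal Dc * L2sq F"
proof -
  have "L2sq (\<lambda>z. LINT x|lborel. complex_of_real (p t z x) * F x) \<le> 1 * ennreal Dc * L2sq F"
    using nn_integral_p_le[of t] nn_integral_p_left[of t] by (intro schur_test) (auto simp: p_nonneg)
  then show ?thesis by (simp add: W_def[abs_def])
qed

text \<open>Fubini and Chapman-Kolmogorov. The same identity applied to |F| yields the integrability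
  on the product space.\<close>

lemma W_semigroup:
  assumes t: "0 < t" "0 < s" "t + s \<le> T" and [measurable]: "F \<in> borel_measurable borel" and F: "L2sq F < \<infinity>"
  shows "W t (W s F) x = W (t + s) F x"
proof -
  let ?h = "\<lambda>y z. complex_of_real (p t x y) * (complex_of_real (p s y z) * F z)"
  have int: "integrable (lborel \<Otimes>\<^sub>M lborel) (\<lambda>(y, z). ?h y z)"
  proof (rule integrableI_bounded)
    have "(\<integral>\<^sup>+w. ennreal (norm (case w of (y, z) \<Rightarrow> ?h y z)) \<partial>(lborel \<Otimes>\<^sub>M lborel))
        = (\<integral>\<^sup>+z. (\<integral>\<^sup>+y. ennreal (norm (?h y z)) \<partial>lborel) \<partial>lborel)"
      by (subst lborel_pair.nn_integral_snd[symmetric]) (simp_all add: split_beta')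
    also have "\<dots> = (\<integral>\<^sup>+z. ennreal (norm (complex_of_real (p (t + s) x z) * F z)) \<partial>lborel)"
    proof (rule nn_integral_cong)
      fix z
      have "(\<integral>\<^sup>+y. ennreal (norm (?h y z)) \<partial>lborel) = (\<integral>\<^sup>+y. (ennreal (p t x y) * ennreal (p s y z)) * ennreal (norm (F z)) \<partial>lborel)"
        by (intro nn_integral_cong) (simp add: norm_mult p_nonneg ennreal_mult mult.assoc)
      also have "\<dots> = (\<integral>\<^sup>+y. ennreal (p t x y) * ennreal (p s y z) \<partial>lborel) * ennreal (norm (F z))"
        by (rule nn_integral_multc) measurable
      also have "\<dots> = ennreal (norm (complex_of_real (p (t + s) x z) * F z))"
        using t by (simp add: chapman_kolmogorov norm_mult p_nonneg ennreal_mult)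
      finally show "(\<integral>\<^sup>+y. ennreal (norm (?h y z)) \<partial>lborel) = ennreal (norm (complex_of_real (p (t + s) x z) * F z))" .
    qed
    also have "\<dots> < \<infinity>" using W_integrable[OF assms(4) F, of "t + s" x] by (simp add: integrable_iff_bounded)
    finally show "(\<integral>\<^sup>+w. ennreal (norm (case w of (y, z) \<Rightarrow> ?h y z)) \<partial>(lborel \<Otimes>\<^sub>M lborel)) < \<infinity>" .
  qed (simp add: split_beta')
  have "W t (W s F) x = (LINT y|lborel. (LINT z|lborel. ?h y z))"
    by (simp add: W_def)
  also have "\<dots> = (LINT z|lborel. (LINT y|lborel. ?h y z))"
    by (rule lborel_pair.Fubini_integral[OF int, symmetric])
  also have "\<dots> = (LINT z|lborel. complex_of_real (p (t + s) x z) * F z)"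
  proof (rule Bochner_Integration.integral_cong[OF refl])
    fix z
    have "(LINT y|lborel. p t x y * p s y z) = p (t + s) x z"
      using chapman_kolmogorov[OF t, of x z] p_nonneg
      by (intro integral_eq_nn_integral[THEN trans]) (auto simp: ennreal_mult)
    then have "complex_of_real (LINT y|lborel. p t x y * p s y z) = complex_of_real (p (t + s) x z)" by simp
    then have "(LINT y|lborel. complex_of_real (p t x y * p s y z)) = complex_of_real (p (t + s) x z)"
      by (simp only: integral_complex_of_real)
    then show "(LINT y|lborel. ?h y z) = complex_of_real (p (t + s) x z) * F z"
      by (simp add: mult.assoc[symmetric] flip: of_real_mult)
  qed
  finally show ?thesis by (simp add: W_def)
qed

end

section \<open>The extrapolation operator\<close>

context ou_control
begin

definition node :: "nat \<Rightarrow> nat \<Rightarrow> real" where "node M = unif_node \<rho> M"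
definition lw :: "nat \<Rightarrow> nat \<Rightarrow> real" where "lw M = lagrange_weight (node M) M"
text \<open>The summand 1 accounts for the value at the target point, which also enters the
  extrapolation error.\<close>

definition Lam :: "nat \<Rightarrow> real" where "Lam M = 1 + (\<Sum>j\<le>M. \<bar>lw M j\<bar>)"
definition phi :: "nat \<Rightarrow> nat \<Rightarrow> real^'n \<Rightarrow> real^'n" where "phi M j x = y x + node M j *\<^sub>R (x - y x)"
definition psi :: "nat \<Rightarrow> nat \<Rightarrow> real^'n \<Rightarrow> real^'n" where "psi M j x = y x + (1 / node M j) *\<^sub>R (x - y x)"
text \<open>The density of the image of Lebesgue measure under \<open>phi M j\<close>. The indicator
  selects the image of \<open>phi M j\<close>, on which \<open>psi M j\<close> is its
  inverse.\<close>

definition dil :: "nat \<Rightarrow> nat \<Rightarrow> real^'n \<Rightarrow> real" where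
  "dil M j x = (1 / node M j) ^ CARD('n) * indicator {x. c (psi M j x) = c x} x"
text \<open>The transpose of the operator that extrapolates a function g to x from its values at the
  points \<open>phi M j x\<close>.\<close>

definition S :: "nat \<Rightarrow> (real^'n \<Rightarrow> complex) \<Rightarrow> real^'n \<Rightarrow> complex" where
  "S M F x = (\<Sum>j\<le>M. complex_of_real (lw M j * dil M j x) * F (psi M j x))"
text \<open>The kernel of \<open>W r\<close> composed with S - 1: the error of extrapolating the
  transition kernel in its second variable.\<close>

definition Kern :: "nat \<Rightarrow> real \<Rightarrow> real^'n \<Rightarrow> real^'n \<Rightarrow> real" where
  "Kern M r z x = (\<Sum>j\<le>M. lw M j * p r z (phi M j x)) - p r z x"
definition G\<rho> :: real where "G\<rho> = (2 / \<rho>) ^ CARD('n)"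

lemma node_bounds:
  assumes "1 \<le> M" "j \<le> M" shows "0 < node M j" "node M j \<le> \<rho>" "\<rho> / 2 \<le> node M j"
  using unif_node_bounds[OF \<rho>(1) assms] \<rho>(1) by (auto simp: node_def)

lemma lw_exact: "1 \<le> M \<Longrightarrow> m \<le> M \<Longrightarrow> (\<Sum>j\<le>M. lw M j * node M j ^ m) = 1"
  unfolding lw_def node_def
  by (intro lagrange_weight_exact inj_on_subset[OF inj_unif_node] \<rho>) auto

lemma Lam_ge_1: "1 \<le> Lam M" by (simp add: Lam_def sum_nonneg)

lemma Lam_le:
  assumes M: "1 \<le> M" shows "Lam M \<le> (1 + 4 * exp 1 / \<rho>) ^ M"
proof -
  define q where "q = 4 * exp 1 / \<rho>"
  have q: "q \<ge> 0" using \<rho> by (simp add: q_def)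
  have "Lam M \<le> 1 + q ^ M"
    using sum_abs_lagrange_weight_le[OF \<rho> M] by (simp add: Lam_def lw_def node_def q_def)
  also have "\<dots> \<le> (1 + q) ^ M"
    using M
  proof (induction M rule: dec_induct)
    case (step m)
    have "1 + q ^ Suc m \<le> (1 + q) * (1 + q ^ m)" using q by (simp add: algebra_simps)
    also have "\<dots> \<le> (1 + q) * (1 + q) ^ m" using q step by (intro mult_left_mono) auto
    finally show ?case by simp
  qed simp
  finally show ?thesis by (simp add: q_def)
qed

lemma G\<rho>_ge_1: "1 \<le> G\<rho>" unfolding G\<rho>_def using \<rho> by (intro one_le_power) (simp add: le_divide_eq)

lemma phi_measurable [measurable]: "phi M j \<in> borel_measurable borel" unfolding phi_def by measurable
lemma psi_measurable [measurable]: "psi M j \<in> borel_measurable borel" unfolding psi_def by measurable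
lemma dil_measurable [measurable]: "dil M j \<in> borel_measurable borel"
proof -
  have [measurable]: "{x. c (psi M j x) = c x} \<in> sets borel" by measurable
  show ?thesis unfolding dil_def by measurable
qed

lemma dil_nonneg: "1 \<le> M \<Longrightarrow> j \<le> M \<Longrightarrow> 0 \<le> dil M j x"
  using node_bounds[of M j] by (simp add: dil_def)

lemma dil_le: assumes "1 \<le> M" "j \<le> M" shows "dil M j x \<le> G\<rho>"
proof -
  have "1 / node M j \<le> 2 / \<rho>" using node_bounds[OF assms] \<rho> by (simp add: field_simps)
  then have "(1 / node M j) ^ CARD('n) \<le> G\<rho>"
    unfolding G\<rho>_def using node_bounds[OF assms] by (intro power_mono) auto
  then show ?thesis using G\<rho>_ge_1 by (simp add: dil_def indicator_def)
qed

lemma c_node: "1 \<le> M \<Longrightarrow> j \<le> M \<Longrightarrow> c (y x + node M j *\<^sub>R (x - y x)) = c x"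
  by (rule c_inv) (rule node_bounds; assumption)+

lemma psi_phi: assumes "1 \<le> M" "j \<le> M" shows "psi M j (phi M j x) = x"
proof -
  have "y (phi M j x) = y x" unfolding phi_def by (rule yc, rule c_node[OF assms])
  then show ?thesis using node_bounds(1)[OF assms] by (simp add: psi_def) (simp add: phi_def)
qed

lemma phi_psi: assumes "1 \<le> M" "j \<le> M" "c (psi M j x) = c x" shows "phi M j (psi M j x) = x"
proof -
  have "y (psi M j x) = y x" by (rule yc[OF assms(3)])
  then show ?thesis using node_bounds(1)[OF assms(1,2)] by (simp add: phi_def) (simp add: psi_def)
qed

lemma distr_phi:
  assumes "1 \<le> M" "j \<le> M"
  shows "distr lborel borel (phi M j) = density lborel (\<lambda>x. ennreal (dil M j x))"
proof -
  have "distr lborel borel (phi M j) = density lborel (\<lambda>x. ennreal ((1 / node M j) ^ CARD('n)) *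
      indicator {x. c (y x + (1 / node M j) *\<^sub>R (x - y x)) = c x} x)"
    unfolding phi_def[abs_def]
  proof (rule distr_cell_contraction[where c = c and y = y and t = "node M j"])
    show "y x = y x'" if "c x = c x'" for x x' using that by (rule yc)
    show "c (y x + node M j *\<^sub>R (x - y x)) = c x" for x by (rule c_node[OF assms])
  qed (rule c_meas y_meas c_cnt node_bounds(1)[OF assms])+
  also have "(\<lambda>x. ennreal ((1 / node M j) ^ CARD('n)) * indicator {x. c (y x + (1 / node M j) *\<^sub>R (x - y x)) = c x} x)
      = (\<lambda>x. ennreal (dil M j x))"
    by (auto simp: fun_eq_iff dil_def psi_def indicator_def)
  finally show ?thesis .
qed

lemma nn_integral_phi:
  assumes "1 \<le> M" "j \<le> M" and [measurable]: "g \<in> borel_measurable borel"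
  shows "(\<integral>\<^sup>+x. g (phi M j x) \<partial>lborel) = (\<integral>\<^sup>+x. ennreal (dil M j x) * g x \<partial>lborel)"
proof -
  have "(\<integral>\<^sup>+x. g (phi M j x) \<partial>lborel) = (\<integral>\<^sup>+x. g x \<partial>distr lborel borel (phi M j))"
    by (subst nn_integral_distr) auto
  also have "\<dots> = (\<integral>\<^sup>+x. ennreal (dil M j x) * g x \<partial>lborel)"
    unfolding distr_phi[OF assms(1,2)] by (subst nn_integral_density) auto
  finally show ?thesis .
qed

lemma integral_phi:
  fixes g :: "real^'n \<Rightarrow> complex"
  assumes "1 \<le> M" "j \<le> M" and [measurable]: "g \<in> borel_measurable borel"
  shows "(LINT x|lborel. g (phi M j x)) = (LINT x|lborel. complex_of_real (dil M j x) * g x)"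
    and "integrable lborel (\<lambda>x. g (phi M j x)) \<longleftrightarrow> integrable lborel (\<lambda>x. complex_of_real (dil M j x) * g x)"
proof -
  have "(LINT x|lborel. g (phi M j x)) = (LINT x|distr lborel borel (phi M j). g x)"
    by (subst integral_distr) auto
  also have "\<dots> = (LINT x|lborel. dil M j x *\<^sub>R g x)"
    unfolding distr_phi[OF assms(1,2)] using dil_nonneg[OF assms(1,2)] by (subst integral_density) auto
  finally show "(LINT x|lborel. g (phi M j x)) = (LINT x|lborel. complex_of_real (dil M j x) * g x)"
    by (simp add: scaleR_conv_of_real)
  have "integrable lborel (\<lambda>x. g (phi M j x)) \<longleftrightarrow> integrable (distr lborel borel (phi M j)) g"
    by (subst integrable_distr_eq) auto
  also have "\<dots> \<longleftrightarrow> integrable lborel (\<lambda>x. dil M j x *\<^sub>R g x)"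
    unfolding distr_phi[OF assms(1,2)] using dil_nonneg[OF assms(1,2)] by (subst integrable_density) auto
  finally show "integrable lborel (\<lambda>x. g (phi M j x)) \<longleftrightarrow> integrable lborel (\<lambda>x. complex_of_real (dil M j x) * g x)"
    by (simp add: scaleR_conv_of_real)
qed

lemma nn_integral_psi:
  assumes "1 \<le> M" "j \<le> M" and [measurable]: "g \<in> borel_measurable borel"
  shows "(\<integral>\<^sup>+x. ennreal (dil M j x) * g (psi M j x) \<partial>lborel) = (\<integral>\<^sup>+x. g x \<partial>lborel)"
  using nn_integral_phi[OF assms(1,2), of "\<lambda>x. g (psi M j x)"] by (simp add: psi_phi[OF assms(1,2)])

text \<open>A nonzero summand needs a nonzero \<open>dil\<close>, so x is a value of
  \<open>phi M j\<close>, and these all lie in \<omega>.\<close>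

lemma S_support: assumes "1 \<le> M" "S M F x \<noteq> 0" shows "x \<in> \<omega>"
proof -
  obtain j where j: "j \<le> M" "dil M j x \<noteq> 0"
    using assms(2) unfolding S_def by (metis (no_types, lifting) atMost_iff mult_zero_left mult_zero_right of_real_0 sum.neutral)
  then have "c (psi M j x) = c x" by (auto simp: dil_def indicator_def split: if_splits)
  then have "phi M j (psi M j x) = x" by (rule phi_psi[OF assms(1) j(1)])
  moreover have "phi M j (psi M j x) \<in> \<omega>"
    unfolding phi_def using node_bounds[OF assms(1) j(1)] by (intro in_\<omega>) auto
  ultimately show ?thesis by simp
qed

lemma S_measurable [measurable (raw)]:
  assumes g[measurable]: "g \<in> borel_measurable M'" and F: "(\<lambda>w. F (fst w) (snd w)) \<in> borel_measurable (M' \<Otimes>\<^sub>M borel)"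
  shows "(\<lambda>w. S M (F w) (g w)) \<in> borel_measurable M'"
proof -
  have [measurable]: "(\<lambda>w. F w (psi M j (g w))) \<in> borel_measurable M'" for j
    using measurable_compose[OF measurable_Pair[OF measurable_ident] F, of "\<lambda>w. psi M j (g w)"] by simp
  show ?thesis unfolding S_def by measurable
qed

text \<open>Of the squared density, one factor serves as the Jacobian of the substitution and the
  other is bounded by \<open>G\<rho>\<close>.\<close>

lemma L2sq_dil:
  assumes "1 \<le> M" "j \<le> M" and [measurable]: "F \<in> borel_measurable borel"
  shows "L2sq (\<lambda>x. complex_of_real (dil M j x) * F (psi M j x)) \<le> ennreal G\<rho> * L2sq F"
proof -
  have "L2sq (\<lambda>x. complex_of_real (dil M j x) * F (psi M j x))
      \<le> (\<integral>\<^sup>+x. ennreal G\<rho> * (ennreal (dil M j x) * ennreal ((cmod (F (psi M j x)))\<^sup>2)) \<partial>lborel)"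
    unfolding L2sq_def
  proof (rule nn_integral_mono)
    fix x
    have "(dil M j x)\<^sup>2 \<le> G\<rho> * dil M j x"
      unfolding power2_eq_square by (intro mult_right_mono dil_le dil_nonneg assms)
    then have "(dil M j x)\<^sup>2 * (cmod (F (psi M j x)))\<^sup>2 \<le> (G\<rho> * dil M j x) * (cmod (F (psi M j x)))\<^sup>2"
      by (rule mult_right_mono) simp
    then have "ennreal ((dil M j x)\<^sup>2 * (cmod (F (psi M j x)))\<^sup>2) \<le> ennreal (G\<rho> * (dil M j x * (cmod (F (psi M j x)))\<^sup>2))"
      by (intro ennreal_leI) (simp add: mult.assoc)
    then show "ennreal ((cmod (complex_of_real (dil M j x) * F (psi M j x)))\<^sup>2)
        \<le> ennreal G\<rho> * (ennreal (dil M j x) * ennreal ((cmod (F (psi M j x)))\<^sup>2))"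
      using G\<rho>_ge_1 dil_nonneg[OF assms(1,2)] by (simp add: norm_mult power_mult_distrib ennreal_mult)
  qed
  also have "\<dots> = ennreal G\<rho> * (\<integral>\<^sup>+x. ennreal (dil M j x) * ennreal ((cmod (F (psi M j x)))\<^sup>2) \<partial>lborel)"
    by (rule nn_integral_cmult) measurable
  also have "\<dots> = ennreal G\<rho> * L2sq F"
    unfolding L2sq_def using nn_integral_psi[OF assms(1,2), of "\<lambda>x. ennreal ((cmod (F x))\<^sup>2)"] by simp
  finally show ?thesis .
qed

lemma sum_weighted_square_le:
  fixes w g :: "nat \<Rightarrow> real"
  shows "(\<Sum>j\<in>I. \<bar>w j\<bar> * g j)\<^sup>2 \<le> (\<Sum>j\<in>I. \<bar>w j\<bar>) * (\<Sum>j\<in>I. \<bar>w j\<bar> * (g j)\<^sup>2)"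
  using Cauchy_Schwarz_ineq_sum[of "\<lambda>j. sqrt \<bar>w j\<bar>" "\<lambda>j. sqrt \<bar>w j\<bar> * g j" I]
  by (simp add: power_mult_distrib mult.assoc[symmetric])

text \<open>Cauchy-Schwarz with respect to the weights \<open>\<bar>lw M j\<bar>\<close> brings in
  the total weight twice.\<close>

lemma L2sq_S:
  assumes M: "1 \<le> M" and [measurable]: "F \<in> borel_measurable borel"
  shows "L2sq (S M F) \<le> ennreal ((Lam M)\<^sup>2 * G\<rho>) * L2sq F"
proof -
  let ?g = "\<lambda>j x. complex_of_real (dil M j x) * F (psi M j x)"
  have sl: "(\<Sum>j\<le>M. \<bar>lw M j\<bar>) \<le> Lam M" by (simp add: Lam_def)
  have "L2sq (S M F) \<le> (\<integral>\<^sup>+x. (\<Sum>j\<le>M. ennreal (Lam M * \<bar>lw M j\<bar>) * ennreal ((cmod (?g j x))\<^sup>2)) \<partial>lborel)"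
    unfolding L2sq_def
  proof (rule nn_integral_mono)
    fix x
    have "cmod (S M F x) \<le> (\<Sum>j\<le>M. cmod (complex_of_real (lw M j * dil M j x) * F (psi M j x)))"
      unfolding S_def by (rule norm_sum)
    also have "\<dots> = (\<Sum>j\<le>M. \<bar>lw M j\<bar> * cmod (?g j x))" by (simp add: norm_mult abs_mult mult.assoc)
    finally have "(cmod (S M F x))\<^sup>2 \<le> (\<Sum>j\<le>M. \<bar>lw M j\<bar> * cmod (?g j x))\<^sup>2" by (rule power_mono) simp
    also have "\<dots> \<le> (\<Sum>j\<le>M. \<bar>lw M j\<bar>) * (\<Sum>j\<le>M. \<bar>lw M j\<bar> * (cmod (?g j x))\<^sup>2)" by (rule sum_weighted_square_le)
    also have "\<dots> \<le> Lam M * (\<Sum>j\<le>M. \<bar>lw M j\<bar> * (cmod (?g j x))\<^sup>2)"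
      by (intro mult_right_mono sl sum_nonneg) auto
    also have "\<dots> = (\<Sum>j\<le>M. Lam M * \<bar>lw M j\<bar> * (cmod (?g j x))\<^sup>2)" by (simp add: sum_distrib_left mult.assoc)
    finally have "ennreal ((cmod (S M F x))\<^sup>2) \<le> ennreal (\<Sum>j\<le>M. Lam M * \<bar>lw M j\<bar> * (cmod (?g j x))\<^sup>2)" by (rule ennreal_leI)
    also have "\<dots> = (\<Sum>j\<le>M. ennreal (Lam M * \<bar>lw M j\<bar> * (cmod (?g j x))\<^sup>2))"
      using Lam_ge_1[of M] by (intro sum_ennreal[symmetric]) auto
    also have "\<dots> = (\<Sum>j\<le>M. ennreal (Lam M * \<bar>lw M j\<bar>) * ennreal ((cmod (?g j x))\<^sup>2))"
      using Lam_ge_1[of M] by (intro sum.cong ennreal_mult) auto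
    finally show "ennreal ((cmod (S M F x))\<^sup>2) \<le> (\<Sum>j\<le>M. ennreal (Lam M * \<bar>lw M j\<bar>) * ennreal ((cmod (?g j x))\<^sup>2))" .
  qed
  also have "\<dots> = (\<Sum>j\<le>M. ennreal (Lam M * \<bar>lw M j\<bar>) * L2sq (?g j))"
    unfolding L2sq_def by (subst nn_integral_sum, measurable) (intro sum.cong nn_integral_cmult refl, measurable)
  also have "\<dots> \<le> (\<Sum>j\<le>M. ennreal (Lam M * \<bar>lw M j\<bar>) * (ennreal G\<rho> * L2sq F))"
    using M by (intro sum_mono mult_left_mono L2sq_dil) auto
  also have "\<dots> = ennreal (\<Sum>j\<le>M. Lam M * \<bar>lw M j\<bar>) * (ennreal G\<rho> * L2sq F)"
    unfolding sum_distrib_right[symmetric] using Lam_ge_1[of M] by (subst sum_ennreal) auto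
  also have "\<dots> \<le> ennreal ((Lam M)\<^sup>2) * (ennreal G\<rho> * L2sq F)"
    using sl Lam_ge_1[of M]
    by (intro mult_right_mono ennreal_leI) (auto simp: sum_distrib_left[symmetric] power2_eq_square)
  also have "\<dots> = ennreal ((Lam M)\<^sup>2 * G\<rho>) * L2sq F"
    using G\<rho>_ge_1 by (simp add: ennreal_mult mult.assoc)
  finally show ?thesis .
qed

lemma Kern_measurable [measurable (raw)]:
  assumes [measurable]: "f \<in> borel_measurable M'" "g \<in> borel_measurable M'" "h \<in> borel_measurable M'"
  shows "(\<lambda>w. Kern M (f w) (g w) (h w)) \<in> borel_measurable M'"
  unfolding Kern_def by measurable

text \<open>The substitution by \<open>phi M j\<close> transfers the contractions from F to the
  second variable of the transition kernel.\<close>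

lemma W_S:
  assumes M: "1 \<le> M" and [measurable]: "F \<in> borel_measurable borel" and F: "L2sq F < \<infinity>"
  shows "W r (S M F) z = W r F z + (LINT x|lborel. complex_of_real (Kern M r z x) * F x)"
    and "integrable lborel (\<lambda>x. complex_of_real (Kern M r z x) * F x)"
proof -
  let ?g = "\<lambda>j x. complex_of_real (p r z x) * F (psi M j x)"
  have Lfin: "L2sq (\<lambda>x. complex_of_real (dil M j x) * F (psi M j x)) < \<infinity>" if "j \<le> M" for j
  proof -
    have "ennreal G\<rho> * L2sq F < \<infinity>" using F by (simp add: ennreal_mult_less_top)
    then show ?thesis using L2sq_dil[OF M that assms(2)] by (rule order_le_less_trans[rotated])
  qed
  have int1: "integrable lborel (\<lambda>x. complex_of_real (dil M j x) * ?g j x)" if "j \<le> M" for j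
    using W_integrable[OF _ Lfin[OF that], of r z] by (simp add: mult.left_commute)
  have int2: "integrable lborel (\<lambda>x. complex_of_real (p r z (phi M j x)) * F x)" if "j \<le> M" for j
    using integral_phi(2)[OF M that, of "?g j"] int1[OF that] by (simp add: psi_phi[OF M that])
  have eq: "(LINT x|lborel. complex_of_real (dil M j x) * ?g j x) = (LINT x|lborel. complex_of_real (p r z (phi M j x)) * F x)"
    if "j \<le> M" for j
    using integral_phi(1)[OF M that, of "?g j"] by (simp add: psi_phi[OF M that])
  have intp: "integrable lborel (\<lambda>x. complex_of_real (p r z x) * F x)" by (rule W_integrable[OF _ F]) simp
  have Ke: "complex_of_real (Kern M r z x) * F x
      = (\<Sum>j\<le>M. complex_of_real (lw M j) * (complex_of_real (p r z (phi M j x)) * F x)) - complex_of_real (p r z x) * F x" for x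
    by (simp add: Kern_def left_diff_distrib sum_distrib_right mult.assoc)
  have intK: "integrable lborel (\<lambda>x. \<Sum>j\<le>M. complex_of_real (lw M j) * (complex_of_real (p r z (phi M j x)) * F x))"
    by (intro Bochner_Integration.integrable_sum integrable_mult_right int2) auto
  show "integrable lborel (\<lambda>x. complex_of_real (Kern M r z x) * F x)"
    unfolding Ke by (intro Bochner_Integration.integrable_diff intK intp)
  have "W r (S M F) z = (LINT x|lborel. (\<Sum>j\<le>M. complex_of_real (lw M j) * (complex_of_real (dil M j x) * ?g j x)))"
    unfolding W_def S_def by (simp add: sum_distrib_left mult_ac)
  also have "\<dots> = (\<Sum>j\<le>M. complex_of_real (lw M j) * (LINT x|lborel. complex_of_real (dil M j x) * ?g j x))"
    by (subst Bochner_Integration.integral_sum) (auto intro!: integrable_mult_right int1)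
  also have "\<dots> = (\<Sum>j\<le>M. complex_of_real (lw M j) * (LINT x|lborel. complex_of_real (p r z (phi M j x)) * F x))"
    by (simp add: eq)
  also have "\<dots> = (LINT x|lborel. (\<Sum>j\<le>M. complex_of_real (lw M j) * (complex_of_real (p r z (phi M j x)) * F x)))"
    by (subst Bochner_Integration.integral_sum) (auto intro!: integrable_mult_right int2)
  also have "\<dots> = W r F z + (LINT x|lborel. complex_of_real (Kern M r z x) * F x)"
    unfolding Ke W_def by (subst Bochner_Integration.integral_diff[OF intK intp]) simp
  finally show "W r (S M F) z = W r F z + (LINT x|lborel. complex_of_real (Kern M r z x) * F x)" .
qed

text \<open>The bound of \<open>gauss_interpolation\<close> at radius R: the form of the inverse of
  C r is at most D^2 / (cl r^\<kappa>) on vectors of length at most D.\<close>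

definition eta :: "nat \<Rightarrow> real \<Rightarrow> real \<Rightarrow> real" where
  "eta M R r = Lam M / R ^ M * exp (3 / 2 * R\<^sup>2 * (D\<^sup>2 / (cl * r ^ \<kappa>)))"

text \<open>\<open>gauss_interpolation\<close> is applied along the line through y x and x, based at
  y x. The Gaussian factor of the bound then depends on x only through the centre y x, and on z
  through \<open>E r *v z\<close>.\<close>

lemma Kern_bound:
  assumes M: "1 \<le> M" and R: "1 \<le> R" and r: "0 < r" "r \<le> T"
  shows "\<bar>Kern M r z x\<bar> \<le> eta M R r * (gauss_const (C r) * exp (- (1/4) * gauss_form (C r) (E r *v z - y x)))"
proof -
  note pd = pos_def_C[OF r]
  have "Kern M r z x = (\<Sum>j\<le>M. lw M j * gauss (C r) ((E r *v z - y x) - node M j *\<^sub>R (x - y x))) - gauss (C r) ((E r *v z - y x) - (x - y x))"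
    using r by (simp add: Kern_def p_def phi_def algebra_simps)
  then have "\<bar>Kern M r z x\<bar> \<le> Lam M / R ^ M * exp (3 / 2 * R\<^sup>2 * gauss_form (C r) (x - y x))
       * (gauss_const (C r) * exp (- (1/4) * gauss_form (C r) (E r *v z - y x)))"
    unfolding Lam_def using node_bounds[OF M] \<rho> R
    by (simp only:) (intro gauss_interpolation pd lw_exact M; force intro: order_trans less_imp_le)
  also have "\<dots> \<le> eta M R r * (gauss_const (C r) * exp (- (1/4) * gauss_form (C r) (E r *v z - y x)))"
  proof -
    have l: "0 < cl * r ^ \<kappa>" using cl r by simp
    have "gauss_form (C r) (x - y x) \<le> (norm (x - y x))\<^sup>2 / (cl * r ^ \<kappa>)"
      using low[OF r] by (intro gauss_form_le pd l) (simp add: C_def)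
    also have "\<dots> \<le> D\<^sup>2 / (cl * r ^ \<kappa>)"
      using y_dist[of x] l by (intro divide_right_mono power_mono) auto
    finally have "3 / 2 * R\<^sup>2 * gauss_form (C r) (x - y x) \<le> 3 / 2 * R\<^sup>2 * (D\<^sup>2 / (cl * r ^ \<kappa>))"
      by (intro mult_left_mono) auto
    then have "Lam M / R ^ M * exp (3 / 2 * R\<^sup>2 * gauss_form (C r) (x - y x)) \<le> eta M R r"
      unfolding eta_def using Lam_ge_1[of M] R by (intro mult_left_mono) auto
    then show ?thesis using gauss_const_pos[OF pd] by (intro mult_right_mono) auto
  qed
  finally show ?thesis .
qed

lemma eta_nonneg: "1 \<le> R \<Longrightarrow> 0 \<le> eta M R r"
  unfolding eta_def using Lam_ge_1[of M] by simp

text \<open>Schur test with unequal bounds. Integrating in x for fixed z, only the crude bound by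
  the total weight is used. Integrating in z for fixed x, the bound of \<open>Kern_bound\<close> is
  a Gaussian after a linear substitution and a shift, and gives the small factor
  \<open>eta\<close>.\<close>

lemma L2sq_Kern:
  assumes M: "1 \<le> M" and R: "1 \<le> R" and r: "0 < r" "r \<le> T" and [measurable]: "F \<in> borel_measurable borel"
  shows "L2sq (\<lambda>z. LINT x|lborel. complex_of_real (Kern M r z x) * F x)
    \<le> ennreal (Lam M * G\<rho> * (eta M R r * c4 * Dc)) * L2sq F"
proof -
  have a: "(\<integral>\<^sup>+x. ennreal \<bar>Kern M r z x\<bar> \<partial>lborel) \<le> ennreal (Lam M * G\<rho>)" for z
  proof -
    have "(\<integral>\<^sup>+x. ennreal \<bar>Kern M r z x\<bar> \<partial>lborel)
        \<le> (\<integral>\<^sup>+x. (\<Sum>j\<le>M. ennreal \<bar>lw M j\<bar> * ennreal (p r z (phi M j x))) + ennreal (p r z x) \<partial>lborel)"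
    proof (rule nn_integral_mono)
      fix x
      have "\<bar>Kern M r z x\<bar> \<le> \<bar>\<Sum>j\<le>M. lw M j * p r z (phi M j x)\<bar> + p r z x"
        unfolding Kern_def using p_nonneg[of r z x] by linarith
      also have "\<dots> \<le> (\<Sum>j\<le>M. \<bar>lw M j\<bar> * p r z (phi M j x)) + p r z x"
        using sum_abs[of "\<lambda>j. lw M j * p r z (phi M j x)" "{..M}"] p_nonneg by (simp add: abs_mult)
      finally have "ennreal \<bar>Kern M r z x\<bar> \<le> ennreal ((\<Sum>j\<le>M. \<bar>lw M j\<bar> * p r z (phi M j x)) + p r z x)" by (rule ennreal_leI)
      also have "\<dots> = (\<Sum>j\<le>M. ennreal \<bar>lw M j\<bar> * ennreal (p r z (phi M j x))) + ennreal (p r z x)"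
        using p_nonneg by (subst ennreal_plus) (auto simp: sum_nonneg sum_ennreal[symmetric] ennreal_mult)
      finally show "ennreal \<bar>Kern M r z x\<bar> \<le> (\<Sum>j\<le>M. ennreal \<bar>lw M j\<bar> * ennreal (p r z (phi M j x))) + ennreal (p r z x)" .
    qed
    also have "\<dots> = (\<Sum>j\<le>M. ennreal \<bar>lw M j\<bar> * (\<integral>\<^sup>+x. ennreal (p r z (phi M j x)) \<partial>lborel)) + (\<integral>\<^sup>+x. ennreal (p r z x) \<partial>lborel)"
      by (subst nn_integral_add, measurable, subst nn_integral_sum, measurable) (simp add: nn_integral_cmult)
    also have "\<dots> \<le> (\<Sum>j\<le>M. ennreal \<bar>lw M j\<bar> * ennreal G\<rho>) + ennreal G\<rho>"
    proof (intro add_mono sum_mono mult_left_mono)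
      fix j assume "j \<in> {..M}"
      then have j: "j \<le> M" by simp
      have "(\<integral>\<^sup>+x. ennreal (p r z (phi M j x)) \<partial>lborel) = (\<integral>\<^sup>+x. ennreal (dil M j x) * ennreal (p r z x) \<partial>lborel)"
        by (rule nn_integral_phi[OF M j]) measurable
      also have "\<dots> \<le> (\<integral>\<^sup>+x. ennreal G\<rho> * ennreal (p r z x) \<partial>lborel)"
        by (intro nn_integral_mono mult_right_mono ennreal_leI dil_le M j) auto
      also have "\<dots> = ennreal G\<rho> * (\<integral>\<^sup>+x. ennreal (p r z x) \<partial>lborel)" by (rule nn_integral_cmult) measurable
      also have "\<dots> \<le> ennreal G\<rho> * 1" by (intro mult_left_mono nn_integral_p_le) auto
      finally show "(\<integral>\<^sup>+x. ennreal (p r z (phi M j x)) \<partial>lborel) \<le> ennreal G\<rho>" by simp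
    next
      have "(\<integral>\<^sup>+x. ennreal (p r z x) \<partial>lborel) \<le> 1" by (rule nn_integral_p_le)
      also have "1 \<le> ennreal G\<rho>" using G\<rho>_ge_1 by simp
      finally show "(\<integral>\<^sup>+x. ennreal (p r z x) \<partial>lborel) \<le> ennreal G\<rho>" .
    qed auto
    also have "\<dots> = ennreal (Lam M * G\<rho>)"
    proof -
      have "(\<Sum>j\<le>M. ennreal \<bar>lw M j\<bar> * ennreal G\<rho>) = ennreal (\<Sum>j\<le>M. \<bar>lw M j\<bar> * G\<rho>)"
        using G\<rho>_ge_1 by (simp add: ennreal_mult[symmetric])
      then show ?thesis using G\<rho>_ge_1
        by (simp add: Lam_def distrib_right sum_distrib_right[symmetric] ennreal_plus[symmetric] sum_nonneg add.commute del: ennreal_plus)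
    qed
    finally show ?thesis .
  qed
  have b: "(\<integral>\<^sup>+z. ennreal \<bar>Kern M r z x\<bar> \<partial>lborel) \<le> ennreal (eta M R r * c4 * Dc)" for x
  proof -
    let ?q = "\<lambda>v. ennreal (gauss_const (C r) * exp (- (1/4) * gauss_form (C r) v))"
    note pd = pos_def_C[OF r]
    have "(\<integral>\<^sup>+z. ennreal \<bar>Kern M r z x\<bar> \<partial>lborel) \<le> (\<integral>\<^sup>+z. ennreal (eta M R r) * ?q (E r *v z + - y x) \<partial>lborel)"
      using Kern_bound[OF M R r, of _ x] eta_nonneg[OF R] gauss_const_pos[OF pd]
      by (intro nn_integral_mono) (auto simp: ennreal_mult[symmetric] intro!: ennreal_leI)
    also have "\<dots> = ennreal (eta M R r) * (\<integral>\<^sup>+z. ?q (E r *v z + - y x) \<partial>lborel)"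
      by (rule nn_integral_cmult) measurable
    also have "\<dots> \<le> ennreal (eta M R r) * (ennreal Dc * (\<integral>\<^sup>+z. ?q (z + - y x) \<partial>lborel))"
      unfolding E_def using r by (intro mult_left_mono Dc(2)) auto
    also have "(\<integral>\<^sup>+z. ?q (z + - y x) \<partial>lborel) = (\<integral>\<^sup>+z. ?q z \<partial>lborel)"
      by (rule nn_integral_lborel_shift) measurable
    also have "ennreal (eta M R r) * (ennreal Dc * (\<integral>\<^sup>+z. ?q z \<partial>lborel)) \<le> ennreal (eta M R r) * (ennreal Dc * ennreal c4)"
      by (intro mult_left_mono c4(2) pd) auto
    also have "\<dots> = ennreal (eta M R r * c4 * Dc)"
      using eta_nonneg[OF R] Dc(1) c4(1) by (simp add: ennreal_mult[symmetric] mult_ac)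
    finally show ?thesis .
  qed
  have "L2sq (\<lambda>z. LINT x|lborel. complex_of_real (Kern M r z x) * F x)
      \<le> ennreal (Lam M * G\<rho>) * ennreal (eta M R r * c4 * Dc) * L2sq F"
    by (rule schur_test[OF _ _ a b]) auto
  also have "ennreal (Lam M * G\<rho>) * ennreal (eta M R r * c4 * Dc) = ennreal (Lam M * G\<rho> * (eta M R r * c4 * Dc))"
    using eta_nonneg[OF R] Dc(1) c4(1) Lam_ge_1[of M] G\<rho>_ge_1 by (simp add: ennreal_mult)
  finally show ?thesis .
qed

end

section \<open>One step of the control\<close>

text \<open>Cauchy-Schwarz in time costs the length of J. The second estimate, for the integral of
  absolute values, is the one that yields convergence of Duhamel's integral at almost every
  point.\<close>

lemma L2sq_time_integral_le:
  fixes H :: "real \<Rightarrow> 'a::euclidean_space \<Rightarrow> complex" and J :: "real set"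
  assumes H[measurable]: "(\<lambda>w. H (fst w) (snd w)) \<in> borel_measurable (borel \<Otimes>\<^sub>M borel)"
    and J[measurable]: "J \<in> sets borel" and H0: "\<And>s x. s \<notin> J \<Longrightarrow> H s x = 0"
  shows "L2sq (\<lambda>x. LINT s|lborel. H s x) \<le> emeasure lborel J * (\<integral>\<^sup>+s. L2sq (H s) \<partial>lborel)"
    and "(\<integral>\<^sup>+x. (\<integral>\<^sup>+s. ennreal (cmod (H s x)) \<partial>lborel)\<^sup>2 \<partial>lborel) \<le> emeasure lborel J * (\<integral>\<^sup>+s. L2sq (H s) \<partial>lborel)"
proof -
  have Hm[measurable]: "(\<lambda>(s, x). H s x) \<in> borel_measurable (lborel \<Otimes>\<^sub>M lborel)"
    using H by (simp add: split_beta' cong: measurable_cong_sets sets_pair_measure_cong)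
  have [measurable]: "(\<lambda>s. H s x) \<in> borel_measurable borel" for x
    using measurable_compose[OF measurable_Pair[OF measurable_ident measurable_const] H, of x] by simp
  have pt: "(\<integral>\<^sup>+s. ennreal (cmod (H s x)) \<partial>lborel)\<^sup>2 \<le> emeasure lborel J * (\<integral>\<^sup>+s. ennreal ((cmod (H s x))\<^sup>2) \<partial>lborel)" for x
  proof -
    have "(\<integral>\<^sup>+s. ennreal (cmod (H s x)) \<partial>lborel) = (\<integral>\<^sup>+s. indicator J s * ennreal (cmod (H s x)) \<partial>lborel)"
      using H0 by (intro nn_integral_cong) (auto simp: indicator_def)
    then have "(\<integral>\<^sup>+s. ennreal (cmod (H s x)) \<partial>lborel)\<^sup>2
        \<le> (\<integral>\<^sup>+s. (indicator J s)\<^sup>2 \<partial>lborel) * (\<integral>\<^sup>+s. (ennreal (cmod (H s x)))\<^sup>2 \<partial>lborel)"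
      using Cauchy_Schwarz_nn_integral[of "indicator J" lborel "\<lambda>s. ennreal (cmod (H s x))"] by simp
    also have "(\<integral>\<^sup>+s. (indicator J s)\<^sup>2 \<partial>lborel) = (\<integral>\<^sup>+s. indicator J s \<partial>lborel)"
      by (intro nn_integral_cong) (auto simp: indicator_def)
    also have "\<dots> = emeasure lborel J" by simp
    finally show ?thesis by (simp add: ennreal_power)
  qed
  have sum: "(\<integral>\<^sup>+x. emeasure lborel J * (\<integral>\<^sup>+s. ennreal ((cmod (H s x))\<^sup>2) \<partial>lborel) \<partial>lborel)
      = emeasure lborel J * (\<integral>\<^sup>+s. L2sq (H s) \<partial>lborel)"
  proof -
    have "(\<integral>\<^sup>+x. emeasure lborel J * (\<integral>\<^sup>+s. ennreal ((cmod (H s x))\<^sup>2) \<partial>lborel) \<partial>lborel)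
        = emeasure lborel J * (\<integral>\<^sup>+x. (\<integral>\<^sup>+s. ennreal ((cmod (H s x))\<^sup>2) \<partial>lborel) \<partial>lborel)"
      by (rule nn_integral_cmult) measurable
    also have "(\<integral>\<^sup>+x. (\<integral>\<^sup>+s. ennreal ((cmod (H s x))\<^sup>2) \<partial>lborel) \<partial>lborel) = (\<integral>\<^sup>+s. L2sq (H s) \<partial>lborel)"
      unfolding L2sq_def by (rule lborel_pair.Fubini'[symmetric]) measurable
    finally show ?thesis .
  qed
  show "(\<integral>\<^sup>+x. (\<integral>\<^sup>+s. ennreal (cmod (H s x)) \<partial>lborel)\<^sup>2 \<partial>lborel) \<le> emeasure lborel J * (\<integral>\<^sup>+s. L2sq (H s) \<partial>lborel)"
    unfolding sum[symmetric] by (intro nn_integral_mono pt)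
  have "L2sq (\<lambda>x. LINT s|lborel. H s x) \<le> (\<integral>\<^sup>+x. (\<integral>\<^sup>+s. ennreal (cmod (H s x)) \<partial>lborel)\<^sup>2 \<partial>lborel)"
    unfolding L2sq_def
  proof (rule nn_integral_mono)
    fix x
    have "(ennreal (cmod (LINT s|lborel. H s x)))\<^sup>2 \<le> (\<integral>\<^sup>+s. ennreal (cmod (H s x)) \<partial>lborel)\<^sup>2"
      by (intro power_mono norm_integral_le_nn_integral) auto
    then show "ennreal ((cmod (LINT s|lborel. H s x))\<^sup>2) \<le> (\<integral>\<^sup>+s. ennreal (cmod (H s x)) \<partial>lborel)\<^sup>2"
      by (simp add: ennreal_power)
  qed
  also have "\<dots> \<le> emeasure lborel J * (\<integral>\<^sup>+s. L2sq (H s) \<partial>lborel)" by fact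
  finally show "L2sq (\<lambda>x. LINT s|lborel. H s x) \<le> emeasure lborel J * (\<integral>\<^sup>+s. L2sq (H s) \<partial>lborel)" .
qed

lemma ennreal_bound_finite:
  fixes a b :: ennreal
  assumes "a \<le> ennreal k * b" "b < \<infinity>" shows "a < \<infinity>"
  using assms by (auto intro: order_le_less_trans simp: ennreal_mult_less_top)

lemma L2sq_cmult:
  assumes [measurable]: "F \<in> borel_measurable borel"
  shows "L2sq (\<lambda>x. k * F x) = ennreal ((cmod k)\<^sup>2) * L2sq F"
  unfolding L2sq_def
  by (subst nn_integral_cmult[symmetric]) (auto simp: norm_mult power_mult_distrib ennreal_mult)

context ou_control
begin

text \<open>Acting before a + \<theta> leaves a time r \<ge> \<theta> of evolution until a + 2
  \<theta>, which is what makes the bound \<open>eta M R \<theta>\<close> available.\<close>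

definition ctrl :: "nat \<Rightarrow> real \<Rightarrow> real \<Rightarrow> (real^'n \<Rightarrow> complex) \<Rightarrow> real \<Rightarrow> real^'n \<Rightarrow> complex" where
  "ctrl M a \<theta> f s x = (if a < s \<and> s < a + \<theta> then complex_of_real (- 1 / \<theta>) * S M (W (s - a) f) x else 0)"

text \<open>Duhamel's formula for the state at time a + 2 \<theta>.\<close>

definition nxt :: "nat \<Rightarrow> real \<Rightarrow> real \<Rightarrow> (real^'n \<Rightarrow> complex) \<Rightarrow> real^'n \<Rightarrow> complex" where
  "nxt M a \<theta> f x = W (2 * \<theta>) f x + (LINT s|lborel. W (a + 2 * \<theta> - s) (ctrl M a \<theta> f s) x)"

lemma W_0 [simp]: "W t (\<lambda>_. 0) x = 0" by (simp add: W_def)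

lemma W_cmult: "W t (\<lambda>x. k * F x) x = k * W t F x"
  unfolding W_def by (subst integral_mult_right_zero[symmetric]) (simp add: mult_ac)

lemma ctrl_outside: "\<not> (a < s \<and> s < a + \<theta>) \<Longrightarrow> ctrl M a \<theta> f s = (\<lambda>_. 0)"
  by (auto simp: ctrl_def fun_eq_iff)

lemma ctrl_inside: "a < s \<and> s < a + \<theta> \<Longrightarrow> ctrl M a \<theta> f s = (\<lambda>x. complex_of_real (- 1 / \<theta>) * S M (W (s - a) f) x)"
  by (auto simp: ctrl_def fun_eq_iff)

lemma ctrl_measurable [measurable (raw)]:
  assumes [measurable]: "f \<in> borel_measurable borel" "g \<in> borel_measurable M'" "h \<in> borel_measurable M'"
  shows "(\<lambda>w. ctrl M a \<theta> f (g w) (h w)) \<in> borel_measurable M'"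
  unfolding ctrl_def by measurable

lemma nxt_measurable [measurable]:
  assumes [measurable]: "f \<in> borel_measurable borel"
  shows "nxt M a \<theta> f \<in> borel_measurable borel"
proof -
  have "(\<lambda>(x, s). W (a + 2 * \<theta> - s) (ctrl M a \<theta> f s) x) \<in> borel_measurable (borel \<Otimes>\<^sub>M lborel)"
    unfolding split_beta' by measurable
  then have [measurable]: "(\<lambda>x. LINT s|lborel. W (a + 2 * \<theta> - s) (ctrl M a \<theta> f s) x) \<in> borel_measurable borel"
    by (rule lborel.borel_measurable_lebesgue_integral)
  show ?thesis unfolding nxt_def by measurable
qed

lemma L2sq_ctrl:
  assumes M: "1 \<le> M" and \<theta>: "0 < \<theta>" and [measurable]: "f \<in> borel_measurable borel"
  shows "L2sq (ctrl M a \<theta> f s) \<le> ennreal ((1 / \<theta>)\<^sup>2 * (Lam M)\<^sup>2 * G\<rho> * Dc) * L2sq f"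
proof (cases "a < s \<and> s < a + \<theta>")
  case True
  have "L2sq (ctrl M a \<theta> f s) = ennreal ((1 / \<theta>)\<^sup>2) * L2sq (S M (W (s - a) f))"
    unfolding ctrl_inside[OF True] using \<theta> by (subst L2sq_cmult) (auto simp: norm_divide)
  also have "\<dots> \<le> ennreal ((1 / \<theta>)\<^sup>2) * (ennreal ((Lam M)\<^sup>2 * G\<rho>) * (ennreal Dc * L2sq f))"
    by (intro mult_left_mono order_trans[OF L2sq_S[OF M]] L2sq_W) auto
  also have "\<dots> = ennreal ((1 / \<theta>)\<^sup>2 * (Lam M)\<^sup>2 * G\<rho> * Dc) * L2sq f"
    using G\<rho>_ge_1 Dc(1) by (simp add: ennreal_mult mult.assoc)
  finally show ?thesis .
qed (simp add: ctrl_outside L2sq_def)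

lemma nn_integral_L2sq_ctrl:
  assumes M: "1 \<le> M" and \<theta>: "0 < \<theta>" and [measurable]: "f \<in> borel_measurable borel"
  shows "(\<integral>\<^sup>+s. L2sq (ctrl M a \<theta> f s) \<partial>lborel) \<le> ennreal ((1 / \<theta>) * (Lam M)\<^sup>2 * G\<rho> * Dc) * L2sq f"
proof -
  let ?c = "ennreal ((1 / \<theta>)\<^sup>2 * (Lam M)\<^sup>2 * G\<rho> * Dc) * L2sq f"
  have "(\<integral>\<^sup>+s. L2sq (ctrl M a \<theta> f s) \<partial>lborel) \<le> (\<integral>\<^sup>+s. ?c * indicator {a<..<a + \<theta>} s \<partial>lborel)"
  proof (rule nn_integral_mono)
    fix s show "L2sq (ctrl M a \<theta> f s) \<le> ?c * indicator {a<..<a + \<theta>} s"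
      using L2sq_ctrl[OF M \<theta> assms(3), of a s]
      by (cases "a < s \<and> s < a + \<theta>") (auto simp: ctrl_outside L2sq_def)
  qed
  also have "\<dots> = ?c * ennreal \<theta>"
    using \<theta> by (subst nn_integral_cmult_indicator) auto
  also have "\<dots> = ennreal ((1 / \<theta>)\<^sup>2 * (Lam M)\<^sup>2 * G\<rho> * Dc * \<theta>) * L2sq f"
    using \<theta> G\<rho>_ge_1 Dc(1) by (simp add: ennreal_mult'' mult_ac)
  also have "(1 / \<theta>)\<^sup>2 * (Lam M)\<^sup>2 * G\<rho> * Dc * \<theta> = (1 / \<theta>) * (Lam M)\<^sup>2 * G\<rho> * Dc"
    using \<theta> by (simp add: power2_eq_square)
  finally show ?thesis .
qed

text \<open>A product of two square-integrable functions of (s, y): for r s \<ge> \<theta>' the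
  kernel is bounded by some k, so its square is at most k times itself. This justifies exchanging
  time and space integrals.\<close>

lemma time_kernel_integrable:
  fixes r :: "real \<Rightarrow> real" and \<theta> a :: real
  assumes \<theta>: "0 < \<theta>" and r[measurable]: "r \<in> borel_measurable borel"
    and rb: "\<And>s. a < s \<Longrightarrow> s < a + \<theta> \<Longrightarrow> \<theta>' \<le> r s" and \<theta>': "0 < \<theta>'"
    and H[measurable]: "(\<lambda>w. H (fst w) (snd w)) \<in> borel_measurable (borel \<Otimes>\<^sub>M borel)"
    and H0: "\<And>s. \<not> (a < s \<and> s < a + \<theta>) \<Longrightarrow> H s = (\<lambda>_. 0)"
    and Hfin: "(\<integral>\<^sup>+s. L2sq (H s) \<partial>lborel) < \<infinity>"
  shows "integrable (lborel \<Otimes>\<^sub>M lborel) (\<lambda>(s, y). complex_of_real (p (r s) x y) * H s y)"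
proof -
  obtain k where k: "k > 0" "\<And>s x y. \<theta>' \<le> s \<Longrightarrow> p s x y \<le> k" using p_bounded[OF \<theta>'] by blast
  have [measurable]: "(\<lambda>w. r (fst w)) \<in> borel_measurable (lborel \<Otimes>\<^sub>M lborel)"
    by (rule measurable_compose[OF _ r]) simp
  have [measurable]: "(\<lambda>w. p (r (fst w)) x (snd w)) \<in> borel_measurable (lborel \<Otimes>\<^sub>M lborel)"
    by (rule p_measurable) (simp_all, measurable)
  have Hm[measurable]: "(\<lambda>w. H (fst w) (snd w)) \<in> borel_measurable (lborel \<Otimes>\<^sub>M lborel)"
    using H by (simp cong: measurable_cong_sets sets_pair_measure_cong)
  let ?I = "{a<..<a + \<theta>}"
  have 1: "(\<integral>\<^sup>+w. ennreal ((indicator ?I (fst w) * p (r (fst w)) x (snd w))\<^sup>2) \<partial>(lborel \<Otimes>\<^sub>M lborel)) < \<infinity>"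
  proof -
    have [measurable]: "(\<lambda>w. indicator ?I (fst w) * p (r (fst w)) x (snd w)) \<in> borel_measurable (lborel \<Otimes>\<^sub>M lborel)"
      by (intro borel_measurable_times measurable_compose[OF measurable_fst borel_measurable_indicator]) simp_all
    have "(\<integral>\<^sup>+w. ennreal ((indicator ?I (fst w) * p (r (fst w)) x (snd w))\<^sup>2) \<partial>(lborel \<Otimes>\<^sub>M lborel))
        = (\<integral>\<^sup>+s. (\<integral>\<^sup>+y. ennreal ((indicator ?I s * p (r s) x y)\<^sup>2) \<partial>lborel) \<partial>lborel)"
      by (subst lborel.nn_integral_fst[symmetric]) auto
    also have "\<dots> \<le> (\<integral>\<^sup>+s. ennreal k * indicator ?I s \<partial>lborel)"
    proof (rule nn_integral_mono)
      fix s
      show "(\<integral>\<^sup>+y. ennreal ((indicator ?I s * p (r s) x y)\<^sup>2) \<partial>lborel) \<le> ennreal k * indicator ?I s"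
      proof (cases "s \<in> ?I")
        case True
        have "(\<integral>\<^sup>+y. ennreal ((p (r s) x y)\<^sup>2) \<partial>lborel) \<le> (\<integral>\<^sup>+y. ennreal k * ennreal (p (r s) x y) \<partial>lborel)"
          using True k rb[of s] p_nonneg
          by (intro nn_integral_mono) (auto simp: power2_eq_square ennreal_mult[symmetric] intro!: ennreal_leI mult_right_mono)
        also have "\<dots> = ennreal k * (\<integral>\<^sup>+y. ennreal (p (r s) x y) \<partial>lborel)" by (rule nn_integral_cmult) measurable
        also have "\<dots> \<le> ennreal k * 1" by (intro mult_left_mono nn_integral_p_le) auto
        finally show ?thesis using True by simp
      qed simp
    qed
    also have "\<dots> = ennreal k * ennreal \<theta>" using \<theta> by (subst nn_integral_cmult_indicator) auto
    also have "\<dots> < \<infinity>" by (simp add: ennreal_mult_less_top)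
    finally show ?thesis .
  qed
  have 2: "(\<integral>\<^sup>+w. ennreal ((cmod (H (fst w) (snd w)))\<^sup>2) \<partial>(lborel \<Otimes>\<^sub>M lborel)) < \<infinity>"
    using Hfin unfolding L2sq_def by (subst lborel.nn_integral_fst[symmetric]) auto
  have "integrable (lborel \<Otimes>\<^sub>M lborel) (\<lambda>w. complex_of_real (indicator ?I (fst w) * p (r (fst w)) x (snd w)) * H (fst w) (snd w))"
    by (rule L2_mult_integrable[OF _ Hm 1 2]) measurable
  also have "(\<lambda>w. complex_of_real (indicator ?I (fst w) * p (r (fst w)) x (snd w)) * H (fst w) (snd w))
      = (\<lambda>(s, y). complex_of_real (p (r s) x y) * H s y)"
    using H0 by (auto simp: fun_eq_iff indicator_def)
  finally show ?thesis .
qed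

lemma integrable_W_ctrl:
  assumes M: "1 \<le> M" and \<theta>: "0 < \<theta>" and \<tau>: "a + 2 * \<theta> \<le> \<tau>"
    and [measurable]: "f \<in> borel_measurable borel" and f: "L2sq f < \<infinity>"
  shows "integrable lborel (\<lambda>s. W (\<tau> - s) (ctrl M a \<theta> f s) x)"
proof -
  have fin: "(\<integral>\<^sup>+s. L2sq (ctrl M a \<theta> f s) \<partial>lborel) < \<infinity>"
    by (rule ennreal_bound_finite[OF nn_integral_L2sq_ctrl[OF M \<theta> assms(4)] f])
  have "integrable (lborel \<Otimes>\<^sub>M lborel) (\<lambda>(s, y). complex_of_real (p (\<tau> - s) x y) * ctrl M a \<theta> f s y)"
    by (rule time_kernel_integrable[OF \<theta> _ _ \<theta> _ ctrl_outside fin]) (use \<tau> in auto)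
  from lborel_pair.integrable_fst'[OF this] show ?thesis by (simp add: W_def)
qed

text \<open>With 1 in place of S the Duhamel integrand would be - (1 / \<theta>) W (2 \<theta>) f by
  the semigroup law, constant over an interval of length \<theta>, and would cancel the free
  evolution. What survives is the part with \<open>Kern\<close>; \<open>?k\<close> spreads the free
  evolution evenly over that interval.\<close>

lemma nxt_eq:
  assumes M: "1 \<le> M" and \<theta>: "0 < \<theta>" "2 * \<theta> \<le> T"
    and [measurable]: "f \<in> borel_measurable borel" and f: "L2sq f < \<infinity>"
  shows "nxt M a \<theta> f x = (LINT s|lborel. (if a < s \<and> s < a + \<theta> then complex_of_real (- 1 / \<theta>) *
      (LINT y|lborel. complex_of_real (Kern M (a + 2 * \<theta> - s) x y) * W (s - a) f y) else 0))"
proof -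
  let ?w = "W (2 * \<theta>) f x"
  let ?k = "\<lambda>s. if a < s \<and> s < a + \<theta> then complex_of_real (1 / \<theta>) * ?w else 0"
  have k: "?k = (\<lambda>s. indicator {a<..<a + \<theta>} s *\<^sub>R (complex_of_real (1 / \<theta>) * ?w))"
    by (auto simp: fun_eq_iff indicator_def)
  have ki: "integrable lborel ?k" unfolding k by (rule integrable_indicator) (use \<theta> in auto)
  have kw: "(LINT s|lborel. ?k s) = ?w"
  proof -
    have "has_bochner_integral lborel ?k (measure lborel {a<..<a + \<theta>} *\<^sub>R (complex_of_real (1 / \<theta>) * ?w))"
      unfolding k by (rule has_bochner_integral_indicator) (use \<theta> in auto)
    then show ?thesis using \<theta> by (simp add: has_bochner_integral_integral_eq scaleR_conv_of_real)
  qed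
  have pt: "(if a < s \<and> s < a + \<theta> then complex_of_real (- 1 / \<theta>) *
      (LINT y|lborel. complex_of_real (Kern M (a + 2 * \<theta> - s) x y) * W (s - a) f y) else 0)
      = ?k s + W (a + 2 * \<theta> - s) (ctrl M a \<theta> f s) x" for s
  proof (cases "a < s \<and> s < a + \<theta>")
    case True
    have Wfin: "L2sq (W (s - a) f) < \<infinity>"
      by (rule ennreal_bound_finite[OF L2sq_W[OF assms(4)] f])
    have "W (a + 2 * \<theta> - s) (ctrl M a \<theta> f s) x = complex_of_real (- 1 / \<theta>) * W (a + 2 * \<theta> - s) (S M (W (s - a) f)) x"
      unfolding ctrl_inside[OF True] by (rule W_cmult)
    also have "W (a + 2 * \<theta> - s) (S M (W (s - a) f)) x = W (a + 2 * \<theta> - s) (W (s - a) f) x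
        + (LINT y|lborel. complex_of_real (Kern M (a + 2 * \<theta> - s) x y) * W (s - a) f y)"
      by (rule W_S(1)[OF M _ Wfin]) measurable
    also have "W (a + 2 * \<theta> - s) (W (s - a) f) x = ?w"
      using True \<theta> f by (subst W_semigroup) auto
    finally show ?thesis using True by (simp add: distrib_left)
  next
    case False
    show ?thesis by (simp only: if_not_P[OF False] ctrl_outside[OF False] W_0 add_0_left)
  qed
  have "(LINT s|lborel. ?k s + W (a + 2 * \<theta> - s) (ctrl M a \<theta> f s) x) = nxt M a \<theta> f x"
    unfolding nxt_def
    by (subst Bochner_Integration.integral_add[OF ki integrable_W_ctrl[OF M \<theta>(1) order_refl assms(4) f]]) (simp only: kw)
  then show ?thesis unfolding pt ..
qed

lemma eta_antimono:
  assumes "1 \<le> R" "0 < r" "r \<le> r'" shows "eta M R r' \<le> eta M R r"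
proof -
  have "cl * r ^ \<kappa> \<le> cl * r' ^ \<kappa>" using assms cl by (intro mult_left_mono power_mono) auto
  moreover have "0 < cl * r ^ \<kappa>" using assms cl by simp
  ultimately have "D\<^sup>2 / (cl * r' ^ \<kappa>) \<le> D\<^sup>2 / (cl * r ^ \<kappa>)" by (intro divide_left_mono) auto
  then have "3 / 2 * R\<^sup>2 * (D\<^sup>2 / (cl * r' ^ \<kappa>)) \<le> 3 / 2 * R\<^sup>2 * (D\<^sup>2 / (cl * r ^ \<kappa>))"
    by (intro mult_left_mono) auto
  then show ?thesis unfolding eta_def using Lam_ge_1[of M] assms by (intro mult_left_mono) auto
qed

text \<open>The factor 1 / \<theta>^2 of the control cancels against one \<theta> from
  Cauchy-Schwarz in time and one from the length of the interval, so \<theta> enters only through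
  \<open>eta\<close>.\<close>

lemma L2sq_nxt:
  assumes M: "1 \<le> M" and R: "1 \<le> R" and \<theta>: "0 < \<theta>" "2 * \<theta> \<le> T"
    and [measurable]: "f \<in> borel_measurable borel" and f: "L2sq f < \<infinity>"
  shows "L2sq (nxt M a \<theta> f) \<le> ennreal (Lam M * G\<rho> * (eta M R \<theta> * c4 * Dc) * Dc) * L2sq f"
proof -
  let ?I = "{a<..<a + \<theta>}"
  let ?H = "\<lambda>s x. if a < s \<and> s < a + \<theta> then complex_of_real (- 1 / \<theta>) *
      (LINT y|lborel. complex_of_real (Kern M (a + 2 * \<theta> - s) x y) * W (s - a) f y) else 0"
  let ?c = "Lam M * G\<rho> * (eta M R \<theta> * c4 * Dc)"
  have c0: "0 \<le> ?c" using Lam_ge_1[of M] G\<rho>_ge_1 eta_nonneg[OF R, of M \<theta>] c4(1) Dc(1) by simp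
  have Km: "(\<lambda>w. LINT y|lborel. complex_of_real (Kern M (a + 2 * \<theta> - fst w) (snd w) y) * W (fst w - a) f y)
      \<in> borel_measurable (borel \<Otimes>\<^sub>M borel)"
  proof (rule lborel.borel_measurable_lebesgue_integral)
    show "(\<lambda>(w, y). complex_of_real (Kern M (a + 2 * \<theta> - fst w) (snd w) y) * W (fst w - a) f y)
      \<in> borel_measurable ((borel \<Otimes>\<^sub>M borel) \<Otimes>\<^sub>M lborel)"
      unfolding split_beta' by measurable
  qed
  have Hm: "(\<lambda>w. ?H (fst w) (snd w)) \<in> borel_measurable (borel \<Otimes>\<^sub>M borel)"
    using Km by measurable
  have Hs: "L2sq (?H s) \<le> ennreal ((1 / \<theta>)\<^sup>2 * ?c * Dc) * L2sq f * indicator ?I s" for s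
  proof (cases "a < s \<and> s < a + \<theta>")
    case True
    let ?K = "\<lambda>x. LINT y|lborel. complex_of_real (Kern M (a + 2 * \<theta> - s) x y) * W (s - a) f y"
    have r: "0 < a + 2 * \<theta> - s" "a + 2 * \<theta> - s \<le> T" "\<theta> \<le> a + 2 * \<theta> - s" using True \<theta> by auto
    have [measurable]: "?K \<in> borel_measurable borel"
      using measurable_compose[OF measurable_Pair[OF measurable_const measurable_ident] Km, of s] by simp
    have "L2sq (?H s) = ennreal ((1 / \<theta>)\<^sup>2) * L2sq ?K"
      using True by (simp only: if_True simp_thms) (subst L2sq_cmult, auto simp: norm_divide)
    also have "L2sq ?K \<le> ennreal (Lam M * G\<rho> * (eta M R (a + 2 * \<theta> - s) * c4 * Dc)) * L2sq (W (s - a) f)"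
      by (rule L2sq_Kern[OF M R r(1,2)]) measurable
    also have "\<dots> \<le> ennreal ?c * (ennreal Dc * L2sq f)"
      using Lam_ge_1[of M] G\<rho>_ge_1 c4(1) Dc(1)
      by (intro mult_mono ennreal_leI L2sq_W mult_left_mono mult_right_mono eta_antimono R \<theta>(1) r(3)) auto
    finally have "L2sq (?H s) \<le> ennreal ((1 / \<theta>)\<^sup>2) * (ennreal ?c * (ennreal Dc * L2sq f))"
      by (simp add: mult_left_mono)
    also have "\<dots> = ennreal ((1 / \<theta>)\<^sup>2 * ?c * Dc) * L2sq f"
      unfolding ennreal_mult[OF mult_nonneg_nonneg[OF zero_le_power2[of "1 / \<theta>"] c0] order_trans[OF zero_le_one Dc(1)]]
        ennreal_mult[OF zero_le_power2[of "1 / \<theta>"] c0] by (simp only: mult.assoc)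
    finally show ?thesis using True by simp
  next
    case False
    then have "?H s = (\<lambda>_. 0)" by (intro ext if_not_P)
    then show ?thesis by (simp only: L2sq_def) simp
  qed
  have "L2sq (\<lambda>x. LINT s|lborel. ?H s x) \<le> emeasure lborel ?I * (\<integral>\<^sup>+s. L2sq (?H s) \<partial>lborel)"
    by (rule L2sq_time_integral_le(1)[OF Hm]) auto
  also have "\<dots> \<le> ennreal \<theta> * (\<integral>\<^sup>+s. ennreal ((1 / \<theta>)\<^sup>2 * ?c * Dc) * L2sq f * indicator ?I s \<partial>lborel)"
    using \<theta> by (intro mult_mono nn_integral_mono Hs) auto
  also have "\<dots> = ennreal \<theta> * (ennreal ((1 / \<theta>)\<^sup>2 * ?c * Dc) * L2sq f * ennreal \<theta>)"
    using \<theta> by (subst nn_integral_cmult_indicator) auto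
  also have "\<dots> = (ennreal \<theta> * ennreal ((1 / \<theta>)\<^sup>2 * ?c * Dc) * ennreal \<theta>) * L2sq f"
    by (simp only: mult_ac)
  also have "ennreal \<theta> * ennreal ((1 / \<theta>)\<^sup>2 * ?c * Dc) * ennreal \<theta> = ennreal (\<theta> * ((1 / \<theta>)\<^sup>2 * ?c * Dc) * \<theta>)"
  proof -
    have d0: "0 \<le> (1 / \<theta>)\<^sup>2 * ?c * Dc" 
      by (rule mult_nonneg_nonneg[OF mult_nonneg_nonneg[OF zero_le_power2 c0] order_trans[OF zero_le_one Dc(1)]])
    have t0: "0 \<le> \<theta>" using \<theta>(1) by simp
    show ?thesis
      unfolding ennreal_mult[OF t0 d0, symmetric] by (rule ennreal_mult[OF mult_nonneg_nonneg[OF t0 d0] t0, symmetric])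
  qed
  also have "\<theta> * ((1 / \<theta>)\<^sup>2 * ?c * Dc) * \<theta> = (\<theta> * (1 / \<theta>))\<^sup>2 * (?c * Dc)"
    by (simp only: power2_eq_square mult_ac)
  also have "\<dots> = ?c * Dc" using \<theta>(1) by simp
  also have "(\<lambda>x. LINT s|lborel. ?H s x) = nxt M a \<theta> f"
    by (intro ext nxt_eq[OF M \<theta> assms(5) f, symmetric])
  finally show ?thesis .
qed

text \<open>Restarting the evolution at b = a + 2 \<theta>: \<open>W (\<tau> - b)\<close> is pulled
  through the time integral by Fubini and merged with \<open>W (b - s)\<close> by the semigroup
  law.\<close>

lemma step_identity:
  assumes M: "1 \<le> M" and \<theta>: "0 < \<theta>" and a: "0 \<le> a" and \<tau>: "a + 2 * \<theta> < \<tau>" "\<tau> \<le> T"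
    and [measurable]: "f \<in> borel_measurable borel" and f: "L2sq f < \<infinity>"
  shows "W (\<tau> - a) f x + (LINT s|lborel. W (\<tau> - s) (ctrl M a \<theta> f s) x) = W (\<tau> - (a + 2 * \<theta>)) (nxt M a \<theta> f) x"
proof -
  define b where "b = a + 2 * \<theta>"
  let ?H = "\<lambda>s y. W (b - s) (ctrl M a \<theta> f s) y"
  let ?J = "\<lambda>y. LINT s|lborel. ?H s y"
  have cfin: "L2sq (ctrl M a \<theta> f s) < \<infinity>" for s
    by (rule ennreal_bound_finite[OF L2sq_ctrl[OF M \<theta> assms(6)] f])
  have Hm[measurable]: "(\<lambda>w. ?H (fst w) (snd w)) \<in> borel_measurable (borel \<Otimes>\<^sub>M borel)" by measurable
  have H0: "?H s = (\<lambda>_. 0)" if "\<not> (a < s \<and> s < a + \<theta>)" for s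
    by (rule ext) (simp only: ctrl_outside[OF that] W_0)
  have Hfin: "(\<integral>\<^sup>+s. L2sq (?H s) \<partial>lborel) < \<infinity>"
  proof -
    have "(\<integral>\<^sup>+s. L2sq (?H s) \<partial>lborel) \<le> (\<integral>\<^sup>+s. ennreal Dc * L2sq (ctrl M a \<theta> f s) \<partial>lborel)"
      by (intro nn_integral_mono L2sq_W) measurable
    also have "\<dots> = ennreal Dc * (\<integral>\<^sup>+s. L2sq (ctrl M a \<theta> f s) \<partial>lborel)"
    proof (rule nn_integral_cmult)
      show "(\<lambda>s. L2sq (ctrl M a \<theta> f s)) \<in> borel_measurable lborel" unfolding L2sq_def by measurable
    qed
    also have "\<dots> \<le> ennreal Dc * (ennreal ((1 / \<theta>) * (Lam M)\<^sup>2 * G\<rho> * Dc) * L2sq f)"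
      by (intro mult_left_mono nn_integral_L2sq_ctrl M \<theta>) auto
    also have "\<dots> < \<infinity>" using f by (simp add: ennreal_mult_less_top)
    finally show ?thesis .
  qed
  have Jm[measurable]: "?J \<in> borel_measurable borel"
  proof (rule lborel.borel_measurable_lebesgue_integral)
    show "(\<lambda>(y, s). ?H s y) \<in> borel_measurable (borel \<Otimes>\<^sub>M lborel)" unfolding split_beta' by measurable
  qed
  have Jfin: "L2sq ?J < \<infinity>"
  proof -
    have "L2sq ?J \<le> emeasure lborel {a<..<a + \<theta>} * (\<integral>\<^sup>+s. L2sq (?H s) \<partial>lborel)"
      by (rule L2sq_time_integral_le(1)[OF Hm]) (auto simp: H0)
    also have "\<dots> < \<infinity>" using Hfin \<theta> by (simp add: ennreal_mult_less_top)
    finally show ?thesis .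
  qed
  have Wfin: "L2sq (W (2 * \<theta>) f) < \<infinity>"
    by (rule ennreal_bound_finite[OF L2sq_W[OF assms(6)] f])
  have int: "integrable (lborel \<Otimes>\<^sub>M lborel) (\<lambda>(s, y). complex_of_real (p (\<tau> - b) x y) * ?H s y)"
    by (rule time_kernel_integrable[OF \<theta> _ _ _ Hm H0 Hfin, where r = "\<lambda>_. \<tau> - b" and \<theta>' = "\<tau> - b"]) (use \<tau> in \<open>auto simp: b_def\<close>)
  have "W (\<tau> - b) ?J x = (LINT y|lborel. (LINT s|lborel. complex_of_real (p (\<tau> - b) x y) * ?H s y))"
    by (simp add: W_def[of "\<tau> - b"])
  also have "\<dots> = (LINT s|lborel. (LINT y|lborel. complex_of_real (p (\<tau> - b) x y) * ?H s y))"
    by (rule lborel_pair.Fubini_integral[OF int])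
  also have "\<dots> = (LINT s|lborel. W (\<tau> - b) (?H s) x)" by (simp add: W_def[of "\<tau> - b"])
  also have "\<dots> = (LINT s|lborel. W (\<tau> - s) (ctrl M a \<theta> f s) x)"
  proof (rule Bochner_Integration.integral_cong[OF refl])
    fix s
    show "W (\<tau> - b) (?H s) x = W (\<tau> - s) (ctrl M a \<theta> f s) x"
    proof (cases "a < s \<and> s < a + \<theta>")
      case True
      have "W (\<tau> - b) (W (b - s) (ctrl M a \<theta> f s)) x = W ((\<tau> - b) + (b - s)) (ctrl M a \<theta> f s) x"
        using True \<tau> a \<theta> by (intro W_semigroup cfin) (auto simp: b_def)
      then show ?thesis by simp
    next
      case False
      then show ?thesis by (simp add: H0 ctrl_outside)
    qed
  qed
  finally have J: "W (\<tau> - b) ?J x = (LINT s|lborel. W (\<tau> - s) (ctrl M a \<theta> f s) x)" .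
  have "W (\<tau> - b) (nxt M a \<theta> f) x = W (\<tau> - b) (W (2 * \<theta>) f) x + W (\<tau> - b) ?J x"
    unfolding nxt_def b_def[symmetric] W_def[of "\<tau> - b"] distrib_left
    by (rule Bochner_Integration.integral_add) (auto intro!: W_integrable Jfin Wfin)
  also have "W (\<tau> - b) (W (2 * \<theta>) f) x = W (\<tau> - a) f x"
    using \<theta> \<tau> a f by (subst W_semigroup) (auto simp: b_def)
  finally have "W (\<tau> - b) (nxt M a \<theta> f) x = W (\<tau> - a) f x + (LINT s|lborel. W (\<tau> - s) (ctrl M a \<theta> f s) x)"
    unfolding J .
  then show ?thesis unfolding b_def ..
qed

end

section \<open>Iteration of the steps\<close>

context ou_control
begin

text \<open>Step k occupies the interval from \<open>tk k\<close> to \<open>tk (Suc k)\<close>, of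
  length T / 2^(k+1) = 2 * th k; its control lives in the first half, \<open>slot k\<close>.\<close>

definition tk :: "nat \<Rightarrow> real" where "tk k = T * (1 - (1/2) ^ k)"
definition th :: "nat \<Rightarrow> real" where "th k = T * (1/2) ^ (k + 2)"

lemma th_pos: "0 < th k" using T by (simp add: th_def)

lemma tk_Suc: "tk k + 2 * th k = tk (Suc k)"
  by (simp add: tk_def th_def algebra_simps)

lemma tk_0 [simp]: "tk 0 = 0" by (simp add: tk_def)

lemma tk_less: "tk k < T" using T by (simp add: tk_def algebra_simps)

lemma tk_mono: "k \<le> l \<Longrightarrow> tk k \<le> tk l"
  unfolding tk_def using T by (intro mult_left_mono diff_mono power_decreasing) auto

lemma tk_nonneg: "0 \<le> tk k" using tk_mono[of 0 k] by simp

lemma th_le: "2 * th k \<le> T"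
  using tk_Suc[of k] tk_less[of "Suc k"] tk_nonneg[of k] by linarith

definition slot :: "nat \<Rightarrow> real \<Rightarrow> bool" where "slot k s \<longleftrightarrow> tk k < s \<and> s < tk k + th k"

lemma slot_unique: assumes "slot k s" "slot l s" shows "k = l"
proof -
  have "\<not> k < l" if "slot k s" "slot l s" for k l
  proof
    assume "k < l"
    then have "tk (Suc k) \<le> tk l" by (intro tk_mono) simp
    then show False using that tk_Suc[of k] th_pos[of k] by (simp add: slot_def)
  qed
  then show ?thesis using assms by (meson linorder_neqE_nat)
qed

lemma slot_bounds: "slot k s \<Longrightarrow> 0 < s \<and> s < T"
  using tk_nonneg[of k] tk_Suc[of k] tk_less[of "Suc k"] th_pos[of k] by (simp add: slot_def)

primrec state :: "(nat \<Rightarrow> nat) \<Rightarrow> (real^'n \<Rightarrow> complex) \<Rightarrow> nat \<Rightarrow> real^'n \<Rightarrow> complex" where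
  "state Mk f0 0 = f0"
| "state Mk f0 (Suc k) = nxt (Mk k) (tk k) (th k) (state Mk f0 k)"

abbreviation "ctrl_k Mk f0 k \<equiv> ctrl (Mk k) (tk k) (th k) (state Mk f0 k)"

text \<open>The slots are disjoint, so at each time the series has at most one nonzero term.\<close>

definition U :: "(nat \<Rightarrow> nat) \<Rightarrow> (real^'n \<Rightarrow> complex) \<Rightarrow> real \<Rightarrow> real^'n \<Rightarrow> complex" where
  "U Mk f0 s x = (\<Sum>k. ctrl_k Mk f0 k s x)"

lemma ctrl_k_outside: "\<not> slot k s \<Longrightarrow> ctrl_k Mk f0 k s = (\<lambda>_. 0)"
  unfolding slot_def by (rule ctrl_outside)

lemma U_slot: assumes "slot k s" shows "U Mk f0 s = ctrl_k Mk f0 k s"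
proof
  fix x
  have "ctrl_k Mk f0 l s x = 0" if "l \<notin> {k}" for l
    using ctrl_k_outside[of l s Mk f0] slot_unique[OF assms, of l] that by fastforce
  then have "(\<Sum>l. ctrl_k Mk f0 l s x) = (\<Sum>l\<in>{k}. ctrl_k Mk f0 l s x)"
    by (intro suminf_finite) auto
  then show "U Mk f0 s x = ctrl_k Mk f0 k s x" by (simp add: U_def)
qed

lemma U_no_slot: assumes "\<And>k. \<not> slot k s" shows "U Mk f0 s = (\<lambda>_. 0)"
  using ctrl_k_outside[OF assms] by (simp add: U_def[abs_def])

context
  fixes Mk :: "nat \<Rightarrow> nat" and f0 :: "real^'n \<Rightarrow> complex"
  assumes Mk: "\<And>k. 1 \<le> Mk k" and f0[measurable]: "f0 \<in> borel_measurable borel" and f0_fin: "L2sq f0 < \<infinity>"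
begin

lemma state_measurable [measurable]: "state Mk f0 k \<in> borel_measurable borel"
  by (induction k) auto

lemma state_finite: "L2sq (state Mk f0 k) < \<infinity>"
proof (induction k)
  case (Suc k)
  show ?case unfolding state.simps
    by (rule ennreal_bound_finite[OF L2sq_nxt[OF Mk order_refl th_pos th_le state_measurable Suc] Suc])
qed (use f0_fin in simp)

lemma U_measurable [measurable (raw)]:
  assumes [measurable]: "g \<in> borel_measurable M'" "h \<in> borel_measurable M'"
  shows "(\<lambda>w. U Mk f0 (g w) (h w)) \<in> borel_measurable M'"
  unfolding U_def by measurable

lemma U_support: assumes "U Mk f0 s x \<noteq> 0" shows "0 < s" "s < T" "x \<in> \<omega>"
proof -
  obtain k where k: "slot k s" using assms U_no_slot[of s Mk f0] by force
  then show "0 < s" "s < T" using slot_bounds by auto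
  have "S (Mk k) (W (s - tk k) (state Mk f0 k)) x \<noteq> 0"
    using assms U_slot[OF k, of Mk f0] k by (auto simp: ctrl_def slot_def)
  then show "x \<in> \<omega>" by (rule S_support[OF Mk])
qed

text \<open>Telescoping of \<open>step_identity\<close>, always with final time T.\<close>

lemma final_identity:
  "W T f0 x + (\<Sum>k<m. LINT s|lborel. W (T - s) (ctrl_k Mk f0 k s) x) = W (T - tk m) (state Mk f0 m) x"
proof (induction m)
  case (Suc m)
  have "W (T - tk m) (state Mk f0 m) x + (LINT s|lborel. W (T - s) (ctrl_k Mk f0 m s) x)
      = W (T - (tk m + 2 * th m)) (nxt (Mk m) (tk m) (th m) (state Mk f0 m)) x"
    by (rule step_identity[OF Mk th_pos tk_nonneg _ order_refl state_measurable state_finite])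
      (simp add: tk_Suc tk_less)
  then show ?case using Suc by (simp add: tk_Suc add.assoc[symmetric])
qed simp

text \<open>Up to the factor \<open>G\<rho> * Dc\<close>, the k-th term of \<open>cost\<close>
  bounds the squared norm of the k-th control in space and time.\<close>

context
  assumes cost: "(\<Sum>k. ennreal ((1 / th k) * (Lam (Mk k))\<^sup>2) * L2sq (state Mk f0 k)) < \<infinity>"
begin

lemma sum_state_finite: "(\<Sum>k. L2sq (state Mk f0 k)) < \<infinity>"
proof -
  have "L2sq (state Mk f0 k) \<le> ennreal T * (ennreal ((1 / th k) * (Lam (Mk k))\<^sup>2) * L2sq (state Mk f0 k))" for k
  proof -
    have "th k \<le> T" using th_le[of k] th_pos[of k] by linarith
    then have "1 \<le> T * (1 / th k)" using th_pos[of k] by (simp add: le_divide_eq)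
    moreover have "1 \<le> (Lam (Mk k))\<^sup>2" using Lam_ge_1 by (rule one_le_power)
    ultimately have "1 * 1 \<le> (T * (1 / th k)) * (Lam (Mk k))\<^sup>2" by (intro mult_mono) auto
    then have "ennreal 1 \<le> ennreal (T * ((1 / th k) * (Lam (Mk k))\<^sup>2))" by (intro ennreal_leI) (simp add: mult.assoc)
    also have "\<dots> = ennreal T * ennreal ((1 / th k) * (Lam (Mk k))\<^sup>2)"
      using T th_pos[of k] by (intro ennreal_mult) auto
    finally have "1 * L2sq (state Mk f0 k) \<le> (ennreal T * ennreal ((1 / th k) * (Lam (Mk k))\<^sup>2)) * L2sq (state Mk f0 k)"
      by (intro mult_right_mono) auto
    then show ?thesis by (simp add: mult.assoc)
  qed
  then have "(\<Sum>k. L2sq (state Mk f0 k)) \<le> (\<Sum>k. ennreal T * (ennreal ((1 / th k) * (Lam (Mk k))\<^sup>2) * L2sq (state Mk f0 k)))"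
    by (intro suminf_le) auto
  also have "\<dots> = ennreal T * (\<Sum>k. ennreal ((1 / th k) * (Lam (Mk k))\<^sup>2) * L2sq (state Mk f0 k))"
    by (rule ennreal_suminf_cmult)
  also have "\<dots> < \<infinity>" using cost by (simp add: ennreal_mult_less_top)
  finally show ?thesis .
qed

lemma U_finite: "(\<integral>\<^sup>+s. L2sq (U Mk f0 s) \<partial>lborel) < \<infinity>"
proof -
  have "(\<integral>\<^sup>+s. L2sq (U Mk f0 s) \<partial>lborel) \<le> (\<integral>\<^sup>+s. (\<Sum>k. L2sq (ctrl_k Mk f0 k s)) \<partial>lborel)"
  proof (rule nn_integral_mono)
    fix s
    show "L2sq (U Mk f0 s) \<le> (\<Sum>k. L2sq (ctrl_k Mk f0 k s))"
    proof (cases "\<exists>k. slot k s")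
      case True
      then obtain k where k: "slot k s" by blast
      have "L2sq (U Mk f0 s) = (\<Sum>l\<in>{k}. L2sq (ctrl_k Mk f0 l s))" by (simp add: U_slot[OF k])
      also have "\<dots> \<le> (\<Sum>l. L2sq (ctrl_k Mk f0 l s))" by (rule sum_le_suminf) auto
      finally show ?thesis .
    next
      case False
      then have "U Mk f0 s = (\<lambda>_. 0)" by (intro U_no_slot) auto
      then show ?thesis by (simp add: L2sq_def)
    qed
  qed
  also have "\<dots> = (\<Sum>k. \<integral>\<^sup>+s. L2sq (ctrl_k Mk f0 k s) \<partial>lborel)"
  proof (rule nn_integral_suminf)
    show "(\<lambda>s. L2sq (ctrl_k Mk f0 k s)) \<in> borel_measurable lborel" for k unfolding L2sq_def by measurable
  qed
  also have "\<dots> \<le> (\<Sum>k. ennreal (G\<rho> * Dc) * (ennreal ((1 / th k) * (Lam (Mk k))\<^sup>2) * L2sq (state Mk f0 k)))"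
  proof (rule suminf_le)
    fix k
    have "(\<integral>\<^sup>+s. L2sq (ctrl_k Mk f0 k s) \<partial>lborel) \<le> ennreal ((1 / th k) * (Lam (Mk k))\<^sup>2 * G\<rho> * Dc) * L2sq (state Mk f0 k)"
      by (rule nn_integral_L2sq_ctrl[OF Mk th_pos state_measurable])
    also have "(1 / th k) * (Lam (Mk k))\<^sup>2 * G\<rho> * Dc = (G\<rho> * Dc) * ((1 / th k) * (Lam (Mk k))\<^sup>2)" by simp
    also have "ennreal \<dots> = ennreal (G\<rho> * Dc) * ennreal ((1 / th k) * (Lam (Mk k))\<^sup>2)"
      using G\<rho>_ge_1 Dc(1) th_pos[of k] by (intro ennreal_mult) auto
    finally show "(\<integral>\<^sup>+s. L2sq (ctrl_k Mk f0 k s) \<partial>lborel) \<le> ennreal (G\<rho> * Dc) * (ennreal ((1 / th k) * (Lam (Mk k))\<^sup>2) * L2sq (state Mk f0 k))"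
      by (simp only: mult.assoc)
  qed auto
  also have "\<dots> = ennreal (G\<rho> * Dc) * (\<Sum>k. ennreal ((1 / th k) * (Lam (Mk k))\<^sup>2) * L2sq (state Mk f0 k))"
    by (rule ennreal_suminf_cmult)
  also have "\<dots> < \<infinity>" using cost by (simp add: ennreal_mult_less_top)
  finally show ?thesis .
qed

text \<open>The time integral of absolute values is square-integrable in x, hence finite at almost
  every x.\<close>

lemma W_U_integrable: "AE x in lborel. integrable lborel (\<lambda>s. W (T - s) (U Mk f0 s) x)"
proof -
  let ?d = "\<lambda>s x. W (T - s) (U Mk f0 s) x"
  have dm[measurable]: "(\<lambda>w. ?d (fst w) (snd w)) \<in> borel_measurable (borel \<Otimes>\<^sub>M borel)" by measurable
  have d0: "?d s x = 0" if "s \<notin> {0<..<T}" for s x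
  proof -
    have "U Mk f0 s = (\<lambda>_. 0)" using that slot_bounds by (intro U_no_slot) force
    then show ?thesis by simp
  qed
  have "(\<integral>\<^sup>+x. (\<integral>\<^sup>+s. ennreal (cmod (?d s x)) \<partial>lborel)\<^sup>2 \<partial>lborel) \<le> emeasure lborel {0<..<T} * (\<integral>\<^sup>+s. L2sq (?d s) \<partial>lborel)"
    by (rule L2sq_time_integral_le(2)[OF dm _ d0]) auto
  also have "\<dots> \<le> emeasure lborel {0<..<T} * (\<integral>\<^sup>+s. ennreal Dc * L2sq (U Mk f0 s) \<partial>lborel)"
    by (intro mult_left_mono nn_integral_mono L2sq_W) measurable
  also have "(\<integral>\<^sup>+s. ennreal Dc * L2sq (U Mk f0 s) \<partial>lborel) = ennreal Dc * (\<integral>\<^sup>+s. L2sq (U Mk f0 s) \<partial>lborel)"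
  proof (rule nn_integral_cmult)
    show "(\<lambda>s. L2sq (U Mk f0 s)) \<in> borel_measurable lborel" unfolding L2sq_def by measurable
  qed
  also have "emeasure lborel {0<..<T} * (ennreal Dc * (\<integral>\<^sup>+s. L2sq (U Mk f0 s) \<partial>lborel)) < \<infinity>"
    using U_finite T by (simp add: ennreal_mult_less_top)
  finally have fin: "(\<integral>\<^sup>+x. (\<integral>\<^sup>+s. ennreal (cmod (?d s x)) \<partial>lborel)\<^sup>2 \<partial>lborel) < \<infinity>" .
  have "AE x in lborel. (\<integral>\<^sup>+s. ennreal (cmod (?d s x)) \<partial>lborel)\<^sup>2 \<noteq> \<infinity>"
  proof (rule nn_integral_noteq_infinite)
    show "(\<lambda>x. (\<integral>\<^sup>+s. ennreal (cmod (?d s x)) \<partial>lborel)\<^sup>2) \<in> borel_measurable lborel" by measurable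
  qed (use fin in simp)
  then show ?thesis
  proof eventually_elim
    case (elim x)
    then have "(\<integral>\<^sup>+s. ennreal (cmod (?d s x)) \<partial>lborel) < \<infinity>"
      by (auto simp: less_top power_eq_top_ennreal)
    then show ?case by (intro integrableI_bounded) auto
  qed
qed

text \<open>Summability of the squared norms makes the series of |.|^2 finite at almost every x, so
  its terms tend to 0 there along the full sequence.\<close>

lemma W_state_tendsto_0: "AE x in lborel. (\<lambda>m. W (T - tk m) (state Mk f0 m) x) \<longlonglongrightarrow> 0"
proof -
  let ?w = "\<lambda>m x. W (T - tk m) (state Mk f0 m) x"
  have "(\<integral>\<^sup>+x. (\<Sum>m. ennreal ((cmod (?w m x))\<^sup>2)) \<partial>lborel) = (\<Sum>m. L2sq (?w m))"
    unfolding L2sq_def by (rule nn_integral_suminf) measurable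
  also have "\<dots> \<le> (\<Sum>m. ennreal Dc * L2sq (state Mk f0 m))"
    by (intro suminf_le L2sq_W) auto
  also have "\<dots> = ennreal Dc * (\<Sum>m. L2sq (state Mk f0 m))" by (rule ennreal_suminf_cmult)
  also have "\<dots> < \<infinity>" using sum_state_finite by (simp add: ennreal_mult_less_top)
  finally have fin: "(\<integral>\<^sup>+x. (\<Sum>m. ennreal ((cmod (?w m x))\<^sup>2)) \<partial>lborel) < \<infinity>" .
  have "AE x in lborel. (\<Sum>m. ennreal ((cmod (?w m x))\<^sup>2)) \<noteq> \<infinity>"
  proof (rule nn_integral_noteq_infinite)
    show "(\<lambda>x. \<Sum>m. ennreal ((cmod (?w m x))\<^sup>2)) \<in> borel_measurable lborel" by measurable
  qed (use fin in simp)
  then show ?thesis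
  proof eventually_elim
    case (elim x)
    then have "summable (\<lambda>m. (cmod (?w m x))\<^sup>2)"
      by (intro summable_suminf_not_top) auto
    then have "(\<lambda>m. (cmod (?w m x))\<^sup>2) \<longlonglongrightarrow> 0" by (rule summable_LIMSEQ_zero)
    then have "(\<lambda>m. sqrt ((cmod (?w m x))\<^sup>2)) \<longlonglongrightarrow> sqrt 0" by (rule tendsto_real_sqrt)
    then show ?case by (simp add: tendsto_norm_zero_iff)
  qed
qed

text \<open>Let m tend to infinity in \<open>final_identity\<close>. The first m controls add up to
  the restriction of U to the first m slots, so the integrands are dominated by the one with U
  itself.\<close>

lemma final_state_zero: "AE x in lborel. W T f0 x + (LINT s|lborel. W (T - s) (U Mk f0 s) x) = 0"
  using W_U_integrable W_state_tendsto_0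
proof eventually_elim
  case (elim x)
  let ?d = "\<lambda>s. W (T - s) (U Mk f0 s) x"
  let ?e = "\<lambda>k s. W (T - s) (ctrl_k Mk f0 k s) x"
  have e_int: "integrable lborel (?e k)" for k
    by (rule integrable_W_ctrl[OF Mk th_pos _ state_measurable state_finite])
      (simp add: tk_Suc less_imp_le[OF tk_less])
  have part: "(\<Sum>k<m. ?e k s) = (if \<exists>k<m. slot k s then ?d s else 0)" for m s
  proof (cases "\<exists>k<m. slot k s")
    case True
    then obtain k where k: "k < m" "slot k s" by blast
    have "?e l s = (if l = k then ?d s else 0)" for l
    proof (cases "l = k")
      case False
      then have "\<not> slot l s" using slot_unique[OF k(2)] by blast
      then show ?thesis using False by (simp add: ctrl_k_outside)
    qed (simp add: U_slot[OF k(2)])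
    then show ?thesis using True k by simp
  next
    case False
    then have "?e l s = 0" if "l < m" for l using ctrl_k_outside[of l s Mk f0] that by auto
    then show ?thesis by (subst if_not_P[OF False]) simp
  qed
  have "(\<lambda>m. LINT s|lborel. (\<Sum>k<m. ?e k s)) \<longlonglongrightarrow> (LINT s|lborel. ?d s)"
  proof (rule integral_dominated_convergence[where w = "\<lambda>s. norm (?d s)"])
    show "AE s in lborel. (\<lambda>m. \<Sum>k<m. ?e k s) \<longlonglongrightarrow> ?d s"
    proof (rule AE_I2)
      fix s
      show "(\<lambda>m. \<Sum>k<m. ?e k s) \<longlonglongrightarrow> ?d s"
      proof (cases "\<exists>k. slot k s")
        case True
        then obtain k where k: "slot k s" by blast
        have "eventually (\<lambda>m. (\<Sum>k<m. ?e k s) = ?d s) sequentially"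
          using eventually_gt_at_top[of k] by eventually_elim (use k part in auto)
        then show ?thesis by (rule tendsto_eventually)
      next
        case False
        then have "U Mk f0 s = (\<lambda>_. 0)" by (intro U_no_slot) auto
        then show ?thesis using False by (simp only: part) simp
      qed
    qed
    show "AE s in lborel. norm (\<Sum>k<m. ?e k s) \<le> norm (?d s)" for m
      unfolding part by (rule AE_I2) auto
  qed (use elim(1) in \<open>auto intro: integrable_norm\<close>)
  moreover have "(LINT s|lborel. (\<Sum>k<m. ?e k s)) = W (T - tk m) (state Mk f0 m) x - W T f0 x" for m
    using final_identity[of x m]
    by (subst Bochner_Integration.integral_sum[OF e_int]) (simp add: algebra_simps)
  ultimately have "(\<lambda>m. W (T - tk m) (state Mk f0 m) x - W T f0 x) \<longlonglongrightarrow> (LINT s|lborel. ?d s)" by simp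
  moreover have "(\<lambda>m. W (T - tk m) (state Mk f0 m) x - W T f0 x) \<longlonglongrightarrow> 0 - W T f0 x"
    by (intro tendsto_diff elim(2) tendsto_const)
  ultimately have "(LINT s|lborel. ?d s) = 0 - W T f0 x" by (rule LIMSEQ_unique)
  then show ?case by simp
qed

end

end

end

section \<open>Null-controllability\<close>

context ou_control
begin

text \<open>
  Given \<open>Lam M \<le> q\<^sup>M\<close> and \<open>P = 2\<^sup>\<kappa>\<close>, take \<open>R = e q\<^sup>2\<^sup>P\<^sup>+\<^sup>2\<close>, then \<open>m\<close> large depending on \<open>R\<close>, and \<open>M\<^sub>k = m P\<^sup>k\<close>: the
  exponent \<open>R\<^sup>2 D\<^sup>2 / \<lambda>\<close> in \<open>eta\<close> also grows like \<open>P\<^sup>k\<close>.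
\<close>

lemma schedule_exists:
  obtains Mk R where "\<And>k. 1 \<le> Mk k" "1 \<le> R"
    "\<And>k. (Lam (Mk (Suc k)))\<^sup>2 * (Lam (Mk k) * G\<rho> * (eta (Mk k) R (th k) * c4 * Dc) * Dc) \<le> 1 / 4"
proof -
  define q where "q = 1 + 4 * exp 1 / \<rho>"
  have q: "1 \<le> q" using \<rho> by (simp add: q_def)
  define P :: nat where "P = 2 ^ \<kappa>"
  define Kc where "Kc = G\<rho> * c4 * Dc\<^sup>2"
  have "1 * 1 * 1 \<le> Kc"
    unfolding Kc_def using G\<rho>_ge_1 c4(1) Dc(1) by (intro mult_mono one_le_power) auto
  then have Kc: "1 \<le> Kc" by simp
  define A where "A = 3 / 2 * D\<^sup>2 * (4 / T) ^ \<kappa> / cl"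
  \<comment> \<open>The power of q absorbs four factors \<open>Lam\<close>: two at M_(k+1) = P M_k
    from the cost of the next control, one at M_k in \<open>eta\<close> and one from the crude Schur
    bound. The factor e leaves exp (- M_k) as net gain.\<close>
  define R where "R = q ^ (2 * P + 2) * exp 1"
  have "1 * 1 \<le> R" unfolding R_def using q by (intro mult_mono one_le_power) auto
  then have R: "1 \<le> R" by simp
  \<comment> \<open>The gain exp (- m P^k) has to beat the exponent A R^2 P^k of \<open>eta\<close>
    at time \<open>th k\<close> and still leave 1 / (4 Kc). Adding 1 keeps m positive.\<close>
  define m where "m = nat \<lceil>A * R\<^sup>2 + ln (4 * Kc)\<rceil> + 1"
  have m: "A * R\<^sup>2 + ln (4 * Kc) \<le> real m"
    unfolding m_def by (simp add: add.commute) linarith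
  define Mk where "Mk k = m * P ^ k" for k
  have Pk: "1 \<le> P ^ k" for k by (simp add: P_def)
  have Mk1: "1 \<le> Mk k" for k
    unfolding Mk_def m_def using Pk[of k] by (simp add: Suc_le_eq)
  have "(Lam (Mk (Suc k)))\<^sup>2 * (Lam (Mk k) * G\<rho> * (eta (Mk k) R (th k) * c4 * Dc) * Dc) \<le> 1 / 4" for k
  proof -
    have L: "0 \<le> Lam M" "Lam M \<le> q ^ M" if "1 \<le> M" for M
      using Lam_ge_1[of M] Lam_le[OF that] by (simp_all add: q_def)
    have L2: "(Lam (Mk k))\<^sup>2 \<le> (q ^ Mk k)\<^sup>2" "(Lam (Mk (Suc k)))\<^sup>2 \<le> (q ^ Mk (Suc k))\<^sup>2"
      using L[OF Mk1] by (auto intro: power_mono)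
    have MkS: "Mk (Suc k) = P * Mk k" by (simp add: Mk_def)
    have ex: "3 / 2 * R\<^sup>2 * (D\<^sup>2 / (cl * th k ^ \<kappa>)) = A * R\<^sup>2 * real (P ^ k)"
    proof -
      have "th k ^ \<kappa> = (T / 4) ^ \<kappa> / real (P ^ k)"
      proof -
        have "th k = (T / 4) / 2 ^ k" by (simp add: th_def power_divide)
        then have "th k ^ \<kappa> = (T / 4) ^ \<kappa> / (2 ^ k) ^ \<kappa>" by (simp add: power_divide)
        also have "(2 ^ k :: real) ^ \<kappa> = real (P ^ k)"
          by (simp add: P_def power_mult[symmetric] mult.commute)
        finally show ?thesis .
      qed
      moreover have "(4 / T) ^ \<kappa> = 1 / (T / 4) ^ \<kappa>" by (simp add: power_divide)
      ultimately show ?thesis using T cl by (simp add: A_def mult_ac)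
    qed
    have "(Lam (Mk (Suc k)))\<^sup>2 * (Lam (Mk k) * G\<rho> * (eta (Mk k) R (th k) * c4 * Dc) * Dc)
        = Kc * ((Lam (Mk (Suc k)))\<^sup>2 * (Lam (Mk k))\<^sup>2) * (exp (A * R\<^sup>2 * real (P ^ k)) / R ^ Mk k)"
      unfolding eta_def ex Kc_def by (simp add: power2_eq_square)
    also have "\<dots> \<le> Kc * ((q ^ Mk (Suc k))\<^sup>2 * (q ^ Mk k)\<^sup>2) * (exp (A * R\<^sup>2 * real (P ^ k)) / R ^ Mk k)"
      using Kc R L2 by (intro mult_right_mono mult_left_mono mult_mono) auto
    also have "(q ^ Mk (Suc k))\<^sup>2 * (q ^ Mk k)\<^sup>2 = (q ^ (2 * P + 2)) ^ Mk k"
      by (simp add: MkS power_mult[symmetric] power_add[symmetric] algebra_simps)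
    also have "R ^ Mk k = (q ^ (2 * P + 2)) ^ Mk k * exp (real (Mk k))"
      unfolding R_def power_mult_distrib by (simp add: exp_of_nat_mult[symmetric])
    also have "Kc * (q ^ (2 * P + 2)) ^ Mk k * (exp (A * R\<^sup>2 * real (P ^ k)) / ((q ^ (2 * P + 2)) ^ Mk k * exp (real (Mk k))))
        = Kc * exp (A * R\<^sup>2 * real (P ^ k) - real (Mk k))"
      using q by (simp add: exp_diff)
    also have "A * R\<^sup>2 * real (P ^ k) - real (Mk k) = (A * R\<^sup>2 - real m) * real (P ^ k)"
      by (simp add: Mk_def algebra_simps)
    also have "Kc * exp ((A * R\<^sup>2 - real m) * real (P ^ k)) \<le> Kc * exp (- ln (4 * Kc))"
    proof -
      have l: "0 \<le> ln (4 * Kc)" using Kc by simp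
      have "(A * R\<^sup>2 - real m) * real (P ^ k) \<le> (- ln (4 * Kc)) * real (P ^ k)"
        using m by (intro mult_right_mono) auto
      also have "\<dots> \<le> - ln (4 * Kc)"
      proof -
        have "1 \<le> real (P ^ k)" using Pk[of k] by linarith
        then have "ln (4 * Kc) * 1 \<le> ln (4 * Kc) * real (P ^ k)" using l by (rule mult_left_mono)
        then show ?thesis by simp
      qed
      finally show ?thesis using Kc by simp
    qed
    also have "\<dots> = 1 / 4" using Kc by (simp add: exp_minus)
    finally show ?thesis .
  qed
  then show ?thesis using that[of Mk R] Mk1 R by blast
qed

text \<open>The quantity X k gains a factor 1/4 per step, while 1 / th k only doubles, so the cost
  is dominated by a geometric series of ratio 1/2.\<close>

lemma cost_finite:
  assumes Mk: "\<And>k. 1 \<le> Mk k" and R: "1 \<le> R" and f0: "f0 \<in> borel_measurable borel" "L2sq f0 < \<infinity>"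
    and dec: "\<And>k. (Lam (Mk (Suc k)))\<^sup>2 * (Lam (Mk k) * G\<rho> * (eta (Mk k) R (th k) * c4 * Dc) * Dc) \<le> 1 / 4"
  shows "(\<Sum>k. ennreal ((1 / th k) * (Lam (Mk k))\<^sup>2) * L2sq (state Mk f0 k)) < \<infinity>"
proof -
  define X where "X k = ennreal ((Lam (Mk k))\<^sup>2) * L2sq (state Mk f0 k)" for k
  have Xstep: "X (Suc k) \<le> ennreal (1 / 4) * X k" for k
  proof -
    let ?c = "Lam (Mk k) * G\<rho> * (eta (Mk k) R (th k) * c4 * Dc) * Dc"
    have "X (Suc k) \<le> ennreal ((Lam (Mk (Suc k)))\<^sup>2) * (ennreal ?c * L2sq (state Mk f0 k))"
      unfolding X_def state.simps
      by (intro mult_left_mono L2sq_nxt Mk R th_pos th_le state_measurable state_finite f0) auto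
    also have "\<dots> = ennreal ((Lam (Mk (Suc k)))\<^sup>2 * ?c) * L2sq (state Mk f0 k)"
      by (subst ennreal_mult') (auto simp: mult.assoc)
    also have "\<dots> \<le> ennreal (1 / 4) * L2sq (state Mk f0 k)"
      by (intro mult_right_mono ennreal_leI dec) auto
    also have "\<dots> \<le> ennreal (1 / 4) * X k"
    proof -
      have "ennreal 1 \<le> ennreal ((Lam (Mk k))\<^sup>2)" by (intro ennreal_leI one_le_power Lam_ge_1)
      then have "1 * L2sq (state Mk f0 k) \<le> X k" unfolding X_def by (intro mult_right_mono) auto
      then show ?thesis by (intro mult_left_mono) auto
    qed
    finally show ?thesis .
  qed
  have X: "X k \<le> ennreal ((1 / 4) ^ k) * X 0" for k
  proof (induction k)
    case (Suc k)
    have "X (Suc k) \<le> ennreal (1 / 4) * (ennreal ((1 / 4) ^ k) * X 0)"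
      using Suc by (intro order_trans[OF Xstep] mult_left_mono) auto
    also have "\<dots> = ennreal ((1 / 4) ^ Suc k) * X 0"
      by (subst power_Suc, subst ennreal_mult) (auto simp: mult.assoc)
    finally show ?case .
  qed simp
  have "ennreal ((1 / th k) * (Lam (Mk k))\<^sup>2) * L2sq (state Mk f0 k) \<le> ennreal (4 / T * (1 / 2) ^ k) * X 0" for k
  proof -
    have t: "0 \<le> 1 / th k" using th_pos[of k] by simp
    have "ennreal ((1 / th k) * (Lam (Mk k))\<^sup>2) * L2sq (state Mk f0 k) = ennreal (1 / th k) * X k"
      unfolding X_def by (subst ennreal_mult[OF t]) (auto simp: mult.assoc)
    also have "\<dots> \<le> ennreal (1 / th k) * (ennreal ((1 / 4) ^ k) * X 0)" by (intro mult_left_mono X) auto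
    also have "\<dots> = ennreal ((1 / th k) * (1 / 4) ^ k) * X 0"
      by (subst ennreal_mult[OF t]) (auto simp: mult.assoc)
    also have "(1 / th k) * (1 / 4) ^ k = 4 / T * (1 / 2) ^ k"
    proof -
      have "(4 :: real) ^ k = 2 ^ k * 2 ^ k" by (simp flip: power_mult_distrib)
      then show ?thesis using T by (simp add: th_def power_divide field_simps)
    qed
    finally show ?thesis .
  qed
  then have "(\<Sum>k. ennreal ((1 / th k) * (Lam (Mk k))\<^sup>2) * L2sq (state Mk f0 k)) \<le> (\<Sum>k. ennreal (4 / T * (1 / 2) ^ k) * X 0)"
    by (intro suminf_le) auto
  also have "\<dots> = (\<Sum>k. ennreal (4 / T * (1 / 2) ^ k)) * X 0" by (rule ennreal_suminf_multc)
  also have "(\<Sum>k. ennreal (4 / T * (1 / 2) ^ k)) = ennreal (4 / T * 2)"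
    using T geometric_sums[of "1 / 2 :: real"] by (intro suminf_ennreal_eq sums_mult) auto
  also have "ennreal (4 / T * 2) * X 0 < \<infinity>"
    using f0(2) by (simp add: X_def ennreal_mult_less_top)
  finally show ?thesis .
qed

theorem null_controllable: "ou_null_controllable Q B \<omega> T"
  unfolding ou_null_controllable_def
proof (intro allI impI)
  fix f0 :: "real^'n \<Rightarrow> complex"
  assume L2: "L2_on UNIV f0"
  have f0[measurable]: "f0 \<in> borel_measurable borel"
    using L2 by (simp add: L2_on_def set_borel_measurable_def)
  have f0_fin: "L2sq f0 < \<infinity>"
    using L2 by (simp add: L2_on_def set_integrable_def integrable_iff_bounded L2sq_def)
  obtain Mk R where Mk: "\<And>k. 1 \<le> Mk k" and R: "1 \<le> R"
    and dec: "\<And>k. (Lam (Mk (Suc k)))\<^sup>2 * (Lam (Mk k) * G\<rho> * (eta (Mk k) R (th k) * c4 * Dc) * Dc) \<le> 1 / 4"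
    using schedule_exists by blast
  note cost = cost_finite[where Mk = Mk, OF Mk R f0 f0_fin dec]
  define u where "u = (\<lambda>(s, x). U Mk f0 s x)"
  have um[measurable]: "u \<in> borel_measurable borel"
    unfolding u_def split_beta'
    by (intro U_measurable[where Mk = Mk, OF Mk f0 f0_fin] borel_measurable_continuous_onI continuous_intros)
  have U0: "U Mk f0 s = (\<lambda>_. 0)" if "s \<notin> {0<..<T}" for s
    using U_support[where Mk = Mk, OF Mk f0 f0_fin] that by (intro ext) force
  have Um[measurable]: "U Mk f0 s \<in> borel_measurable borel" for s
    by (rule U_measurable[where Mk = Mk, OF Mk f0 f0_fin]) auto
  \<comment> \<open>The indicator of \<omega> has no effect because U is supported there. Outside
    (0, T) both sides vanish; inside, T - s lies in the range where the truncated kernel is the true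
    one.\<close>
  have duh: "indicator {0<..<T} s *\<^sub>R duhamel_integrand Q B \<omega> u T x s = W (T - s) (U Mk f0 s) x" for s x
  proof (cases "s \<in> {0<..<T}")
    case True
    have "(\<lambda>y. indicator \<omega> y * u (s, y)) = U Mk f0 s"
    proof
      fix y
      show "indicator \<omega> y * u (s, y) = U Mk f0 s y"
        using U_support(3)[where Mk = Mk, OF Mk f0 f0_fin, where s = s and x = y] by (cases "y \<in> \<omega>") (auto simp: u_def)
    qed
    then have "duhamel_integrand Q B \<omega> u T x s = W (T - s) (U Mk f0 s) x"
      unfolding duhamel_integrand_def using True by (simp only:) (intro ou_semigroup_eq_W; simp)
    then show ?thesis using True by simp
  next
    case False
    then show ?thesis by (simp add: U0)
  qed
  show "\<exists>u. L2_on ({0<..<T} \<times> UNIV) u \<and> (\<forall>p. p \<notin> {0<..<T} \<times> \<omega> \<longrightarrow> u p = 0) \<and>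
      (AE x in lborel. set_integrable lborel {0<..<T} (duhamel_integrand Q B \<omega> u T x)) \<and>
      (AE x in lborel. mild_solution Q B \<omega> f0 u T x = 0)"
  proof (intro exI[of _ u] conjI allI impI)
    have ST: "{0<..<T} \<times> (UNIV :: (real^'n) set) \<in> sets borel"
      by (intro borel_open open_Times) auto
    have "(\<lambda>p. ennreal ((cmod (u p))\<^sup>2)) \<in> borel_measurable (lborel \<Otimes>\<^sub>M lborel)"
      unfolding lborel_prod by measurable
    from lborel.nn_integral_fst[OF this]
    have "(\<integral>\<^sup>+p. ennreal ((cmod (u p))\<^sup>2) \<partial>lborel) = (\<integral>\<^sup>+s. L2sq (U Mk f0 s) \<partial>lborel)"
      by (simp add: L2sq_def u_def lborel_prod)
    also have "\<dots> < \<infinity>" by (rule U_finite[where Mk = Mk, OF Mk f0 f0_fin cost])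
    finally have fin: "(\<integral>\<^sup>+p. ennreal ((cmod (u p))\<^sup>2) \<partial>lborel) < \<infinity>" .
    have "integrable lborel (\<lambda>p. (cmod (u p))\<^sup>2)"
      using fin by (intro integrableI_bounded) auto
    then have "set_integrable lborel ({0<..<T} \<times> UNIV) (\<lambda>p. (cmod (u p))\<^sup>2)"
      unfolding set_integrable_def using ST by (intro integrable_mult_indicator) auto
    moreover have "set_borel_measurable lborel ({0<..<T} \<times> UNIV) u"
      unfolding set_borel_measurable_def using ST by measurable
    ultimately show "L2_on ({0<..<T} \<times> UNIV) u" by (simp add: L2_on_def)
    show "u p = 0" if "p \<notin> {0<..<T} \<times> \<omega>" for p
      using U_support[where Mk = Mk, OF Mk f0 f0_fin, where s = "fst p" and x = "snd p"] that by (cases p) (auto simp: u_def)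
    show "AE x in lborel. set_integrable lborel {0<..<T} (duhamel_integrand Q B \<omega> u T x)"
      using W_U_integrable[where Mk = Mk, OF Mk f0 f0_fin cost] unfolding set_integrable_def duh .
    show "AE x in lborel. mild_solution Q B \<omega> f0 u T x = 0"
      using final_state_zero[where Mk = Mk, OF Mk f0 f0_fin cost] T
      unfolding mild_solution_def set_lebesgue_integral_def duh by (simp add: ou_semigroup_eq_W)
  qed
qed

end

theorem theorem1p3:
  fixes Q B :: "real^'n^'n" and \<omega> :: "(real^'n) set" and T :: real
  assumes "transpose Q = Q"
    and "\<forall>x. 0 \<le> (Q *v x) \<bullet> x"
    and "rank (kalman_matrix Q B) = CARD('n)"
    and "0 < T"
    and "open \<omega>"
    and "\<exists>\<delta> r. 0 < \<delta> \<and> 0 < r \<and>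
           (\<forall>y. \<exists>y'\<in>\<omega>. ball y' r \<subseteq> \<omega> \<and> norm (y - y') < \<delta>)"
  shows "ou_null_controllable Q B \<omega> T"
proof -
  have Q: "sym_psd Q" using assms(1,2) by (simp add: sym_psd_def)
  obtain cl \<kappa> where cl: "cl > 0"
    "\<And>t x. 0 < t \<Longrightarrow> t \<le> T \<Longrightarrow> cl * t ^ \<kappa> * (x \<bullet> x) \<le> (ou_covariance Q B t *v x) \<bullet> x"
    using kalman_lower_bound[OF Q assms(3,4)] by blast
  interpret K: ou_kernel Q B T cl \<kappa> by unfold_locales (fact Q assms(4) cl)+
  obtain \<delta> r where dr: "0 < \<delta>" "0 < r" "\<forall>y. \<exists>y'\<in>\<omega>. ball y' r \<subseteq> \<omega> \<and> norm (y - y') < \<delta>"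
    using assms(6) by blast
  obtain d where d: "d > 0" "\<And>t f. 0 \<le> t \<Longrightarrow> t \<le> T \<Longrightarrow> f \<in> borel_measurable borel \<Longrightarrow>
    (\<integral>\<^sup>+x. f (K.E t *v x) \<partial>lborel) \<le> ennreal d * (\<integral>\<^sup>+x. f x \<partial>lborel)"
    using K.nn_integral_E_le by blast
  obtain e where e: "e > 0" "\<And>A :: real^'n^'n. pos_def A \<Longrightarrow>
      (\<integral>\<^sup>+x. ennreal (gauss_const A * exp (- (1/4) * gauss_form A x)) \<partial>lborel) = ennreal e"
    using nn_integral_gauss_quarter by blast
  show ?thesis
  proof (rule cells_exist[OF dr])
    fix c y :: "real^'n \<Rightarrow> real^'n" and D \<rho> :: real
    assume cells:
      "0 < D" "0 < \<rho>" "\<rho> \<le> 1"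
      "c \<in> borel_measurable borel" "y \<in> borel_measurable borel" "countable (range c)"
      "\<And>x x'. c x = c x' \<Longrightarrow> y x = y x'"
      "\<And>x. norm (x - y x) \<le> D"
      "\<And>x t. 0 < t \<Longrightarrow> t \<le> \<rho> \<Longrightarrow> c (y x + t *\<^sub>R (x - y x)) = c x"
      "\<And>x t. 0 < t \<Longrightarrow> t \<le> \<rho> \<Longrightarrow> y x + t *\<^sub>R (x - y x) \<in> \<omega>"
    \<comment> \<open>The maxima with 1 meet the normalisations \<open>1 \<le> Dc\<close> and
      \<open>1 \<le> c4\<close> of the locale.\<close>
    interpret ou_control Q B T cl \<kappa> \<omega> c y D \<rho> "max 1 d" "max 1 e"
    proof unfold_locales
      fix t and f :: "real^'n \<Rightarrow> ennreal" assume a: "0 \<le> t" "t \<le> T" "f \<in> borel_measurable borel"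
      have "(\<integral>\<^sup>+x. f (mexp (t *\<^sub>R B) *v x) \<partial>lborel) \<le> ennreal d * (\<integral>\<^sup>+x. f x \<partial>lborel)"
        using d(2)[OF a] by (simp add: K.E_def)
      also have "\<dots> \<le> ennreal (max 1 d) * (\<integral>\<^sup>+x. f x \<partial>lborel)" by (intro mult_right_mono ennreal_leI) auto
      finally show "(\<integral>\<^sup>+x. f (mexp (t *\<^sub>R B) *v x) \<partial>lborel) \<le> ennreal (max 1 d) * (\<integral>\<^sup>+x. f x \<partial>lborel)" .
    next
      fix A :: "real^'n^'n" assume A: "pos_def A"
      show "(\<integral>\<^sup>+x. ennreal (gauss_const A * exp (- (1/4) * gauss_form A x)) \<partial>lborel) \<le> ennreal (max 1 e)"
        unfolding e(2)[OF A] by (rule ennreal_leI) simp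
    qed (fact cells | simp)+
    show ?thesis by (rule null_controllable)
  qed
qed

end
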